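(* Let $M$ be a complete (connected) $n$-dimensional Riemannian manifold with metric $g$ and distance function $\rho$, let $x^*\in M$, and let $D\subseteq B_{x^*}(i(x^* ))$ be an open set containing $x^*$. Let $f:[0,+\infty)\times D\to TM$, with $f(t,x)\in T_xM$, be continuous in $t$ and locally Lipschitz in $x$, and suppose that $x^*$ is an equilibrium point of the system $$\dot x(t)=f(t,x(t)),\qquad t\ge t_0\ge 0, \qquad (\mathrm{S})$$ i.e. $f(t,x^* )=0$ for all $t\ge 0$. Let $r_0=\sup\{r>0:\ B_{x^*}(r)\subseteq D\}\in(0,+\infty)\cup\{+\infty\}$. Suppose there exist a continuously differentiable function $V:[0,+\infty)\times D\to\mathbb R$ and continuous functions $W_1,W_2,W_3:D\to\mathbb R$, each positive definite related to $x^*$ on $D$, such that for all $(t,x)\in[0,+\infty)\times D$ $$W_1(x)\le V(t,x)\le W_2(x),$$ $$V_t(t,x)+d_xV(t,x)(f(t,x))\le -W_3(x).$$ Then the following assertions hold. (i) For any $r\in(0,r_0)$ and any $c\in\bigl(0,\min_{\rho(x,x^* )=r}W_1(x)\bigr)$, there exists a class $\mathcal{KL}$ function $\beta$ such that the solution $x(\cdot)$ of (S) satisfies $$\rho(x^*,x(t))\le \beta\bigl(\rho(x^*,x(t_0)),\,t-t_0\bigr),\qquad \forall\, t\ge t_0\ge 0, \qquad (\mathrm{E})$$ for all initial states $x(t_0)\in\{x\in \mathrm{cl}\,B_{x^*}(r):\ W_2(x)\le c\}$, where $\mathrm{cl}\,B_{x^*}(r)$ is the closure of $B_{x^*}(r)$.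 (ii) If $$\lim_{\substack{\rho(x,x^* )\to r_0\\ x\in B_{x^*}(r_0)}}W_1(x)=+\infty,$$ then there exists a class $\mathcal{KL}$ function $\beta$ defined on $[0,r_0)\times[0,+\infty)$ such that (E) holds for all $x(t_0)\in B_{x^*}(r_0)$. (iii) If $r_0<+\infty$, $$\lim_{\substack{\rho(x,x^* )\to r_0\\ x\in B_{x^*}(r_0)}}\frac{W_1(x)}{r_0^2-\rho^2(x,x^* )}=+\infty,$$ and $$d_x\rho^2(x,x^* )\bigl(f(t,x)\bigr)\le 0,\qquad \forall\,(t,x)\in[0,+\infty)\times B_{x^*}(r_0),$$ then there exists a class $\mathcal{KL}$ function $\beta$ defined on $[0,r_0)\times[0,+\infty)$ such that (E) holds for all $x(t_0)\in B_{x^*}(r_0)$.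
   Context: For $x\in M$, $T_xM$ is the tangent space with inner product $\langle\cdot,\cdot\rangle$ and norm $|\cdot|$ given by $g$, $TM$ is the tangent bundle, $\exp_x:T_xM\to M$ is the exponential map of the Levi-Civita connection, and $\rho(\cdot,\cdot)$ is the Riemannian distance on $M$. For $r>0$, $B(O_x,r)=\{X\in T_xM:\ |X|<r\}$ and $B_x(r)=\{y\in M:\ \rho(x,y)<r\}$; $B_x(+\infty)$ means $M$. The injectivity radius $i(x)\in(0,+\infty]$ is the largest $r$ for which $\exp_x:B(O_x,r)\to B_x(r)$ is a diffeomorphism. $V_t(t,x)$ denotes the partial derivative of $V$ in $t$; $d_xV(t,x)$ denotes the partial differential of $V$ in $x$ (a linear functional on $T_xM$); $d_x\rho^2(x,x^* )$ is the differential at $x$ of the function $\rho^2(\cdot,x^* )$. A function $W:D\to\mathbb R$ is positive definite related to $x^*$ if $W(x^* )=0$ and $W(x)>0$ for every $x\in D\setminus\{x^*\}$. A continuous function $\alpha:[0,a)\to[0,+\infty)$ with $0<a\le+\infty$ is of class $\mathcal K$ if it is strictly increasing and $\alpha(0)=0$. A continuous function $\beta:[0,a)\times[0,+\infty)\to[0,+\infty)$ is of class $\mathcal{KL}$ if for each fixed $s$ the map $r\mapsto\beta(r,s)$ is of class $\mathcal K$, and for each fixed $r$ the map $s\mapsto\beta(r,s)$ is decreasing with $\beta(r,s)\to0$ as $s\to+\infty$. The function $\beta$ in each assertion does not depend on $t_0$ or on the initial state. "Locally Lipschitz in $x$" is understood in local coordinates, in the usual sense of ODE theory (locally in $x$,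 with a Lipschitz constant uniform for $t$ in compact intervals). *)

theory Defs
  imports "HOL-Analysis.Analysis"
begin

text \<open>
  The underlying set of the manifold is a whole type \<open>'m\<close>, modelled on a Euclidean space \<open>'e\<close> of
  dimension \<open>n = DIM('e)\<close>, so \<open>n \<ge> 1\<close>. A smooth structure is given by any smooth atlas; the atlas
  need not be maximal, and every notion below depends only on the structure it generates.
\<close>

section \<open>Smooth structure\<close>

primrec Ck_on :: "nat \<Rightarrow> 'a::real_normed_vector set \<Rightarrow> ('a \<Rightarrow> 'b::real_normed_vector) \<Rightarrow> bool" where
  "Ck_on 0 S f \<longleftrightarrow> continuous_on S f"
| "Ck_on (Suc k) S f \<longleftrightarrow>
     f differentiable_on S \<and> (\<forall>v. Ck_on k S (\<lambda>x. frechet_derivative f (at x) v))"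

definition smooth_on :: "'a::real_normed_vector set \<Rightarrow> ('a \<Rightarrow> 'b::real_normed_vector) \<Rightarrow> bool" where
  "smooth_on S f \<longleftrightarrow> open S \<and> (\<forall>k. Ck_on k S f)"

text \<open>The coordinate map of a chart is only meaningful on the domain of the chart.\<close>

type_synonym ('m, 'e) chart = "'m set \<times> ('m \<Rightarrow> 'e)"

abbreviation cdom :: "('m, 'e) chart \<Rightarrow> 'm set" where "cdom \<equiv> fst"
abbreviation cmap :: "('m, 'e) chart \<Rightarrow> 'm \<Rightarrow> 'e" where "cmap \<equiv> snd"

definition cinv :: "('m, 'e) chart \<Rightarrow> 'e \<Rightarrow> 'm" where
  "cinv c = inv_into (cdom c) (cmap c)"

definition smooth_atlas ::
    "('m::{t2_space,second_countable_topology}, 'e::euclidean_space) chart set \<Rightarrow> bool" where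
  "smooth_atlas A \<longleftrightarrow>
     (\<forall>c\<in>A. open (cdom c) \<and> open (cmap c ` cdom c)
            \<and> homeomorphism (cdom c) (cmap c ` cdom c) (cmap c) (cinv c))
     \<and> (\<Union>c\<in>A. cdom c) = UNIV
     \<and> (\<forall>c\<in>A. \<forall>d\<in>A. smooth_on (cmap c ` (cdom c \<inter> cdom d)) (cmap d \<circ> cinv c))"

section \<open>Tangent vectors and differentials\<close>

text \<open>
  A tangent vector at \<open>x\<close> is the family of its components in all charts around \<open>x\<close>, the components
  being related by the derivatives of the transition maps. Components in charts not containing \<open>x\<close>
  are \<open>0\<close>, so that equality of tangent vectors at \<open>x\<close> is equality of functions.
\<close>

type_synonym ('m, 'e) tvec = "('m, 'e) chart \<Rightarrow> 'e"

definition tangent_space ::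
    "('m, 'e::euclidean_space) chart set \<Rightarrow> 'm \<Rightarrow> ('m, 'e) tvec set" where
  "tangent_space A x =
     {X. (\<forall>c\<in>A. \<forall>d\<in>A. x \<in> cdom c \<inter> cdom d \<longrightarrow>
            X d = frechet_derivative (cmap d \<circ> cinv c) (at (cmap c x)) (X c))
       \<and> (\<forall>c. c \<notin> A \<or> x \<notin> cdom c \<longrightarrow> X c = 0)}"

text \<open>The tangent vector at \<open>x\<close> whose component in the chart \<open>c\<close> is \<open>v\<close>.\<close>

definition coord_vec ::
    "('m, 'e::euclidean_space) chart set \<Rightarrow> ('m, 'e) chart \<Rightarrow> 'm \<Rightarrow> 'e \<Rightarrow> ('m, 'e) tvec" where
  "coord_vec A c x v =
     (\<lambda>d. if d \<in> A \<and> x \<in> cdom d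
           then frechet_derivative (cmap d \<circ> cinv c) (at (cmap c x)) v else 0)"

text \<open>
  \<open>mdiff A h x X\<close> is \<open>d\<^sub>xh(X)\<close>; for \<open>h\<close> differentiable at \<open>x\<close> it does not depend on the chart
  that is chosen.
\<close>

definition mdiff ::
    "('m, 'e::euclidean_space) chart set \<Rightarrow> ('m \<Rightarrow> real) \<Rightarrow> 'm \<Rightarrow> ('m, 'e) tvec \<Rightarrow> real" where
  "mdiff A h x X =
     (let c = (SOME c. c \<in> A \<and> x \<in> cdom c)
      in frechet_derivative (h \<circ> cinv c) (at (cmap c x)) (X c))"

definition has_velocity ::
    "('m::t2_space, 'e::euclidean_space) chart set \<Rightarrow> real set \<Rightarrow> (real \<Rightarrow> 'm) \<Rightarrow> real \<Rightarrow>
     ('m, 'e) tvec \<Rightarrow> bool" where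
  "has_velocity A I \<gamma> t X \<longleftrightarrow>
     continuous (at t within I) \<gamma> \<and> X \<in> tangent_space A (\<gamma> t)
     \<and> (\<forall>c\<in>A. \<gamma> t \<in> cdom c \<longrightarrow> ((cmap c \<circ> \<gamma>) has_vector_derivative X c) (at t within I))"

section \<open>Riemannian metric and distance\<close>

type_synonym ('m, 'e) metric = "'m \<Rightarrow> ('m, 'e) tvec \<Rightarrow> ('m, 'e) tvec \<Rightarrow> real"

text \<open>The metric in the chart \<open>c\<close>, at the coordinate point \<open>u\<close>.\<close>

definition metric_in ::
    "('m, 'e::euclidean_space) chart set \<Rightarrow> ('m, 'e) metric \<Rightarrow> ('m, 'e) chart \<Rightarrow>
     'e \<Rightarrow> 'e \<Rightarrow> 'e \<Rightarrow> real" where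
  "metric_in A g c u v w =
     g (cinv c u) (coord_vec A c (cinv c u) v) (coord_vec A c (cinv c u) w)"

definition riemannian_metric ::
    "('m, 'e::euclidean_space) chart set \<Rightarrow> ('m, 'e) metric \<Rightarrow> bool" where
  "riemannian_metric A g \<longleftrightarrow>
     (\<forall>x. \<forall>X\<in>tangent_space A x. \<forall>Y\<in>tangent_space A x. \<forall>Z\<in>tangent_space A x. \<forall>a b.
        g x X Y = g x Y X
        \<and> g x (\<lambda>c. a *\<^sub>R X c + b *\<^sub>R Y c) Z = a * g x X Z + b * g x Y Z
        \<and> (X \<noteq> (\<lambda>c. 0) \<longrightarrow> 0 < g x X X))
     \<and> (\<forall>c\<in>A. \<forall>v w. smooth_on (cmap c ` cdom c) (\<lambda>u. metric_in A g c u v w))"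

definition tnorm :: "('m, 'e) metric \<Rightarrow> 'm \<Rightarrow> ('m, 'e) tvec \<Rightarrow> real" where
  "tnorm g x X = sqrt (g x X X)"

definition C1_curve_on ::
    "('m::t2_space, 'e::euclidean_space) chart set \<Rightarrow> real set \<Rightarrow> (real \<Rightarrow> 'm) \<Rightarrow> bool" where
  "C1_curve_on A I \<gamma> \<longleftrightarrow>
     (\<exists>\<gamma>'. (\<forall>t\<in>I. has_velocity A I \<gamma> t (\<gamma>' t))
         \<and> (\<forall>c\<in>A. continuous_on {t \<in> I. \<gamma> t \<in> cdom c} (\<lambda>t. \<gamma>' t c)))"

text \<open>The set \<open>S\<close> consists of the points of a partition of \<open>[0,1]\<close>.\<close>

definition piecewise_C1_curve ::
    "('m::t2_space, 'e::euclidean_space) chart set \<Rightarrow> (real \<Rightarrow> 'm) \<Rightarrow> bool" where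
  "piecewise_C1_curve A \<gamma> \<longleftrightarrow>
     continuous_on {0..1} \<gamma>
     \<and> (\<exists>S. finite S \<and> {0, 1} \<subseteq> S \<and> S \<subseteq> {0..1}
          \<and> (\<forall>a\<in>S. \<forall>b\<in>S. a < b \<and> S \<inter> {a<..<b} = {} \<longrightarrow> C1_curve_on A {a..b} \<gamma>))"

text \<open>The velocity is arbitrary at the finitely many break points of a piecewise C1 curve.\<close>

definition velocity ::
    "('m::t2_space, 'e::euclidean_space) chart set \<Rightarrow> (real \<Rightarrow> 'm) \<Rightarrow> real \<Rightarrow> ('m, 'e) tvec" where
  "velocity A \<gamma> t = (SOME X. has_velocity A UNIV \<gamma> t X)"

definition curve_length ::
    "('m::t2_space, 'e::euclidean_space) chart set \<Rightarrow> ('m, 'e) metric \<Rightarrow> (real \<Rightarrow> 'm) \<Rightarrow> real" where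
  "curve_length A g \<gamma> = integral {0..1} (\<lambda>t. tnorm g (\<gamma> t) (velocity A \<gamma> t))"

definition rdist ::
    "('m::t2_space, 'e::euclidean_space) chart set \<Rightarrow> ('m, 'e) metric \<Rightarrow> 'm \<Rightarrow> 'm \<Rightarrow> real" where
  "rdist A g x y =
     Inf {curve_length A g \<gamma> |\<gamma>. piecewise_C1_curve A \<gamma> \<and> \<gamma> 0 = x \<and> \<gamma> 1 = y}"

definition rball ::
    "('m::t2_space, 'e::euclidean_space) chart set \<Rightarrow> ('m, 'e) metric \<Rightarrow> 'm \<Rightarrow> ereal \<Rightarrow> 'm set" where
  "rball A g x r = {y. ereal (rdist A g x y) < r}"

section \<open>Geodesics, exponential map, injectivity radius\<close>

text \<open>
  \<open>christoffel A g c u v w\<close> is \<open>\<Sum>\<^sub>k \<Gamma>\<^sup>k\<^sub>i\<^sub>j v\<^sup>i w\<^sup>j e\<^sub>k\<close> for the Levi-Civita connection in the chart \<open>c\<close>: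
  the Koszul formula for the constant coordinate fields \<open>v\<close>, \<open>w\<close>, \<open>y\<close>, whose brackets vanish.
\<close>

definition christoffel ::
    "('m, 'e::euclidean_space) chart set \<Rightarrow> ('m, 'e) metric \<Rightarrow> ('m, 'e) chart \<Rightarrow>
     'e \<Rightarrow> 'e \<Rightarrow> 'e \<Rightarrow> 'e" where
  "christoffel A g c u v w =
     (THE z. \<forall>y. 2 * metric_in A g c u z y =
          frechet_derivative (\<lambda>p. metric_in A g c p w y) (at u) v
        + frechet_derivative (\<lambda>p. metric_in A g c p v y) (at u) w
        - frechet_derivative (\<lambda>p. metric_in A g c p v w) (at u) y)"

text \<open>Geodesics defined on the whole real line.\<close>

definition geodesic ::
    "('m::t2_space, 'e::euclidean_space) chart set \<Rightarrow> ('m, 'e) metric \<Rightarrow> (real \<Rightarrow> 'm) \<Rightarrow> bool" where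
  "geodesic A g \<gamma> \<longleftrightarrow>
     (\<exists>\<gamma>'. (\<forall>t. has_velocity A UNIV \<gamma> t (\<gamma>' t))
         \<and> (\<forall>t. \<forall>c\<in>A. \<gamma> t \<in> cdom c \<longrightarrow>
              ((\<lambda>s. \<gamma>' s c) has_vector_derivative
                 - christoffel A g c (cmap c (\<gamma> t)) (\<gamma>' t c) (\<gamma>' t c)) (at t)))"

definition geodesic_from ::
    "('m::t2_space, 'e::euclidean_space) chart set \<Rightarrow> ('m, 'e) metric \<Rightarrow> 'm \<Rightarrow> ('m, 'e) tvec \<Rightarrow>
     (real \<Rightarrow> 'm) \<Rightarrow> bool" where
  "geodesic_from A g x X \<gamma> \<longleftrightarrow> geodesic A g \<gamma> \<and> \<gamma> 0 = x \<and> has_velocity A UNIV \<gamma> 0 X"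

text \<open>
  Completeness is geodesic completeness: every exponential map is defined on the whole tangent space.
\<close>

definition complete_riemannian_manifold ::
    "('m::{t2_space,second_countable_topology}, 'e::euclidean_space) chart set \<Rightarrow>
     ('m, 'e) metric \<Rightarrow> bool" where
  "complete_riemannian_manifold A g \<longleftrightarrow>
     smooth_atlas A \<and> riemannian_metric A g
     \<and> (\<forall>x. \<forall>X\<in>tangent_space A x. \<exists>\<gamma>. geodesic_from A g x X \<gamma>)"

definition rexp ::
    "('m::t2_space, 'e::euclidean_space) chart set \<Rightarrow> ('m, 'e) metric \<Rightarrow> 'm \<Rightarrow> ('m, 'e) tvec \<Rightarrow> 'm" where
  "rexp A g x X = (THE y. \<exists>\<gamma>. geodesic_from A g x X \<gamma> \<and> y = \<gamma> 1)"

text \<open>Diffeomorphism from an open subset of the model space onto an open subset of the manifold.\<close>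

definition diffeo_onto ::
    "('m::t2_space, 'e::euclidean_space) chart set \<Rightarrow> 'e set \<Rightarrow> 'm set \<Rightarrow> ('e \<Rightarrow> 'm) \<Rightarrow> bool" where
  "diffeo_onto A N B F \<longleftrightarrow>
     open N \<and> open B \<and> bij_betw F N B \<and> continuous_on N F
     \<and> (\<forall>d\<in>A. smooth_on (N \<inter> F -` cdom d) (cmap d \<circ> F)
            \<and> smooth_on (cmap d ` (cdom d \<inter> B)) (inv_into N F \<circ> cinv d))"

text \<open>
  The smooth structure of the vector space \<open>T\<^sub>xM\<close> is that of \<open>'e\<close>, through the linear isomorphism
  \<open>v \<mapsto> coord_vec A c x v\<close> for any chart \<open>c\<close> around \<open>x\<close>.
\<close>

definition exp_diffeo ::
    "('m::t2_space, 'e::euclidean_space) chart set \<Rightarrow> ('m, 'e) metric \<Rightarrow> 'm \<Rightarrow> ereal \<Rightarrow> bool" where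
  "exp_diffeo A g x r \<longleftrightarrow>
     (\<forall>c\<in>A. x \<in> cdom c \<longrightarrow>
        diffeo_onto A {v. ereal (tnorm g x (coord_vec A c x v)) < r} (rball A g x r)
          (\<lambda>v. rexp A g x (coord_vec A c x v)))"

definition inj_radius ::
    "('m::t2_space, 'e::euclidean_space) chart set \<Rightarrow> ('m, 'e) metric \<Rightarrow> 'm \<Rightarrow> ereal" where
  "inj_radius A g x = Sup {r. 0 < r \<and> exp_diffeo A g x r}"

section \<open>Time-dependent vector fields, functions and solutions\<close>

definition vector_field_on ::
    "('m, 'e::euclidean_space) chart set \<Rightarrow> 'm set \<Rightarrow> (real \<Rightarrow> 'm \<Rightarrow> ('m, 'e) tvec) \<Rightarrow> bool" where
  "vector_field_on A D f \<longleftrightarrow> (\<forall>t\<ge>0. \<forall>x\<in>D. f t x \<in> tangent_space A x)"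

definition continuous_in_time ::
    "('m, 'e::euclidean_space) chart set \<Rightarrow> 'm set \<Rightarrow> (real \<Rightarrow> 'm \<Rightarrow> ('m, 'e) tvec) \<Rightarrow> bool" where
  "continuous_in_time A D f \<longleftrightarrow>
     (\<forall>x\<in>D. \<forall>c\<in>A. x \<in> cdom c \<longrightarrow> continuous_on {0..} (\<lambda>t. f t x c))"

definition locally_lipschitz_in_state ::
    "('m, 'e::euclidean_space) chart set \<Rightarrow> 'm set \<Rightarrow> (real \<Rightarrow> 'm \<Rightarrow> ('m, 'e) tvec) \<Rightarrow> bool" where
  "locally_lipschitz_in_state A D f \<longleftrightarrow>
     (\<forall>c\<in>A. local_lipschitz {0..} (cmap c ` (cdom c \<inter> D)) (\<lambda>t u. f t (cinv c u) c))"

text \<open>Continuous differentiability on \<open>[0,\<infinity>) \<times> D\<close>, one-sided in time at \<open>t = 0\<close>.\<close>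

definition C1_time_state ::
    "('m, 'e::euclidean_space) chart set \<Rightarrow> 'm set \<Rightarrow> (real \<Rightarrow> 'm \<Rightarrow> real) \<Rightarrow> bool" where
  "C1_time_state A D V \<longleftrightarrow>
     (\<forall>c\<in>A. let S = {0..} \<times> cmap c ` (cdom c \<inter> D) in
        \<exists>V' :: real \<times> 'e \<Rightarrow> (real \<times> 'e) \<Rightarrow>\<^sub>L real.
          continuous_on S V'
          \<and> (\<forall>p\<in>S. ((\<lambda>(t, u). V t (cinv c u)) has_derivative blinfun_apply (V' p)) (at p within S)))"

definition time_deriv :: "(real \<Rightarrow> 'm \<Rightarrow> real) \<Rightarrow> real \<Rightarrow> 'm \<Rightarrow> real" where
  "time_deriv V t x = vector_derivative (\<lambda>s. V s x) (at t within {0..})"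

definition solution_on ::
    "('m::t2_space, 'e::euclidean_space) chart set \<Rightarrow> 'm set \<Rightarrow>
     (real \<Rightarrow> 'm \<Rightarrow> ('m, 'e) tvec) \<Rightarrow> real set \<Rightarrow> (real \<Rightarrow> 'm) \<Rightarrow> bool" where
  "solution_on A D f J x \<longleftrightarrow> (\<forall>t\<in>J. x t \<in> D \<and> has_velocity A J x t (f t (x t)))"

section \<open>Comparison functions\<close>

definition pos_def_on :: "'m set \<Rightarrow> 'm \<Rightarrow> ('m \<Rightarrow> real) \<Rightarrow> bool" where
  "pos_def_on D xs W \<longleftrightarrow> W xs = 0 \<and> (\<forall>x\<in>D - {xs}. 0 < W x)"

definition right_open :: "ereal \<Rightarrow> real set" where
  "right_open a = {r. 0 \<le> r \<and> ereal r < a}"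

definition class_K :: "ereal \<Rightarrow> (real \<Rightarrow> real) \<Rightarrow> bool" where
  "class_K a \<alpha> \<longleftrightarrow>
     0 < a \<and> continuous_on (right_open a) \<alpha> \<and> (\<forall>r\<in>right_open a. 0 \<le> \<alpha> r)
     \<and> strict_mono_on (right_open a) \<alpha> \<and> \<alpha> 0 = 0"

definition class_KL :: "ereal \<Rightarrow> (real \<Rightarrow> real \<Rightarrow> real) \<Rightarrow> bool" where
  "class_KL a \<beta> \<longleftrightarrow>
     0 < a \<and> continuous_on (right_open a \<times> {0..}) (\<lambda>(r, s). \<beta> r s)
     \<and> (\<forall>s\<ge>0. class_K a (\<lambda>r. \<beta> r s))
     \<and> (\<forall>r\<in>right_open a. antimono_on {0..} (\<beta> r) \<and> (\<beta> r \<longlongrightarrow> 0) at_top)"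

text \<open>
  For every initial time \<open>t0 \<ge> 0\<close> and every initial state \<open>x0 \<in> X0\<close>, the solution starting at \<open>x0\<close>
  exists on all of \<open>[t0,\<infinity>)\<close>, is unique, and obeys the estimate given by the class KL function
  \<open>\<beta>\<close>, which is defined for first arguments in \<open>[0,a)\<close>.
\<close>

definition KL_estimate ::
    "('m::t2_space, 'e::euclidean_space) chart set \<Rightarrow> ('m, 'e) metric \<Rightarrow> 'm set \<Rightarrow>
     (real \<Rightarrow> 'm \<Rightarrow> ('m, 'e) tvec) \<Rightarrow> 'm \<Rightarrow> ereal \<Rightarrow> (real \<Rightarrow> real \<Rightarrow> real) \<Rightarrow> 'm set \<Rightarrow> bool" where
  "KL_estimate A g D f xs a \<beta> X0 \<longleftrightarrow>
     (\<forall>t0\<ge>0. \<forall>x0\<in>X0.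
        ereal (rdist A g xs x0) < a
        \<and> (\<exists>x. solution_on A D f {t0..} x \<and> x t0 = x0
             \<and> (\<forall>T y. t0 < T \<and> solution_on A D f {t0..<T} y \<and> y t0 = x0
                    \<longrightarrow> (\<forall>t\<in>{t0..<T}. y t = x t))
             \<and> (\<forall>t\<ge>t0. rdist A g xs (x t) \<le> \<beta> (rdist A g xs (x t0)) (t - t0))))"

text \<open>
  The filter of points \<open>x\<close> with \<open>\<rho>(x,x\<^sub>*) \<rightarrow> r0\<close> and \<open>\<rho>(x,x\<^sub>*) < r0\<close>; a neighbourhood consists of
  all \<open>x\<close> with \<open>b < \<rho>(x,x\<^sub>*) < r0\<close>, for some \<open>b < r0\<close>. Here \<open>r0 = \<infinity>\<close> is allowed.
\<close>

definition to_radius ::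
    "('m::t2_space, 'e::euclidean_space) chart set \<Rightarrow> ('m, 'e) metric \<Rightarrow> 'm \<Rightarrow> ereal \<Rightarrow> 'm filter" where
  "to_radius A g xs r0 = filtercomap (\<lambda>x. ereal (rdist A g x xs)) (at_left r0)"

end

(* Along a solution the inequalities for V bound the distance to xs by the root p of
   phi (alpha p + s * omega (alpha p)) = rho0, where rho0 is the initial distance, s the elapsed time and
   alpha, omega, phi are class K minorants of W1, W3 and of the distance itself; this root is a class KL
   function of (rho0, s).
   Solutions exist for all time because they are trapped in closed geodesic balls inside D. Such balls are
   compact because the exponential map preserves radial distances, which follows from the Gauss lemma. For
   the third assertion V is replaced by its quotient by r0^2 - rho^2, where rho is the distance to xs. *)

theory Submission
  imports Defs
begin

text \<open>The obstacle is uniformity. \<open>W3\<close> may tend to 0 towards the boundary of the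
  ball, so no single decay rate serves all initial states. A trajectory however stays in a sublevel
  set fixed by its initial state, and there \<open>W3\<close> has a positive lower bound away from
  \<open>xs\<close>. The rate thus loses a factor that depends on the initial state only; this
  factor is moved to the side of the initial data, where it enlarges the quantity that
  \<open>\<phi>\<close> compares with the initial distance. In the third assertion \<open>W1\<close>
  may stay bounded near the boundary, and only its quotient by \<open>r0^2 - rho^2\<close> is known
  to blow up, which forces the change of Lyapunov function. The manifold enters through few facts on
  balls around \<open>xs\<close> of radius below \<open>r0\<close>: closed ones are compact, open
  ones are open, and the distance is continuous on them. They are read off in an exponential ball of
  slightly larger radius. Such a ball exists because a metric ball cannot lie inside the ball of
  injectivity radius if its own radius exceeds the injectivity radius.\<close>

section \<open>Class KL bounds from Lyapunov inequalities\<close>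

text \<open>The witness is \<open>p / (1 + p)\<close> times the Lipschitz infimal convolution
  \<open>INF x. P x + max 0 (p - Q x)\<close>; the first factor turns monotone into strictly monotone.\<close>

lemma comparison_function:
  fixes P Q :: "'a \<Rightarrow> real" and a :: ereal
  assumes ne: "X \<noteq> {}"
    and P0: "\<And>x. x \<in> X \<Longrightarrow> 0 \<le> P x" and Q0: "\<And>x. x \<in> X \<Longrightarrow> 0 \<le> Q x"
    and pos: "\<And>e. 0 < e \<Longrightarrow> \<exists>d>0. \<forall>x\<in>X. e \<le> Q x \<longrightarrow> d \<le> P x"
    and unb: "\<And>l. ereal l < a \<Longrightarrow> \<exists>b. \<forall>x\<in>X. b \<le> Q x \<longrightarrow> l \<le> P x"
  obtains \<alpha> where "class_K \<infinity> \<alpha>" "\<And>x. x \<in> X \<Longrightarrow> \<alpha> (Q x) \<le> P x"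
    "\<And>l. ereal l < a \<Longrightarrow> \<exists>p\<ge>0. l < \<alpha> p"
proof -
  define \<mu> where "\<mu> p = (INF x\<in>X. P x + max 0 (p - Q x))" for p
  have bdd: "bdd_below ((\<lambda>x. P x + max 0 (p - Q x)) ` X)" for p
    by (rule bdd_belowI[of _ 0]) (use P0 in force)
  have mu_le: "\<mu> p \<le> P x + max 0 (p - Q x)" if "x \<in> X" for p x
    unfolding \<mu>_def by (rule cINF_lower[OF bdd that])
  have mu_ge: "m \<le> \<mu> p" if "\<And>x. x \<in> X \<Longrightarrow> m \<le> P x + max 0 (p - Q x)" for m p
    unfolding \<mu>_def using ne that by (rule cINF_greatest)
  have mu_mono: "\<mu> p \<le> \<mu> q" if "p \<le> q" for p q
    by (rule mu_ge, rule order_trans[OF mu_le]) (use that in auto)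
  have mu_lip: "\<mu> p \<le> \<mu> q + \<bar>p - q\<bar>" for p q
  proof -
    have "\<mu> p - \<bar>p - q\<bar> \<le> \<mu> q"
      by (rule mu_ge) (use mu_le[of _ p] in \<open>smt (verit, best)\<close>)
    then show ?thesis by simp
  qed
  have mu_nonneg: "0 \<le> \<mu> p" for p
    by (rule mu_ge) (use P0 in force)
  have mu_pos: "0 < \<mu> p" if p: "0 < p" for p
  proof -
    obtain d where d: "d > 0" "\<And>x. x \<in> X \<Longrightarrow> p / 2 \<le> Q x \<Longrightarrow> d \<le> P x"
      using pos[of "p / 2"] p by auto
    have "min d (p / 2) \<le> \<mu> p"
    proof (rule mu_ge)
      fix x assume x: "x \<in> X"
      show "min d (p / 2) \<le> P x + max 0 (p - Q x)"
        using d(2)[OF x] P0[OF x] by (cases "p / 2 \<le> Q x") auto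
    qed
    then show ?thesis using d(1) that by auto
  qed
  define \<alpha> where "\<alpha> p = p / (1 + p) * \<mu> p" for p
  have cont_mu: "continuous_on UNIV \<mu>"
    unfolding continuous_on_iff dist_real_def
  proof (intro ballI allI impI)
    fix p e :: real assume "0 < e"
    moreover have "\<bar>\<mu> q - \<mu> p\<bar> \<le> \<bar>q - p\<bar>" for q
      using mu_lip[of p q] mu_lip[of q p] by (auto simp: abs_minus_commute)
    ultimately show "\<exists>d>0. \<forall>x'\<in>UNIV. \<bar>x' - p\<bar> < d \<longrightarrow> \<bar>\<mu> x' - \<mu> p\<bar> < e"
      by (intro exI[of _ e]) (auto intro: le_less_trans)
  qed
  have cont: "continuous_on {0..} \<alpha>"
    unfolding \<alpha>_def by (intro continuous_intros continuous_on_subset[OF cont_mu]) auto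
  have mono: "strict_mono_on {0..} \<alpha>"
  proof (rule strict_mono_onI)
    fix p q :: real assume pq: "p \<in> {0..}" "q \<in> {0..}" "p < q"
    have f: "p / (1 + p) < q / (1 + q)"
      using pq by (auto simp: divide_simps algebra_simps)
    have "\<alpha> p \<le> p / (1 + p) * \<mu> q"
      unfolding \<alpha>_def using pq by (intro mult_left_mono mu_mono) auto
    also have "\<dots> < \<alpha> q"
      unfolding \<alpha>_def using pq f by (intro mult_strict_right_mono mu_pos) auto
    finally show "\<alpha> p < \<alpha> q" .
  qed
  have zero: "\<alpha> 0 = 0" by (simp add: \<alpha>_def)
  have K: "class_K \<infinity> \<alpha>"
  proof -
    have "right_open \<infinity> = {0..}" by (auto simp: right_open_def)
    moreover have "0 \<le> \<alpha> r" if "r \<ge> 0" for r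
      using that mu_nonneg by (auto simp: \<alpha>_def)
    ultimately show ?thesis
      using cont mono zero unfolding class_K_def by auto
  qed
  have le: "\<alpha> (Q x) \<le> P x" if x: "x \<in> X" for x
  proof -
    have "\<alpha> (Q x) \<le> 1 * \<mu> (Q x)"
      unfolding \<alpha>_def using Q0[OF x] mu_nonneg by (intro mult_right_mono) auto
    also have "\<dots> \<le> P x" using mu_le[OF x, of "Q x"] by simp
    finally show ?thesis .
  qed
  have big: "\<exists>p\<ge>0. l < \<alpha> p" if l: "ereal l < a" for l
  proof (cases "l < 0")
    case True
    then show ?thesis using zero by (intro exI[of _ 0]) auto
  next
    case False
    obtain l' where l': "l < l'" "ereal l' < a"
      using ereal_dense2[OF l] by auto
    obtain b where b: "\<And>x. x \<in> X \<Longrightarrow> b \<le> Q x \<Longrightarrow> l' \<le> P x"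
      using unb[OF l'(2)] by auto
    have mu_l': "l' \<le> \<mu> p" if "b + l' \<le> p" for p
    proof (rule mu_ge)
      fix x assume x: "x \<in> X"
      show "l' \<le> P x + max 0 (p - Q x)"
        using b[OF x] P0[OF x] that by (cases "b \<le> Q x") auto
    qed
    \<comment> \<open>\<open>p / (1 + p) * l'\<close> exceeds \<open>l\<close> exactly when
      \<open>p > l / (l' - l)\<close>, whence the second entry; the first makes
      \<open>\<mu> p\<close> at least \<open>l'\<close>. The gap between \<open>l\<close> and
      \<open>l'\<close> pays for the factor \<open>p / (1 + p) < 1\<close>.\<close>
    define p where "p = max (b + l') (l / (l' - l) + 1)"
    have p1: "l / (l' - l) + 1 \<le> p" by (simp add: p_def)
    have "0 \<le> l / (l' - l)" using False l' by auto
    then have p0: "p > 0" using p1 by linarith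
    have "(l / (l' - l) + 1) * (l' - l) \<le> p * (l' - l)"
      using p1 l' by (intro mult_right_mono) auto
    moreover have "(l / (l' - l) + 1) * (l' - l) = l'"
      using l' by (simp add: distrib_right)
    ultimately have "l < p * (l' - l)" using l' by simp
    then have "l * (1 + p) < p * l'" by (simp add: algebra_simps)
    then have "l < p / (1 + p) * l'"
      using p0 by (simp add: divide_simps algebra_simps)
    also have "\<dots> \<le> \<alpha> p"
      unfolding \<alpha>_def using p0 by (intro mult_left_mono mu_l') (auto simp: p_def)
    finally show ?thesis using p0 by (intro exI[of _ p]) auto
  qed
  show ?thesis by (rule that[OF K le big])
qed

lemma right_open_infinity: "right_open \<infinity> = {0..}"
  by (auto simp: right_open_def)

text \<open>The root of \<open>H p s = q\<close> in \<open>p\<close> exists by the intermediate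
  value theorem and is unique by strict monotonicity. The properties of \<open>\<beta>\<close> are
  read off by comparing \<open>H p s\<close> with \<open>q\<close>: growth of \<open>H\<close> in
  \<open>s\<close> makes the root decrease, and \<open>large\<close> sends it to 0. The condition
  \<open>surj\<close> is imposed at time 0 only, since \<open>H\<close> grows with
  \<open>s\<close>.\<close>

lemma class_KL_root:
  fixes H :: "real \<Rightarrow> real \<Rightarrow> real" and a :: ereal
  assumes a: "0 < a"
    and cont: "continuous_on ({0..} \<times> {0..}) (\<lambda>(p, s). H p s)"
    and mono_p: "\<And>s p q. 0 \<le> s \<Longrightarrow> 0 \<le> p \<Longrightarrow> p < q \<Longrightarrow> H p s < H q s"
    and mono_s: "\<And>s t p. 0 \<le> p \<Longrightarrow> 0 \<le> s \<Longrightarrow> s \<le> t \<Longrightarrow> H p s \<le> H p t"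
    and zero: "\<And>s. 0 \<le> s \<Longrightarrow> H 0 s = 0"
    and surj: "\<And>q. ereal q < a \<Longrightarrow> \<exists>p\<ge>0. q < H p 0"
    and large: "\<And>p q. 0 < p \<Longrightarrow> ereal q < a \<Longrightarrow> \<exists>s\<ge>0. q < H p s"
  obtains \<beta> where "class_KL a \<beta>"
    "\<And>p q s. q \<in> right_open a \<Longrightarrow> 0 \<le> s \<Longrightarrow> 0 \<le> p \<Longrightarrow> H p s \<le> q \<Longrightarrow> p \<le> \<beta> q s"
proof -
  have ex: "\<exists>p\<ge>0. H p s = q" if q: "q \<in> right_open a" "0 \<le> s" for q s
  proof -
    obtain p1 where p1: "p1 \<ge> 0" "q < H p1 0"
      using surj[of q] q by (auto simp: right_open_def)
    have "continuous_on {0..p1} (\<lambda>p. H p s)"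
      using q by (intro continuous_on_compose2[OF cont, of _ "\<lambda>p. (p, s)", simplified]
          continuous_intros) auto
    moreover have "H 0 s \<le> q" "q \<le> H p1 s"
      using zero q mono_s[of p1 0 s] p1 by (auto simp: right_open_def)
    ultimately show ?thesis using IVT'[of "\<lambda>p. H p s" 0 q p1] p1 by auto
  qed
  define \<beta> where "\<beta> q s = (SOME p. 0 \<le> p \<and> H p s = q)" for q s
  have b: "0 \<le> \<beta> q s" "H (\<beta> q s) s = q" if "q \<in> right_open a" "0 \<le> s" for q s
    using someI_ex[of "\<lambda>p. 0 \<le> p \<and> H p s = q"] ex[OF that] by (auto simp: \<beta>_def)
  have le_iff: "H p s \<le> H q s \<longleftrightarrow> p \<le> q" if "0 \<le> s" "0 \<le> p" "0 \<le> q" for p q s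
    using mono_p[OF that(1), of p q] mono_p[OF that(1), of q p] that by (cases p q rule: linorder_cases) auto
  have less_iff: "H p s < H q s \<longleftrightarrow> p < q" if "0 \<le> s" "0 \<le> p" "0 \<le> q" for p q s
    using le_iff[of s q p] that by auto
  have below: "p \<le> \<beta> q s" if "q \<in> right_open a" "0 \<le> s" "0 \<le> p" "H p s \<le> q" for p q s
    using le_iff[of s p "\<beta> q s"] b[of q s] that by auto
  have above: "\<beta> q s \<le> p" if "q \<in> right_open a" "0 \<le> s" "0 \<le> p" "q \<le> H p s" for p q s
    using le_iff[of s "\<beta> q s" p] b[of q s] that by auto
  have cont_b: "continuous_on (right_open a \<times> {0..}) (\<lambda>(q, s). \<beta> q s)"
  proof (clarsimp simp: continuous_on_def)
    fix q1 s1 assume q1: "q1 \<in> right_open a" and s1: "(0::real) \<le> s1"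
    define F where "F = at (q1, s1) within right_open a \<times> {0..}"
    have inF: "\<forall>\<^sub>F x in F. fst x \<in> right_open a \<and> 0 \<le> snd x"
      unfolding F_def eventually_at_filter by (rule always_eventually) auto
    \<comment> \<open>Continuity amounts to two strict inequalities: \<open>l < \<beta> q s\<close>
      means \<open>H l s < q\<close>, which is an open condition on \<open>(q, s)\<close>, and
      likewise from above.\<close>
    have limH: "((\<lambda>x. H p (snd x) - fst x) \<longlongrightarrow> H p s1 - q1) F" if "0 \<le> p" for p
    proof -
      have "continuous_on (right_open a \<times> {0..}) (\<lambda>x. H p (snd x) - fst x)"
        using that by (intro continuous_intros continuous_on_compose2[OF cont, of _ "\<lambda>x. (p, snd x)", simplified]) auto
      then show ?thesis using q1 s1 unfolding F_def continuous_on_def by force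
    qed
    show "((\<lambda>(q, s). \<beta> q s) \<longlongrightarrow> \<beta> q1 s1) (at (q1, s1) within right_open a \<times> {0..})"
      unfolding F_def[symmetric]
    proof (rule order_tendstoI)
      fix l assume l: "l < \<beta> q1 s1"
      show "\<forall>\<^sub>F x in F. l < (case x of (q, s) \<Rightarrow> \<beta> q s)"
      \<comment> \<open>\<open>H\<close> is controlled on nonnegative arguments only; for negative
        \<open>l\<close> the inequality holds because the root is nonnegative.\<close>
      proof (cases "l < 0")
        case True
        from inF show ?thesis
        proof eventually_elim
          case (elim x)
          then show ?case using b(1)[of "fst x" "snd x"] True by (auto split: prod.splits)
        qed
      next
        case False
        have "H l s1 - q1 < 0" using less_iff[of s1 l "\<beta> q1 s1"] b[OF q1 s1] l False s1 by auto
        with limH[of l] False have "\<forall>\<^sub>F x in F. H l (snd x) - fst x < 0"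
          by (intro order_tendstoD) auto
        with inF show ?thesis
        proof eventually_elim
          case (elim x)
          then show ?case using less_iff[of "snd x" l "\<beta> (fst x) (snd x)"] b[of "fst x" "snd x"] False
            by (auto split: prod.splits)
        qed
      qed
    next
      fix l assume l: "\<beta> q1 s1 < l"
      have l0: "0 \<le> l" using b(1)[OF q1 s1] l by simp
      have "0 < H l s1 - q1" using less_iff[of s1 "\<beta> q1 s1" l] b[OF q1 s1] l l0 s1 by auto
      with limH[OF l0] have "\<forall>\<^sub>F x in F. 0 < H l (snd x) - fst x"
        by (intro order_tendstoD) auto
      with inF show "\<forall>\<^sub>F x in F. (case x of (q, s) \<Rightarrow> \<beta> q s) < l"
      proof eventually_elim
        case (elim x)
        then show ?case using less_iff[of "snd x" "\<beta> (fst x) (snd x)" l] b[of "fst x" "snd x"] l0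
          by (auto split: prod.splits)
      qed
    qed
  qed
  have "class_KL a \<beta>"
    unfolding class_KL_def
  proof (intro conjI allI impI ballI a cont_b)
    fix s :: real assume s: "0 \<le> s"
    have z: "0 \<in> right_open a" using a by (auto simp: right_open_def zero_ereal_def)
    show "class_K a (\<lambda>r. \<beta> r s)"
      unfolding class_K_def
    proof (intro conjI a ballI)
      show "continuous_on (right_open a) (\<lambda>r. \<beta> r s)"
        using s by (intro continuous_on_compose2[OF cont_b, of _ "\<lambda>r. (r, s)", simplified]
          continuous_intros) auto
      show "\<And>r. r \<in> right_open a \<Longrightarrow> 0 \<le> \<beta> r s" using b s by auto
      show "strict_mono_on (right_open a) (\<lambda>r. \<beta> r s)"
      proof (rule strict_mono_onI)
        fix q q' assume "q \<in> right_open a" "q' \<in> right_open a" "q < q'"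
        then show "\<beta> q s < \<beta> q' s" using less_iff[of s "\<beta> q s" "\<beta> q' s"] b[of q s] b[of q' s] s by auto
      qed
      show "\<beta> 0 s = 0"
        using above[OF z s, of 0] zero[OF s] b[OF z s] by auto
    qed
  next
    fix q assume q: "q \<in> right_open a"
    show anti: "antimono_on {0..} (\<beta> q)"
    proof (rule monotone_onI)
      fix s t :: real assume st: "s \<in> {0..}" "t \<in> {0..}" "s \<le> t"
      then have "H (\<beta> q t) s \<le> q" using b[OF q, of t] mono_s[of "\<beta> q t" s t] by auto
      then show "\<beta> q t \<le> \<beta> q s" using st b[OF q, of t] below[OF q, of s "\<beta> q t"] by auto
    qed
    show "(\<beta> q \<longlongrightarrow> 0) at_top"
    proof (rule tendsto_sandwich[OF _ _ tendsto_const])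
      show "\<forall>\<^sub>F s in at_top. 0 \<le> \<beta> q s"
        using eventually_ge_at_top[of 0] by eventually_elim (use b q in auto)
    next
      have ev: "\<forall>\<^sub>F s in at_top. \<beta> q s < e" if e: "0 < e" for e
      proof -
        obtain s where s: "s \<ge> 0" "q < H (e/2) s"
          using large[of "e/2" q] e q by (auto simp: right_open_def)
        show ?thesis using eventually_ge_at_top[of s]
        proof eventually_elim
          case (elim t)
          have "\<beta> q t \<le> e / 2" using s elim that mono_s[of "e/2" s t] by (intro above[OF q]) auto
          then show ?case using that by simp
        qed
      qed
      \<comment> \<open>Truncation gives the lower bound at every \<open>s\<close>; at negative
        \<open>s\<close> the chosen root is arbitrary and may be negative.\<close>
      show "((\<lambda>s. max 0 (\<beta> q s)) \<longlongrightarrow> 0) at_top"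
      proof (rule order_tendstoI)
        fix e :: real assume "0 < e"
        from ev[OF this] show "\<forall>\<^sub>F s in at_top. max 0 (\<beta> q s) < e"
          by eventually_elim (use \<open>0 < e\<close> in auto)
      qed (auto intro: always_eventually simp: less_max_iff_disj)
      show "\<forall>\<^sub>F s in at_top. \<beta> q s \<le> max 0 (\<beta> q s)" by simp
    qed
  qed
  then show ?thesis by (rule that) (rule below)
qed

section \<open>Comparison estimates along trajectories\<close>

lemma real_derivative_le_imp_bound:
  fixes v w :: "real \<Rightarrow> real"
  assumes "s \<le> t" and deriv: "\<And>r. s \<le> r \<Longrightarrow> r \<le> t \<Longrightarrow> (v has_real_derivative w r) (at r within {s..t})"
    and le: "\<And>r. s \<le> r \<Longrightarrow> r \<le> t \<Longrightarrow> w r \<le> - m"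
  shows "v t \<le> v s - m * (t - s)"
proof (cases "s = t")
  case False
  then have "s < t" using assms(1) by simp
  from mvt_simple[OF this, of v "\<lambda>r. (*) (w r)"] deriv
  obtain r where r: "r \<in> {s<..<t}" "v t - v s = w r * (t - s)"
    by (auto simp: has_field_derivative_def)
  have "w r * (t - s) \<le> - m * (t - s)"
    using r le \<open>s < t\<close> by (intro mult_right_mono) auto
  with r show ?thesis by simp
qed simp

text \<open>Keeps the comparison argument free of the differential equation: a trajectory is any
  curve \<open>y\<close> in \<open>X\<close> with a scalar \<open>v\<close> along it. The condition
  \<open>N (y t) \<le> B (y t0)\<close> records the sublevel set in which the initial state confines
  the trajectory.\<close>

definition KL_bound :: "ereal \<Rightarrow> (real \<Rightarrow> real \<Rightarrow> real) \<Rightarrow> 'a set \<Rightarrow> ('a \<Rightarrow> real) \<Rightarrow> ('a \<Rightarrow> real) \<Rightarrow>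
    ('a \<Rightarrow> real) \<Rightarrow> ('a \<Rightarrow> real) \<Rightarrow> ('a \<Rightarrow> real) \<Rightarrow> ('a \<Rightarrow> real) \<Rightarrow> bool" where
  "KL_bound a \<beta> X \<rho> N B W1 W2 W3 \<longleftrightarrow> (\<forall>y v w t0.
    (\<forall>t\<ge>t0. y t \<in> X \<and> N (y t) \<le> B (y t0) \<and> W1 (y t) \<le> v t \<and> v t \<le> W2 (y t)
        \<and> (v has_real_derivative w t) (at t within {t0..}) \<and> w t \<le> - W3 (y t))
    \<longrightarrow> ereal (\<rho> (y t0)) < a \<longrightarrow> (\<forall>t\<ge>t0. \<rho> (y t) \<le> \<beta> (\<rho> (y t0)) (t - t0)))"

lemma KL_boundD:
  assumes "KL_bound a \<beta> X \<rho> N B W1 W2 W3"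
    and "\<And>t. t0 \<le> t \<Longrightarrow> y t \<in> X \<and> N (y t) \<le> B (y t0) \<and> W1 (y t) \<le> v t \<and> v t \<le> W2 (y t)
        \<and> (v has_real_derivative w t) (at t within {t0..}) \<and> w t \<le> - W3 (y t)"
    and "ereal (\<rho> (y t0)) < a" "t0 \<le> t"
  shows "\<rho> (y t) \<le> \<beta> (\<rho> (y t0)) (t - t0)"
proof -
  have "\<forall>t\<ge>t0. y t \<in> X \<and> N (y t) \<le> B (y t0) \<and> W1 (y t) \<le> v t \<and> v t \<le> W2 (y t)
        \<and> (v has_real_derivative w t) (at t within {t0..}) \<and> w t \<le> - W3 (y t)"
    using assms(2) by blast
  from assms(1)[unfolded KL_bound_def, rule_format, OF this[rule_format] assms(3,4)] show ?thesis .
qed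

text \<open>Along a trajectory \<open>y\<close> with value \<open>v\<close>, minimizing \<open>W3\<close> over the part of the trajectory
  where \<open>W2\<close> is at least \<open>v t\<close> gives \<open>v t + (t - t0) * \<omega> (v t) / \<kappa> \<le> v t0\<close>; the factor \<open>\<kappa>\<close>
  accounts for \<open>W3\<close> degenerating where \<open>N\<close> is large. Solving this inequality for the distance
  produces \<open>\<beta>\<close> as a root, without any comparison differential equation.\<close>

lemma Lyapunov_class_KL:
  fixes X :: "'a set" and \<rho> W1 W2 W3 N B :: "'a \<Rightarrow> real" and a :: ereal
  assumes a: "0 < a" and ne: "X \<noteq> {}"
    and nonneg: "\<And>x. x \<in> X \<Longrightarrow> 0 \<le> \<rho> x" "\<And>x. x \<in> X \<Longrightarrow> 0 \<le> W1 x"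
      "\<And>x. x \<in> X \<Longrightarrow> 0 \<le> W2 x" "\<And>x. x \<in> X \<Longrightarrow> 0 \<le> W3 x"
    and W1_pos: "\<And>e. 0 < e \<Longrightarrow> \<exists>d>0. \<forall>x\<in>X. e \<le> \<rho> x \<longrightarrow> d \<le> W1 x"
    and W1_unb: "\<And>l. \<exists>b. \<forall>x\<in>X. b \<le> \<rho> x \<longrightarrow> l \<le> W1 x"
    and W2_small: "\<And>e. 0 < e \<Longrightarrow> \<exists>d>0. \<forall>x\<in>X. e \<le> W2 x \<longrightarrow> d \<le> \<rho> x"
    and W3_pos: "\<And>n e. 0 < e \<Longrightarrow> \<exists>d>0. \<forall>x\<in>X. N x \<le> n \<longrightarrow> e \<le> \<rho> x \<longrightarrow> d \<le> W3 x"
    and bounded: "\<And>q. ereal q < a \<Longrightarrow> \<exists>b. \<forall>x\<in>X. \<rho> x \<le> q \<longrightarrow> B x \<le> b \<and> W2 x \<le> b"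
    and N_le: "\<And>x. x \<in> X \<Longrightarrow> N x \<le> B x"
  shows "\<exists>\<beta>. class_KL a \<beta> \<and> KL_bound a \<beta> X \<rho> N B W1 W2 W3"
proof -
  obtain \<alpha> where \<alpha>: "class_K \<infinity> \<alpha>" "\<And>x. x \<in> X \<Longrightarrow> \<alpha> (\<rho> x) \<le> W1 x"
    "\<And>l. \<exists>p\<ge>0. l < \<alpha> p"
    by (rule comparison_function[of X W1 \<rho> \<infinity>]) (use ne nonneg W1_pos W1_unb in auto)
  \<comment> \<open>An arbitrary splitting radius. For \<open>\<rho> x \<le> q0\<close> both
    \<open>B\<close> and \<open>W2\<close> are bounded by a fixed \<open>n0\<close>, so
    \<open>W3_pos\<close> gives a rate independent of the trajectory; a rate depending on the state
    is needed further out only.\<close>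
  obtain q0 :: real where q0: "0 < q0" "ereal q0 < a"
    using ereal_dense2[OF a] by (auto simp: zero_ereal_def)
  obtain n0 where n0: "\<And>x. x \<in> X \<Longrightarrow> \<rho> x \<le> q0 \<Longrightarrow> B x \<le> n0 \<and> W2 x \<le> n0"
    using bounded[OF q0(2)] by auto
  \<comment> \<open>\<open>W3\<close> may degenerate as \<open>n\<close> grows;
    \<open>1 / L n\<close> compensates, so that \<open>W3 x * \<kappa> (N x)\<close> is at least 1
    beyond \<open>q0\<close>. The cap 1 gives \<open>\<kappa> \<ge> 1\<close>, and the empty set is
    treated separately because its infimum is unspecified.\<close>
  define L where "L n = (INF x\<in>{x\<in>X. N x \<le> n \<and> q0 \<le> \<rho> x}. min 1 (W3 x))" for n
  define \<kappa> where "\<kappa> n = (if {x\<in>X. N x \<le> n \<and> q0 \<le> \<rho> x} = {} then 1 else 1 / L n)" for n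
  have bddL: "bdd_below ((\<lambda>x. min 1 (W3 x)) ` {x\<in>X. N x \<le> n \<and> q0 \<le> \<rho> x})" for n
    by (rule bdd_belowI[of _ 0]) (use nonneg in force)
  have L_le: "L n \<le> W3 x" "L n \<le> 1" if "x \<in> X" "N x \<le> n" "q0 \<le> \<rho> x" for x n
    using cINF_lower[OF bddL, of x n] that by (auto simp: L_def)
  have L_pos: "0 < L n" if "{x\<in>X. N x \<le> n \<and> q0 \<le> \<rho> x} \<noteq> {}" for n
  proof -
    obtain d where d: "d > 0" "\<forall>x\<in>X. N x \<le> n \<longrightarrow> q0 \<le> \<rho> x \<longrightarrow> d \<le> W3 x"
      using W3_pos[OF q0(1), of n] by auto
    have "min 1 d \<le> L n" unfolding L_def by (rule cINF_greatest[OF that]) (use d in auto)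
    then show ?thesis using d by auto
  qed
  have \<kappa>_ge1: "1 \<le> \<kappa> n" for n
    unfolding \<kappa>_def using L_pos[of n] L_le(2)[of _ n] by auto
  have \<kappa>_mono: "\<kappa> m \<le> \<kappa> n" if "m \<le> n" for m n
  proof (cases "{x\<in>X. N x \<le> m \<and> q0 \<le> \<rho> x} = {}")
    case True
    then show ?thesis using \<kappa>_ge1[of n] by (simp add: \<kappa>_def[of m])
  next
    case False
    then have ne': "{x\<in>X. N x \<le> n \<and> q0 \<le> \<rho> x} \<noteq> {}" using that by force
    have "L n \<le> L m" unfolding L_def[of m] by (rule cINF_greatest[OF False])
        (use that L_le[of _ n] in auto)
    moreover have "\<kappa> m = 1 / L m" "\<kappa> n = 1 / L n"
      using False ne' by (simp_all only: \<kappa>_def if_False)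
    ultimately show ?thesis using L_pos[OF ne'] by (simp add: frac_le)
  qed
  have P_ge1: "1 \<le> W3 x * \<kappa> (N x)" if x: "x \<in> X" "q0 \<le> \<rho> x" for x
  proof -
    have ne': "{x'\<in>X. N x' \<le> N x \<and> q0 \<le> \<rho> x'} \<noteq> {}" using x by auto
    then have "\<kappa> (N x) = 1 / L (N x)" by (simp only: \<kappa>_def if_False)
    then show ?thesis using L_pos[OF ne'] L_le(1)[of x "N x"] x by simp
  qed
  have P_pos: "\<exists>d>0. \<forall>x\<in>X. e \<le> W2 x \<longrightarrow> d \<le> W3 x * \<kappa> (N x)" if e: "0 < e" for e
  proof -
    obtain e' where e': "e' > 0" "\<And>x. x \<in> X \<Longrightarrow> e \<le> W2 x \<Longrightarrow> e' \<le> \<rho> x"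
      using W2_small[OF e] by auto
    obtain d where d: "d > 0" "\<And>x. x \<in> X \<Longrightarrow> N x \<le> n0 \<Longrightarrow> e' \<le> \<rho> x \<Longrightarrow> d \<le> W3 x"
      using W3_pos[OF e'(1), of n0] by auto
    have "min 1 d \<le> W3 x * \<kappa> (N x)" if x: "x \<in> X" "e \<le> W2 x" for x
    proof (cases "q0 \<le> \<rho> x")
      case True
      then show ?thesis using P_ge1 x by force
    next
      case False
      have "d * 1 \<le> W3 x * \<kappa> (N x)"
        by (rule mult_mono) (use d n0[of x] N_le[of x] e'(2)[OF x] x False \<kappa>_ge1 nonneg in auto)
      then show ?thesis by auto
    qed
    then show ?thesis using d(1) by (intro exI[of _ "min 1 d"]) auto
  qed
  have P0: "0 \<le> W3 x * \<kappa> (N x)" if "x \<in> X" for x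
    using nonneg(4)[OF that] \<kappa>_ge1[of "N x"] by auto
  obtain \<omega> where \<omega>: "class_K \<infinity> \<omega>" "\<And>x. x \<in> X \<Longrightarrow> \<omega> (W2 x) \<le> W3 x * \<kappa> (N x)"
  \<comment> \<open>With \<open>a = 0\<close> the growth condition concerns negative
    \<open>l\<close> only and is trivial; the rate need not grow with \<open>W2\<close>.\<close>
  proof (rule comparison_function[of X "\<lambda>x. W3 x * \<kappa> (N x)" W2 0])
    show "\<exists>b. \<forall>x\<in>X. b \<le> W2 x \<longrightarrow> l \<le> W3 x * \<kappa> (N x)" if "ereal l < 0" for l
    proof (intro exI ballI impI)
      fix x assume "x \<in> X"
      then show "l \<le> W3 x * \<kappa> (N x)" using P0[of x] that by (auto simp: zero_ereal_def)
    qed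
  qed (use ne P0 nonneg P_pos in auto)
  \<comment> \<open>The final estimate is
    \<open>\<alpha> p + s * \<omega> (\<alpha> p) \<le> v t0 * (1 + k)\<close>, with
    \<open>v t0\<close> at most \<open>W2\<close> and \<open>k = \<kappa> (B _)\<close> at the
    initial state; \<open>G\<close> is this bound as a function of that state. The summand 1 absorbs
    \<open>\<alpha> p\<close>, the summand \<open>k\<close> the decay term.\<close>
  define G where "G x = W2 x * (1 + \<kappa> (B x))" for x
  have G0: "0 \<le> G x" if "x \<in> X" for x
    using nonneg(3)[OF that] \<kappa>_ge1[of "B x"] by (auto simp: G_def)
  have G_small: "\<exists>d>0. \<forall>x\<in>X. e \<le> G x \<longrightarrow> d \<le> \<rho> x" if e: "0 < e" for e
  proof -
    have k: "1 + \<kappa> n0 > 0" using \<kappa>_ge1[of n0] by linarith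
    obtain d where d: "d > 0" "\<And>x. x \<in> X \<Longrightarrow> e / (1 + \<kappa> n0) \<le> W2 x \<Longrightarrow> d \<le> \<rho> x"
      using W2_small[of "e / (1 + \<kappa> n0)"] e k by auto
    have "min d q0 \<le> \<rho> x" if x: "x \<in> X" "e \<le> G x" for x
    proof (rule ccontr)
      assume "\<not> min d q0 \<le> \<rho> x"
      then have r: "\<rho> x < d" "\<rho> x < q0" by auto
      have "G x \<le> W2 x * (1 + \<kappa> n0)"
        unfolding G_def using n0[of x] r x nonneg(3) \<kappa>_mono[of "B x" n0] by (intro mult_left_mono) auto
      with x(2) have "e / (1 + \<kappa> n0) \<le> W2 x" using k by (simp add: divide_simps)
      with d(2) x r show False by force
    qed
    then show ?thesis using d q0 by (intro exI[of _ "min d q0"]) auto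
  qed
  have G_unb: "\<exists>b. \<forall>x\<in>X. b \<le> G x \<longrightarrow> l \<le> \<rho> x" if l: "ereal l < a" for l
  proof -
    obtain b where b: "\<And>x. x \<in> X \<Longrightarrow> \<rho> x \<le> l \<Longrightarrow> B x \<le> b \<and> W2 x \<le> b"
      using bounded[OF l] by auto
    have "l \<le> \<rho> x" if x: "x \<in> X" "\<bar>b\<bar> * (1 + \<kappa> b) + 1 \<le> G x" for x
    proof (rule ccontr)
      assume "\<not> l \<le> \<rho> x"
      then have r: "B x \<le> b" "W2 x \<le> b" using b[OF x(1)] by auto
      have "G x \<le> \<bar>b\<bar> * (1 + \<kappa> b)"
        unfolding G_def using r x nonneg(3) \<kappa>_mono[of "B x" b] \<kappa>_ge1[of "B x"] by (intro mult_mono) auto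
      with x show False by simp
    qed
    then show ?thesis by blast
  qed
  \<comment> \<open>A minorant of the distance in terms of \<open>G\<close> serves as the inverse of
    a majorant of \<open>G\<close> in terms of the distance. Its values come arbitrarily close to
    \<open>a\<close>, which makes the root exist for every initial distance below
    \<open>a\<close>.\<close>
  obtain \<phi> where \<phi>: "class_K \<infinity> \<phi>" "\<And>x. x \<in> X \<Longrightarrow> \<phi> (G x) \<le> \<rho> x"
    "\<And>l. ereal l < a \<Longrightarrow> \<exists>p\<ge>0. l < \<phi> p"
    by (rule comparison_function[of X \<rho> G a]) (use ne nonneg(1) G0 G_small G_unb in auto)
  have mono: "\<gamma> p \<le> \<gamma> q" "p < q \<Longrightarrow> \<gamma> p < \<gamma> q" "0 \<le> \<gamma> p" if "class_K \<infinity> \<gamma>" "0 \<le> p" "p \<le> q" for p q \<gamma>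
    using that strict_mono_onD[of "{0..}" \<gamma> p q] by (cases "p = q"; force simp: class_K_def right_open_infinity)+
  define H where "H p s = \<phi> (\<alpha> p + s * \<omega> (\<alpha> p))" for p s
  have \<alpha>0: "\<alpha> 0 = 0" "\<omega> 0 = 0" "\<phi> 0 = 0" using \<alpha>(1) \<omega>(1) \<phi>(1) by (auto simp: class_K_def)
  have \<alpha>_pos: "0 < \<alpha> p" if "0 < p" for p using mono(2)[OF \<alpha>(1), of 0 p] \<alpha>0 that by auto
  have \<omega>_pos: "0 < \<omega> p" if "0 < p" for p using mono(2)[OF \<omega>(1), of 0 p] \<alpha>0 that by auto
  have arg0: "0 \<le> \<alpha> p + s * \<omega> (\<alpha> p)" if "0 \<le> p" "0 \<le> s" for p s
    using that mono(3)[OF \<alpha>(1), of p p] mono(3)[OF \<omega>(1), of "\<alpha> p" "\<alpha> p"] by auto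
  obtain \<beta> where \<beta>: "class_KL a \<beta>"
    "\<And>p q s. q \<in> right_open a \<Longrightarrow> 0 \<le> s \<Longrightarrow> 0 \<le> p \<Longrightarrow> H p s \<le> q \<Longrightarrow> p \<le> \<beta> q s"
  proof (rule class_KL_root[OF a, of H])
    have c: "continuous_on {0..} \<alpha>" "continuous_on {0..} \<omega>" "continuous_on {0..} \<phi>"
      using \<alpha>(1) \<omega>(1) \<phi>(1) by (auto simp: class_K_def right_open_infinity)
    show "continuous_on ({0..} \<times> {0..}) (\<lambda>(p, s). H p s)"
      unfolding H_def split_def
      by (intro continuous_on_compose2[OF c(3)] continuous_on_compose2[OF c(2)] continuous_on_compose2[OF c(1)]
          continuous_intros) (auto simp: arg0 mono(3)[OF \<alpha>(1) _ order_refl])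
    show "H p s < H q s" if "0 \<le> s" "0 \<le> p" "p < q" for s p q
    proof -
      have 1: "\<alpha> p < \<alpha> q" "0 \<le> \<alpha> p" using mono(2,3)[OF \<alpha>(1), of p q] that by auto
      have "\<omega> (\<alpha> p) \<le> \<omega> (\<alpha> q)" using mono(1)[OF \<omega>(1)] 1 by auto
      then have "s * \<omega> (\<alpha> p) \<le> s * \<omega> (\<alpha> q)" using that by (intro mult_left_mono) auto
      then show ?thesis unfolding H_def using 1 arg0 that by (intro mono(2)[OF \<phi>(1)]) auto
    qed
    show "H p s \<le> H p t" if "0 \<le> p" "0 \<le> s" "s \<le> t" for s t p
    proof -
      have "s * \<omega> (\<alpha> p) \<le> t * \<omega> (\<alpha> p)"
        using that mono(3)[OF \<omega>(1) mono(3)[OF \<alpha>(1)]] by (intro mult_right_mono) auto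
      then show ?thesis unfolding H_def using arg0 that by (intro mono(1)[OF \<phi>(1)]) auto
    qed
    show "H 0 s = 0" for s by (simp add: H_def \<alpha>0)
    show "\<exists>p\<ge>0. q < H p 0" if q: "ereal q < a" for q
    proof -
      obtain u where u: "u \<ge> 0" "q < \<phi> u" using \<phi>(3)[OF q] by auto
      obtain p where p: "p \<ge> 0" "u < \<alpha> p" using \<alpha>(3) by auto
      have "\<phi> u \<le> \<phi> (\<alpha> p)" using mono(1)[OF \<phi>(1)] u p by auto
      then show ?thesis using u p by (auto simp: H_def intro!: exI[of _ p])
    qed
    show "\<exists>s\<ge>0. q < H p s" if p: "0 < p" and q: "ereal q < a" for p q
    proof -
      obtain u where u: "u \<ge> 0" "q < \<phi> u" using \<phi>(3)[OF q] by auto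
      define s where "s = u / \<omega> (\<alpha> p)"
      have w: "\<omega> (\<alpha> p) > 0" using \<omega>_pos \<alpha>_pos p by auto
      have "u \<le> \<alpha> p + s * \<omega> (\<alpha> p)" using w \<alpha>_pos[OF p] by (auto simp: s_def)
      then have "\<phi> u \<le> H p s" unfolding H_def using u by (intro mono(1)[OF \<phi>(1)]) auto
      then show ?thesis using u w by (intro exI[of _ s]) (auto simp: s_def)
    qed
  qed auto
  show ?thesis
    unfolding KL_bound_def
  proof (intro exI[of _ \<beta>] conjI allI impI \<beta>(1))
    fix y :: "real \<Rightarrow> 'a" and v w :: "real \<Rightarrow> real" and t0 t :: real
    assume ass: "\<forall>t\<ge>t0. y t \<in> X \<and> N (y t) \<le> B (y t0) \<and> W1 (y t) \<le> v t \<and> v t \<le> W2 (y t)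
        \<and> (v has_real_derivative w t) (at t within {t0..}) \<and> w t \<le> - W3 (y t)"
      and lt: "ereal (\<rho> (y t0)) < a" and t: "t0 \<le> t"
    note A = ass[rule_format]
    have yX: "y \<tau> \<in> X" if "t0 \<le> \<tau>" for \<tau> using A that by blast
    have decr: "v t \<le> v s - m * (t - s)"
      if st: "t0 \<le> s" "s \<le> t" and m: "\<And>\<tau>. s \<le> \<tau> \<Longrightarrow> \<tau> \<le> t \<Longrightarrow> m \<le> W3 (y \<tau>)" for s t m
    proof (rule real_derivative_le_imp_bound[OF st(2)])
      fix \<tau> assume \<tau>: "s \<le> \<tau>" "\<tau> \<le> t"
      then show "(v has_real_derivative w \<tau>) (at \<tau> within {s..t})"
        using A[of \<tau>] st by (auto intro: DERIV_subset)
      show "w \<tau> \<le> - m" using A[of \<tau>] m[OF \<tau>] \<tau> st by force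
    qed
    have antimono: "v t \<le> v s" if "t0 \<le> s" "s \<le> t" for s t
      using decr[OF that, of 0] nonneg(4) yX that by auto
    define p where "p = \<rho> (y t)"
    define s where "s = t - t0"
    define k where "k = \<kappa> (B (y t0))"
    have k: "k \<ge> 1" by (simp add: k_def \<kappa>_ge1)
    have p0: "0 \<le> p" "0 \<le> \<alpha> p" unfolding p_def using nonneg(1)[OF yX[OF t]] mono(3)[OF \<alpha>(1)] by auto
    have v_ge: "\<alpha> p \<le> v t" using \<alpha>(2)[OF yX[OF t]] A[OF t] by (auto simp: p_def)
    have rate: "\<omega> (\<alpha> p) / k \<le> W3 (y \<tau>)" if \<tau>: "t0 \<le> \<tau>" "\<tau> \<le> t" for \<tau>
    proof -
      have "\<alpha> p \<le> W2 (y \<tau>)" using v_ge antimono[OF \<tau>] A[OF \<tau>(1)] by auto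
      then have "\<omega> (\<alpha> p) \<le> W3 (y \<tau>) * \<kappa> (N (y \<tau>))"
        using \<omega>(2)[OF yX[OF \<tau>(1)]] mono(1)[OF \<omega>(1) p0(2)] by force
      also have "\<dots> \<le> W3 (y \<tau>) * k"
        unfolding k_def using nonneg(4)[OF yX] A \<tau> by (intro mult_left_mono \<kappa>_mono) auto
      finally show ?thesis using k by (simp add: divide_simps)
    qed
    have "v t \<le> v t0 - \<omega> (\<alpha> p) / k * s"
      unfolding s_def by (rule decr) (use rate t in auto)
    with v_ge p0 have "\<omega> (\<alpha> p) / k * s \<le> v t0" by simp
    then have "s * \<omega> (\<alpha> p) \<le> v t0 * k" using k by (simp add: divide_simps mult.commute)
    then have "\<alpha> p + s * \<omega> (\<alpha> p) \<le> v t0 * (1 + k)"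
      using v_ge antimono[OF order_refl t] by (simp add: algebra_simps)
    also have "\<dots> \<le> G (y t0)"
      unfolding G_def k_def[symmetric] using k A[of t0] by (intro mult_right_mono) auto
    finally have "H p s \<le> \<phi> (G (y t0))"
      unfolding H_def using arg0[of p s] p0 t by (intro mono(1)[OF \<phi>(1)]) (auto simp: s_def)
    also have "\<dots> \<le> \<rho> (y t0)" by (rule \<phi>(2)[OF yX[OF order_refl]])
    finally show "\<rho> (y t) \<le> \<beta> (\<rho> (y t0)) (t - t0)"
      using \<beta>(2)[of "\<rho> (y t0)" s p] lt nonneg(1)[OF yX[OF order_refl]] p0 t
      by (auto simp: right_open_def p_def s_def)
  qed
qed

section \<open>Ordinary differential equations in Euclidean space and on manifolds\<close>

text \<open>Both solutions stay in a compact set, on which all \<open>\<phi> t\<close> share a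
  Lipschitz constant \<open>L\<close>; then \<open>exp (- 2 L t)\<close> times the squared distance
  has nonpositive derivative and starts at 0.\<close>

lemma ode_unique:
  fixes \<phi> :: "real \<Rightarrow> 'e::euclidean_space \<Rightarrow> 'e"
  assumes ll: "local_lipschitz T U \<phi>" and T: "{a..b} \<subseteq> T"
    and cont: "\<And>u. u \<in> U \<Longrightarrow> continuous_on T (\<lambda>t. \<phi> t u)"
    and u: "\<And>t. t \<in> {a..b} \<Longrightarrow> (u has_vector_derivative \<phi> t (u t)) (at t within {a..b})"
      "\<And>t. t \<in> {a..b} \<Longrightarrow> u t \<in> U"
    and v: "\<And>t. t \<in> {a..b} \<Longrightarrow> (v has_vector_derivative \<phi> t (v t)) (at t within {a..b})"
      "\<And>t. t \<in> {a..b} \<Longrightarrow> v t \<in> U"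
    and init: "u a = v a" and t: "t \<in> {a..b}"
  shows "u t = v t"
proof -
  have cu: "continuous_on {a..b} u" "continuous_on {a..b} v"
    unfolding continuous_on_eq_continuous_within using u(1) v(1) has_vector_derivative_continuous by blast+
  define K where "K = u ` {a..b} \<union> v ` {a..b}"
  have K: "compact K" "K \<subseteq> U" using cu u v by (auto simp: K_def intro!: compact_Un compact_continuous_image)
  obtain L where L: "\<And>t. t \<in> {a..b} \<Longrightarrow> L-lipschitz_on K (\<phi> t)"
  proof (rule local_lipschitz_compact_implies_lipschitz[of "{a..b}" K \<phi>])
    show "local_lipschitz {a..b} K \<phi>" by (rule local_lipschitz_subset[OF ll T K(2)])
    show "continuous_on {a..b} (\<lambda>t. \<phi> t x)" if "x \<in> K" for x
      using cont[of x] that K T by (auto intro: continuous_on_subset)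
  qed (use K in auto)
  define h where "h t = exp (-(2 * L) * t) * ((u t - v t) \<bullet> (u t - v t))" for t
  have "h t \<le> h a - 0 * (t - a)"
  proof (rule real_derivative_le_imp_bound)
    fix r assume r: "a \<le> r" "r \<le> t"
    then have rab: "r \<in> {a..b}" using t by auto
    have uv: "(u has_derivative (\<lambda>x. x *\<^sub>R \<phi> r (u r))) (at r within {a..t})"
      "(v has_derivative (\<lambda>x. x *\<^sub>R \<phi> r (v r))) (at r within {a..t})"
      using u(1)[OF rab] v(1)[OF rab] t
      by (auto simp: has_vector_derivative_def intro: has_derivative_subset)
    show "(h has_real_derivative
        exp (-(2 * L) * r) * (2 * ((\<phi> r (u r) - \<phi> r (v r)) \<bullet> (u r - v r)) - 2 * L * ((u r - v r) \<bullet> (u r - v r))))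
        (at r within {a..t})"
      unfolding h_def has_field_derivative_def
      by (rule has_derivative_eq_rhs, (rule derivative_eq_intros uv refl)+)
        (auto simp: fun_eq_iff algebra_simps inner_commute inner_diff_left inner_diff_right)
    have "(\<phi> r (u r) - \<phi> r (v r)) \<bullet> (u r - v r) \<le> norm (\<phi> r (u r) - \<phi> r (v r)) * norm (u r - v r)"
      by (rule norm_cauchy_schwarz)
    also have "\<dots> \<le> (L * norm (u r - v r)) * norm (u r - v r)"
      using lipschitz_onD[OF L[OF rab], of "u r" "v r"] rab
      by (intro mult_right_mono) (auto simp: K_def dist_norm)
    also have "\<dots> = L * ((u r - v r) \<bullet> (u r - v r))"
      by (simp add: dot_square_norm power2_eq_square)
    finally show "exp (-(2 * L) * r) * (2 * ((\<phi> r (u r) - \<phi> r (v r)) \<bullet> (u r - v r)) - 2 * L * ((u r - v r) \<bullet> (u r - v r))) \<le> -0"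
      by (simp add: mult_le_0_iff)
  qed (use t in auto)
  then have "h t \<le> 0" using init by (simp add: h_def)
  then have "(u t - v t) \<bullet> (u t - v t) \<le> 0" by (simp add: h_def mult_le_0_iff)
  then show ?thesis using inner_ge_zero[of "u t - v t"] by (metis antisym inner_eq_zero_iff right_minus_eq)
qed

text \<open>Picard's fixed point argument on the bounded continuous functions on the whole line.
  Freezing time outside \<open>[a, b]\<close> by the clamp \<open>c\<close> makes the integral
  operator act on that Banach space; \<open>M\<close> keeps its values bounded and
  \<open>small\<close> makes it a contraction with factor \<open>1 / 2\<close>.\<close>

lemma ode_exists_strip:
  fixes \<psi> :: "real \<Rightarrow> 'e::euclidean_space \<Rightarrow> 'e"
  assumes ab: "a \<le> b" and cont: "continuous_on ({a..b} \<times> UNIV) (\<lambda>(t, u). \<psi> t u)"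
    and lip: "\<And>t. t \<in> {a..b} \<Longrightarrow> L-lipschitz_on UNIV (\<psi> t)"
    and small: "L * (b - a) \<le> 1 / 2"
    and bound: "\<And>t u. t \<in> {a..b} \<Longrightarrow> norm (\<psi> t u) \<le> M"
  obtains u where "u a = u0" "\<And>t. t \<in> {a..b} \<Longrightarrow> (u has_vector_derivative \<psi> t (u t)) (at t within {a..b})"
    "\<And>t. t \<in> {a..b} \<Longrightarrow> norm (u t - u0) \<le> M * (b - a)"
proof -
  define c where "c t = max a (min t b)" for t
  have c: "c t \<in> {a..b}" for t using ab by (auto simp: c_def)
  have cc: "continuous_on UNIV c" unfolding c_def by (intro continuous_intros)
  have L0: "0 \<le> L" using lip[of a] ab by (auto simp: lipschitz_on_def)
  have M0: "0 \<le> M" using bound[of a 0] ab by (meson atLeastAtMost_iff norm_ge_zero order_refl order_trans)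
  have ci: "continuous_on {a..s} (\<lambda>t. \<psi> t (apply_bcontfun u t))" if "s \<in> {a..b}" for u s
    using that by (intro continuous_on_compose2[OF cont, of _ "\<lambda>t. (t, apply_bcontfun u t)", simplified] continuous_intros) auto
  define I where "I u t = u0 + integral {a..c t} (\<lambda>t. \<psi> t (apply_bcontfun u t))" for u t
  have I_bound: "norm (I u t - u0) \<le> M * (b - a)" for u t
  proof -
    have "norm (I u t - u0) \<le> M * (c t - a)"
      unfolding I_def using c[of t] by (simp, intro integral_bound ci bound) auto
    also have "\<dots> \<le> M * (b - a)" using c[of t] M0 by (intro mult_left_mono) auto
    finally show ?thesis .
  qed
  have I_bc: "I u \<in> bcontfun" for u
  proof (rule bcontfun_normI)
    have "continuous_on {a..b} (\<lambda>s. integral {a..s} (\<lambda>t. \<psi> t (apply_bcontfun u t)))"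
      using ci[of b u] ab by (intro indefinite_integral_continuous_1 integrable_continuous_real) auto
    then have "continuous_on UNIV (\<lambda>t. integral {a..c t} (\<lambda>t. \<psi> t (apply_bcontfun u t)))"
      by (rule continuous_on_compose2[OF _ cc]) (use c in auto)
    then show "continuous_on UNIV (I u)"
      unfolding I_def by (intro continuous_intros)
    show "norm (I u t) \<le> norm u0 + M * (b - a)" for t
      using I_bound[of u t] norm_triangle_ineq[of "I u t - u0" u0] by simp
  qed
  have "\<exists>!u. Bcontfun (I u) = u"
  proof (rule banach_fix_type)
    show "\<forall>u v. dist (Bcontfun (I u)) (Bcontfun (I v)) \<le> 1 / 2 * dist u v"
    proof (intro allI dist_bound)
      fix u v :: "real \<Rightarrow>\<^sub>C 'e" and t
      have "dist (I u t) (I v t) = norm (integral {a..c t} (\<lambda>t. \<psi> t (u t) - \<psi> t (v t)))"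
        using ci[OF c, of t] by (simp add: I_def dist_norm integral_diff integrable_continuous_real)
      also have "\<dots> \<le> (L * dist u v) * (c t - a)"
      proof (rule integral_bound)
        show "a \<le> c t" using c[of t] by simp
        show "continuous_on {a..c t} (\<lambda>t. \<psi> t (u t) - \<psi> t (v t))"
          by (intro continuous_intros ci c)
        fix s assume "s \<in> {a..c t}"
        then have s: "s \<in> {a..b}" using c[of t] by auto
        have "norm (\<psi> s (u s) - \<psi> s (v s)) \<le> L * dist (u s) (v s)"
          using lipschitz_onD[OF lip[OF s], of "u s" "v s"] by (simp add: dist_norm)
        also have "\<dots> \<le> L * dist u v" using L0 by (intro mult_left_mono dist_bounded)
        finally show "norm (\<psi> s (u s) - \<psi> s (v s)) \<le> L * dist u v" .
      qed
      also have "\<dots> \<le> (L * dist u v) * (b - a)"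
        using c[of t] L0 by (intro mult_left_mono) auto
      also have "\<dots> \<le> 1 / 2 * dist u v"
        using mult_right_mono[OF small, of "dist u v"] by (simp add: algebra_simps)
      finally show "dist (apply_bcontfun (Bcontfun (I u)) t) (apply_bcontfun (Bcontfun (I v)) t) \<le> 1 / 2 * dist u v"
        by (simp add: Bcontfun_inverse I_bc)
    qed
  qed auto
  then obtain w where "Bcontfun (I w) = w" by auto
  then have w: "apply_bcontfun w t = I w t" for t by (metis Bcontfun_inverse I_bc)
  show ?thesis
  proof (rule that[of "I w"])
    show "I w a = u0" using ab by (simp add: I_def c_def)
    show "norm (I w t - u0) \<le> M * (b - a)" for t by (rule I_bound)
    fix t assume t: "t \<in> {a..b}"
    have "((\<lambda>s. u0 + integral {a..s} (\<lambda>t. \<psi> t (w t))) has_vector_derivative \<psi> t (w t)) (at t within {a..b})"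
      using integral_has_vector_derivative[OF ci[of b w] t] ab
      by (auto intro!: derivative_eq_intros)
    then have "((\<lambda>s. u0 + integral {a..s} (\<lambda>t. \<psi> t (w t))) has_vector_derivative \<psi> t (I w t)) (at t within {a..b})"
      by (simp add: w)
    then show "(I w has_vector_derivative \<psi> t (I w t)) (at t within {a..b})"
      by (rule has_vector_derivative_transform[OF t, rotated]) (simp add: I_def c_def)
  qed
qed

text \<open>Composing the field with the projection onto a small closed ball makes it globally Lipschitz,
  and the solution never leaves that ball.\<close>

lemma ode_exists_local:
  fixes \<phi> :: "real \<Rightarrow> 'e::euclidean_space \<Rightarrow> 'e"
  assumes ll: "local_lipschitz {0..} U \<phi>" and U: "open U"
    and cont: "\<And>u. u \<in> U \<Longrightarrow> continuous_on {0..} (\<lambda>t. \<phi> t u)"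
    and t1: "0 \<le> t1" and u1: "u1 \<in> U"
  obtains d where "0 < d" "\<And>t0 u0. 0 \<le> t0 \<Longrightarrow> t0 \<in> ball t1 d \<Longrightarrow> u0 \<in> ball u1 d \<Longrightarrow>
    \<exists>u. u t0 = u0 \<and> (\<forall>t\<in>{t0..t0+d}. u t \<in> U \<and> (u has_vector_derivative \<phi> t (u t)) (at t within {t0..t0+d}))"
proof -
  obtain r1 L where r1: "0 < r1" and L1: "\<And>s. s \<in> cball t1 r1 \<inter> {0..} \<Longrightarrow> L-lipschitz_on (cball u1 r1 \<inter> U) (\<phi> s)"
    using local_lipschitzE[OF ll, of t1 u1] t1 u1 by (metis atLeast_iff)
  obtain r2 where r2: "0 < r2" "cball u1 r2 \<subseteq> U" using U u1 open_contains_cball by blast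
  define r where "r = min r1 r2"
  define Q where "Q = cball u1 r"
  have r: "0 < r" "Q \<subseteq> U" "r \<le> r1" "Q \<subseteq> cball u1 r1" using r1 r2 by (auto simp: r_def Q_def)
  have L: "L-lipschitz_on Q (\<phi> s)" if "s \<in> cball t1 r \<inter> {0..}" for s
    by (rule lipschitz_on_subset[OF L1]) (use that r in auto)
  have L0: "0 \<le> L" using L[of t1] r t1 by (auto simp: lipschitz_on_def)
  have Q: "compact Q" "convex Q" "closed Q" "Q \<noteq> {}" using r by (auto simp: Q_def)
  have jc: "continuous_on ({0..} \<times> U) (\<lambda>(t, u). \<phi> t u)"
    by (rule continuous_on_TimesI[OF ll cont])
  have "compact (({0..} \<inter> cball t1 r) \<times> Q)"
    using Q by (intro compact_Times closed_Int_compact) auto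
  then have "bounded ((\<lambda>(t, u). \<phi> t u) ` (({0..} \<inter> cball t1 r) \<times> Q))"
    using r by (intro compact_imp_bounded compact_continuous_image continuous_on_subset[OF jc]) auto
  then obtain M where M: "\<And>t u. t \<in> {0..} \<inter> cball t1 r \<Longrightarrow> u \<in> Q \<Longrightarrow> norm (\<phi> t u) \<le> M"
    unfolding bounded_iff by fastforce
  have M0: "0 \<le> M"
    using M[of t1 u1] t1 r by (auto simp: Q_def intro: order_trans[OF norm_ge_zero])
  \<comment> \<open>\<open>k\<close> keeps the times in the Lipschitz neighbourhood and the initial
    point within \<open>r / 2\<close> of the centre, \<open>l\<close> gives the contraction
    condition, and \<open>m\<close> bounds the displacement by \<open>r / 2\<close>. The added 1
    avoids division by 0.\<close>
  define k l m where "k = r / 2" and "l = 1 / (2 * (L + 1))" and "m = r / (2 * (M + 1))"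
  have "0 < k" "0 < l" "0 < m" using r L0 M0 by (auto simp: k_def l_def m_def)
  define d where "d = min k (min l m)"
  have "0 < d" "d \<le> k" "d \<le> l" "d \<le> m" using \<open>0 < k\<close> \<open>0 < l\<close> \<open>0 < m\<close> by (auto simp: d_def)
  then have d: "0 < d" "d \<le> r / 2" "d \<le> 1 / (2 * (L + 1))" "d \<le> r / (2 * (M + 1))"
    by (simp_all only: k_def l_def m_def)
  have Ld: "L * d \<le> 1 / 2"
  proof -
    have "L * d \<le> L * (1 / (2 * (L + 1)))" using d L0 by (intro mult_left_mono) auto
    also have "\<dots> \<le> 1 / 2" using L0 by (simp add: divide_simps)
    finally show ?thesis .
  qed
  have Md: "M * d \<le> r / 2"
  proof -
    have "M * d \<le> M * (r / (2 * (M + 1)))" using d M0 by (intro mult_left_mono) auto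
    also have "\<dots> \<le> r / 2" using M0 r by (simp add: divide_simps)
    finally show ?thesis .
  qed
  define P where "P = closest_point Q"
  have P: "P u \<in> Q" "u \<in> Q \<Longrightarrow> P u = u" for u
    using Q closest_point_in_set closest_point_self by (auto simp: P_def)
  show ?thesis
  proof (rule that[OF d(1)])
    fix t0 u0 assume t0: "0 \<le> t0" "t0 \<in> ball t1 d" and u0: "u0 \<in> ball u1 d"
    have I: "{t0..t0+d} \<subseteq> {0..} \<inter> cball t1 r" using t0 d by (auto simp: dist_real_def)
    obtain u where u: "u t0 = u0"
      "\<And>t. t \<in> {t0..t0+d} \<Longrightarrow> (u has_vector_derivative \<phi> t (P (u t))) (at t within {t0..t0+d})"
      "\<And>t. t \<in> {t0..t0+d} \<Longrightarrow> norm (u t - u0) \<le> M * (t0 + d - t0)"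
    proof (rule ode_exists_strip[of t0 "t0 + d" "\<lambda>t u. \<phi> t (P u)" L M u0])
      show "continuous_on ({t0..t0+d} \<times> UNIV) (\<lambda>(t, u). \<phi> t (P u))"
      proof -
        have "continuous_on UNIV P"
          unfolding P_def using Q by (intro continuous_on_closest_point) auto
        then have "continuous_on ({t0..t0+d} \<times> UNIV) (\<lambda>x. (fst x, P (snd x)))"
          by (rule continuous_on_Pair[OF continuous_on_fst[OF continuous_on_id]
              continuous_on_compose2[OF _ continuous_on_snd[OF continuous_on_id] subset_UNIV]])
        then have "continuous_on ({t0..t0+d} \<times> UNIV) (\<lambda>x. (\<lambda>(t, u). \<phi> t u) (fst x, P (snd x)))"
        proof (rule continuous_on_compose2[OF jc])
          show "(\<lambda>x. (fst x, P (snd x))) ` ({t0..t0+d} \<times> UNIV) \<subseteq> {0..} \<times> U"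
            using subsetD[OF I] subsetD[OF r(2) P(1)] by force
        qed
        then show ?thesis by (simp add: split_def)
      qed
      show "L-lipschitz_on UNIV (\<lambda>u. \<phi> t (P u))" if t: "t \<in> {t0..t0+d}" for t
      proof (rule lipschitz_onI)
        fix x y
        have "dist (\<phi> t (P x)) (\<phi> t (P y)) \<le> L * dist (P x) (P y)"
          using L[of t] t I P by (intro lipschitz_onD[where X = Q]) auto
        also have "\<dots> \<le> L * dist x y"
          unfolding P_def using L0 by (intro mult_left_mono closest_point_lipschitz Q)
        finally show "dist (\<phi> t (P x)) (\<phi> t (P y)) \<le> L * dist x y" .
      qed (rule L0)
      show "norm (\<phi> t (P u)) \<le> M" if "t \<in> {t0..t0+d}" for t u using M P that I by auto
    qed (use d Ld in auto)
    have uQ: "u t \<in> Q" if "t \<in> {t0..t0+d}" for t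
    proof -
      have "dist u1 (u t) \<le> dist u1 u0 + norm (u t - u0)" by (metis dist_commute dist_norm dist_triangle)
      also have "\<dots> \<le> r / 2 + r / 2" using u(3)[OF that] Md d u0 by (intro add_mono) auto
      finally show ?thesis by (simp add: Q_def)
    qed
    show "\<exists>u. u t0 = u0 \<and> (\<forall>t\<in>{t0..t0+d}. u t \<in> U \<and> (u has_vector_derivative \<phi> t (u t)) (at t within {t0..t0+d}))"
      using u uQ P(2) r(2) by (intro exI[of _ u]) fastforce
  qed
qed

lemma smooth_on_frechet:
  assumes "smooth_on S h" "x \<in> S"
  shows "(h has_derivative frechet_derivative h (at x)) (at x)"
proof -
  have "open S" "Ck_on (Suc 0) S h" using assms unfolding smooth_on_def by blast+
  then have "h differentiable (at x)"
    using assms(2) by (auto simp: differentiable_on_eq_differentiable_at)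
  then show ?thesis by (simp add: frechet_derivative_works)
qed

section \<open>Charts, velocities and solutions on a manifold\<close>

locale manifold =
  fixes A :: "('m::{t2_space,second_countable_topology}, 'e::euclidean_space) chart set"
  assumes atlas: "smooth_atlas A"
begin

lemma chart:
  assumes "c \<in> A"
  shows open_cdom: "open (cdom c)" and open_cimage: "open (cmap c ` cdom c)"
    and cinv_cmap: "\<And>x. x \<in> cdom c \<Longrightarrow> cinv c (cmap c x) = x"
    and cinv_in: "\<And>u. u \<in> cmap c ` cdom c \<Longrightarrow> cinv c u \<in> cdom c"
    and continuous_cmap: "continuous_on (cdom c) (cmap c)"
    and continuous_cinv: "continuous_on (cmap c ` cdom c) (cinv c)"
  using atlas assms by (auto simp: smooth_atlas_def homeomorphism_def)

lemma chart_at: obtains c where "c \<in> A" "x \<in> cdom c"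
proof -
  have "x \<in> (\<Union>c\<in>A. cdom c)" using atlas by (simp add: smooth_atlas_def)
  then show ?thesis using that by blast
qed

lemma open_cmap_image:
  assumes "c \<in> A" "open S"
  shows "open (cmap c ` (cdom c \<inter> S))"
proof -
  have "cmap c ` (cdom c \<inter> S) = cmap c ` cdom c \<inter> cinv c -` S"
    using cinv_cmap[OF assms(1)] by force
  then show ?thesis
    using continuous_on_open_vimage[OF open_cimage[OF assms(1)]] continuous_cinv[OF assms(1)] assms(2)
    by (metis Int_commute)
qed

lemma transition_smooth:
  "c \<in> A \<Longrightarrow> d \<in> A \<Longrightarrow> smooth_on (cmap c ` (cdom c \<inter> cdom d)) (cmap d \<circ> cinv c)"
  using atlas by (auto simp: smooth_atlas_def)

lemma transition_has_derivative:
  assumes "c \<in> A" "d \<in> A" "x \<in> cdom c" "x \<in> cdom d"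
  shows "((cmap d \<circ> cinv c) has_derivative frechet_derivative (cmap d \<circ> cinv c) (at (cmap c x))) (at (cmap c x))"
  by (rule smooth_on_frechet[OF transition_smooth]) (use assms in auto)

lemma tangent_transition:
  assumes "X \<in> tangent_space A x" "c \<in> A" "d \<in> A" "x \<in> cdom c" "x \<in> cdom d"
  shows "X d = frechet_derivative (cmap d \<circ> cinv c) (at (cmap c x)) (X c)"
  using assms unfolding tangent_space_def by blast

text \<open>The chain rule with the transition map carries the derivative from one chart to every
  other; near \<open>t\<close> the curve stays in the first chart by continuity.\<close>

lemma has_velocityI:
  assumes c: "c \<in> A" "\<gamma> t \<in> cdom c" and cont: "continuous (at t within I) \<gamma>"
    and X: "X \<in> tangent_space A (\<gamma> t)"
    and deriv: "((\<lambda>s. cmap c (\<gamma> s)) has_vector_derivative X c) (at t within I)"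
    and t: "t \<in> I"
  shows "has_velocity A I \<gamma> t X"
  unfolding has_velocity_def
proof (intro conjI ballI impI cont X)
  fix d assume d: "d \<in> A" "\<gamma> t \<in> cdom d"
  let ?h = "cmap d \<circ> cinv c"
  have "(?h has_derivative frechet_derivative ?h (at (cmap c (\<gamma> t)))) (at (cmap c (\<gamma> t)))"
    using c d by (intro transition_has_derivative)
  from vector_derivative_diff_chain_within[OF deriv has_derivative_at_withinI[OF this]]
  have "((?h \<circ> (\<lambda>s. cmap c (\<gamma> s))) has_derivative (\<lambda>r. r *\<^sub>R X d)) (at t within I)"
    using tangent_transition[OF X c(1) d(1) c(2) d(2)] by (simp add: has_vector_derivative_def comp_def)
  moreover have "\<forall>\<^sub>F s in at t within I. \<gamma> s \<in> cdom c"
    using cont c open_cdom[OF c(1)] by (auto simp: continuous_within tendsto_def)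
  then have "\<forall>\<^sub>F s in at t within I. (?h \<circ> (\<lambda>s. cmap c (\<gamma> s))) s = (cmap d \<circ> \<gamma>) s"
    by eventually_elim (simp add: cinv_cmap[OF c(1)])
  ultimately show "((cmap d \<circ> \<gamma>) has_vector_derivative X d) (at t within I)"
    unfolding has_vector_derivative_def
    by (rule has_derivative_transform_eventually) (use c t in \<open>auto simp: cinv_cmap\<close>)
qed

lemma has_velocity_chart:
  assumes "has_velocity A I \<gamma> t X" "c \<in> A" "\<gamma> t \<in> cdom c"
  shows "((\<lambda>s. cmap c (\<gamma> s)) has_vector_derivative X c) (at t within I)"
  using assms by (auto simp: has_velocity_def comp_def)

lemma has_velocity_subset:
  assumes "has_velocity A I \<gamma> t X" "J \<subseteq> I"
  shows "has_velocity A J \<gamma> t X"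
  using assms unfolding has_velocity_def
  by (auto intro: continuous_within_subset has_vector_derivative_within_subset)

lemma has_velocity_cong:
  assumes "has_velocity A I \<gamma> t X" "\<And>s. s \<in> I \<Longrightarrow> \<gamma> s = \<gamma>' s" "t \<in> I"
  shows "has_velocity A I \<gamma>' t X"
proof -
  have "((cmap c \<circ> \<gamma>') has_vector_derivative v) (at t within I)"
    if "((cmap c \<circ> \<gamma>) has_vector_derivative v) (at t within I)" for v and c :: "('m, 'e) chart"
    by (rule has_vector_derivative_transform[OF assms(3) _ that]) (use assms(2) in auto)
  moreover have "\<forall>\<^sub>F s in at t within I. \<gamma> s = \<gamma>' s"
    using assms(2) by (auto simp: eventually_at_filter)
  then have "continuous (at t within I) \<gamma>'" if "continuous (at t within I) \<gamma>"
    using that assms(2)[OF assms(3)] tendsto_cong[of \<gamma> \<gamma>'] by (auto simp: continuous_within)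
  ultimately show ?thesis using assms by (auto simp: has_velocity_def)
qed

lemma has_velocity_filter:
  assumes "has_velocity A I \<gamma> t X" "at t within J = at t within I"
  shows "has_velocity A J \<gamma> t X"
  using assms by (simp add: has_velocity_def)

lemma has_velocity_Un:
  assumes "has_velocity A I \<gamma> t X" "has_velocity A J \<gamma> t X"
  shows "has_velocity A (I \<union> J) \<gamma> t X"
proof -
  have "((cmap c \<circ> \<gamma>) has_vector_derivative v) (at t within I \<union> J)"
    if "((cmap c \<circ> \<gamma>) has_vector_derivative v) (at t within I)"
      "((cmap c \<circ> \<gamma>) has_vector_derivative v) (at t within J)" for v and c :: "('m, 'e) chart"
    using that by (auto simp: has_vector_derivative_def has_derivative_within intro: Lim_Un)
  then show ?thesis
    using assms by (auto simp: has_velocity_def continuous_within intro: Lim_Un)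
qed

lemma solution_on_subset:
  "solution_on A D f I x \<Longrightarrow> J \<subseteq> I \<Longrightarrow> solution_on A D f J x"
  by (auto simp: solution_on_def intro: has_velocity_subset)

lemma solution_on_cong:
  assumes "solution_on A D f I x" "\<And>t. t \<in> I \<Longrightarrow> x t = y t"
  shows "solution_on A D f I y"
  using assms by (auto simp: solution_on_def intro: has_velocity_cong[of I x])

lemma solution_on_continuous:
  "solution_on A D f I x \<Longrightarrow> continuous_on I x"
  by (auto simp: solution_on_def has_velocity_def continuous_on_eq_continuous_within)

lemma solution_join:
  assumes x: "solution_on A D f {a..b} x" and y: "solution_on A D f {b..d} y"
    and eq: "x b = y b" and ab: "a \<le> b" "b \<le> d"
  shows "solution_on A D f {a..d} (\<lambda>t. if t \<le> b then x t else y t)" (is "solution_on A D f _ ?z")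
proof -
  have z: "solution_on A D f {a..b} ?z" "solution_on A D f {b..d} ?z"
    using eq by (auto intro!: solution_on_cong[OF x] solution_on_cong[OF y])
  have un: "{a..d} = {a..b} \<union> {b..d}" using ab by auto
  \<comment> \<open>A closed interval not containing \<open>t\<close> contributes the trivial
    filter, so information from both sides has to be combined only at the junction
    \<open>b\<close>.\<close>
  have bot: "at t within J = bot" if "closed J" "t \<notin> J" for t and J :: "real set"
    using that by (metis at_within_eq_bot_iff closure_closed Diff_empty Diff_insert0)
  have "?z t \<in> D \<and> has_velocity A {a..d} ?z t (f t (?z t))" if t: "t \<in> {a..d}" for t
  proof -
    consider "t \<in> {a..b}" "t \<in> {b..d}" | "t \<in> {a..b}" "t \<notin> {b..d}" | "t \<notin> {a..b}" "t \<in> {b..d}"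
      using t un by blast
    then show ?thesis
    proof cases
      case 1
      then show ?thesis unfolding un using z has_velocity_Un unfolding solution_on_def by blast
    next
      case 2
      then have "at t within {a..d} = at t within {a..b}"
        unfolding un at_within_union using bot[of "{b..d}" t] by auto
      then show ?thesis using z(1) 2 has_velocity_filter unfolding solution_on_def by blast
    next
      case 3
      then have "at t within {a..d} = at t within {b..d}"
        unfolding un at_within_union using bot[of "{a..b}" t] by auto
      then show ?thesis using z(2) 3 has_velocity_filter unfolding solution_on_def by blast
    qed
  qed
  then show ?thesis by (auto simp: solution_on_def)
qed

text \<open>At the infimum \<open>s\<close> of the times of disagreement the solutions agree, by
  continuity and the Hausdorff property. In a chart around that point \<open>ode_unique\<close>
  pushes agreement beyond \<open>s\<close>, which is impossible unless \<open>s\<close> is the right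
  end point.\<close>

lemma solution_unique:
  assumes D: "open D"
    and f: "continuous_in_time A D f" "locally_lipschitz_in_state A D f"
    and x: "solution_on A D f {a..b} x" and y: "solution_on A D f {a..b} y"
    and a: "0 \<le> a" and init: "x a = y a" and t: "t \<in> {a..b}"
  shows "x t = y t"
proof (rule ccontr)
  assume "x t \<noteq> y t"
  define N where "N = {s\<in>{a..b}. x s \<noteq> y s}"
  define s where "s = Inf N"
  have N: "t \<in> N" "bdd_below N" using t \<open>x t \<noteq> y t\<close> by (auto simp: N_def intro: bdd_belowI[of _ a])
  have "a \<le> s" unfolding s_def by (rule cInf_greatest) (use N in \<open>auto simp: N_def\<close>)
  moreover have "s \<le> t" unfolding s_def by (rule cInf_lower[OF N])
  ultimately have s: "a \<le> s" "s \<le> t" "s \<in> {a..b}" using t by auto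
  have below: "x r = y r" if "a \<le> r" "r < s" for r
    using cInf_lower[OF _ N(2), of r] that s t by (fastforce simp: N_def s_def)
  have cont: "continuous_on {a..b} x" "continuous_on {a..b} y"
    using x y by (auto intro: solution_on_continuous)
  have lim: "(x \<longlongrightarrow> x s) (at s within {a..b})" "(y \<longlongrightarrow> y s) (at s within {a..b})"
    using cont s(3) by (simp_all add: continuous_on_def)
  have xs: "x s = y s"
  proof (cases "s = a")
    case False
    then have as: "a < s" using s by simp
    have F: "at s within {a..<s} \<noteq> bot"
      using as by (simp add: at_within_eq_bot_iff)
    have "(x \<longlongrightarrow> x s) (at s within {a..<s})" "(y \<longlongrightarrow> y s) (at s within {a..<s})"
      using s t by (auto intro!: tendsto_within_subset[OF lim(1)] tendsto_within_subset[OF lim(2)])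
    moreover have "\<forall>\<^sub>F r in at s within {a..<s}. x r = y r"
      using below by (auto simp: eventually_at_filter)
    ultimately show ?thesis using tendsto_cong[of x y] tendsto_unique[OF F] by blast
  qed (simp add: init)
  obtain c where c: "c \<in> A" "x s \<in> cdom c" by (rule chart_at)
  have xsD: "x s \<in> D" using x s t by (auto simp: solution_on_def)
  let ?O = "cdom c \<inter> D"
  have O: "open ?O" using D open_cdom[OF c(1)] by auto
  have ev: "\<forall>\<^sub>F r in at s within {a..b}. x r \<in> ?O \<and> y r \<in> ?O"
    using topological_tendstoD[OF lim(1) O] topological_tendstoD[OF lim(2) O] c xsD xs
    by (simp add: eventually_conj_iff)
  then obtain d where d: "d > 0" "\<And>r. r \<in> {a..b} \<Longrightarrow> r \<noteq> s \<Longrightarrow> dist r s < d \<Longrightarrow> x r \<in> ?O \<and> y r \<in> ?O"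
    by (auto simp: eventually_at)
  have dO: "x r \<in> ?O" "y r \<in> ?O" if "r \<in> {a..b}" "dist r s < d" for r
    using d(2)[OF that(1)] that(2) c xsD xs by (cases "r = s"; auto)+
  \<comment> \<open>Beyond \<open>s\<close> by \<open>d / 2\<close> unless the interval ends
    earlier; the latter case leaves \<open>s = b\<close> and is excluded by the agreement at
    \<open>s\<close> itself.\<close>
  define e where "e = min b (s + d / 2)"
  have se: "{s..e} \<subseteq> {a..b}" "\<And>r. r \<in> {s..e} \<Longrightarrow> dist r s < d"
    using s t d by (auto simp: e_def dist_real_def)
  have agree: "x r = y r" if r: "r \<in> {s..e}" for r
  proof -
    have "cmap c (x r) = cmap c (y r)"
    proof (rule ode_unique[of "{0..}" "cmap c ` ?O" "\<lambda>t u. f t (cinv c u) c" s e "\<lambda>t. cmap c (x t)" "\<lambda>t. cmap c (y t)"])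
      show "local_lipschitz {0..} (cmap c ` ?O) (\<lambda>t u. f t (cinv c u) c)"
        using f(2) c by (auto simp: locally_lipschitz_in_state_def)
      show "continuous_on {0..} (\<lambda>t. f t (cinv c u) c)" if "u \<in> cmap c ` ?O" for u
        using f(1) that c cinv_cmap[OF c(1)] by (auto simp: continuous_in_time_def)
      show "((\<lambda>t. cmap c (x t)) has_vector_derivative f t (cinv c (cmap c (x t))) c) (at t within {s..e})"
        "((\<lambda>t. cmap c (y t)) has_vector_derivative f t (cinv c (cmap c (y t))) c) (at t within {s..e})"
        if "t \<in> {s..e}" for t
        using dO[of t] se that c cinv_cmap[OF c(1)]
          has_velocity_subset[OF _ se(1), THEN has_velocity_chart, OF _ c(1)] x y
        unfolding solution_on_def by (auto simp: subset_iff)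
    qed (use se a s r xs dO in \<open>auto simp: subset_iff\<close>)
    then show ?thesis
      using dO[of r] se r cinv_cmap[OF c(1)] by (metis IntE subsetD)
  qed
  have "e \<le> s"
    unfolding s_def
  proof (rule cInf_greatest)
    fix r assume r: "r \<in> N"
    then have "s \<le> r" using cInf_lower[OF r N(2)] by (simp add: s_def)
    with agree[of r] r show "e \<le> r" by (fastforce simp: N_def)
  qed (use N in auto)
  then have "s = b" using d s t by (auto simp: e_def min_def split: if_splits)
  with s t xs \<open>x t \<noteq> y t\<close> show False by auto
qed

text \<open>One length \<open>d\<close> serves all initial times near \<open>t1\<close> and all
  initial points near \<open>p\<close>, which is the form a compactness argument needs.\<close>

lemma solution_exists_local:
  assumes D: "open D"
    and f: "vector_field_on A D f" "continuous_in_time A D f" "locally_lipschitz_in_state A D f"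
    and p: "p \<in> D" and t1: "0 \<le> t1"
  obtains d N where "0 < d" "open N" "p \<in> N" "\<And>t0 q. 0 \<le> t0 \<Longrightarrow> t0 \<in> ball t1 d \<Longrightarrow> q \<in> N \<Longrightarrow>
    \<exists>x. x t0 = q \<and> solution_on A D f {t0..t0+d} x"
proof -
  obtain c where c: "c \<in> A" "p \<in> cdom c" by (rule chart_at)
  let ?O = "cdom c \<inter> D" and ?\<phi> = "\<lambda>t u. f t (cinv c u) c"
  have O: "open ?O" "open (cmap c ` ?O)" using D open_cdom[OF c(1)] open_cmap_image[OF c(1) D] by auto
  have ll: "local_lipschitz {0..} (cmap c ` ?O) ?\<phi>"
    using f(3) c by (auto simp: locally_lipschitz_in_state_def)
  have ct: "continuous_on {0..} (\<lambda>t. ?\<phi> t u)" if "u \<in> cmap c ` ?O" for u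
    using f(2) that c cinv_cmap[OF c(1)] by (auto simp: continuous_in_time_def)
  obtain d where d: "0 < d" "\<And>t0 u0. 0 \<le> t0 \<Longrightarrow> t0 \<in> ball t1 d \<Longrightarrow> u0 \<in> ball (cmap c p) d \<Longrightarrow>
    \<exists>u. u t0 = u0 \<and> (\<forall>t\<in>{t0..t0+d}. u t \<in> cmap c ` ?O \<and> (u has_vector_derivative ?\<phi> t (u t)) (at t within {t0..t0+d}))"
    by (rule ode_exists_local[OF ll O(2) ct t1, of "cmap c p"]) (use p c in auto)
  define N where "N = cdom c \<inter> cmap c -` ball (cmap c p) d"
  have N: "open N" "p \<in> N"
    using continuous_on_open_vimage[OF open_cdom[OF c(1)]] continuous_cmap[OF c(1)] c d
    by (auto simp: N_def Int_commute)
  show ?thesis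
  proof (rule that[OF d(1) N])
    fix t0 q assume t0: "0 \<le> t0" "t0 \<in> ball t1 d" and q: "q \<in> N"
    let ?I = "{t0..t0+d}"
    obtain u where u: "u t0 = cmap c q" "\<And>t. t \<in> ?I \<Longrightarrow> u t \<in> cmap c ` ?O"
      "\<And>t. t \<in> ?I \<Longrightarrow> (u has_vector_derivative ?\<phi> t (u t)) (at t within ?I)"
      using d(2)[OF t0, of "cmap c q"] q by (auto simp: N_def)
    have uO: "cinv c (u t) \<in> ?O" "cmap c (cinv c (u t)) = u t" if "t \<in> ?I" for t
      using u(2)[OF that] cinv_cmap[OF c(1)] by auto
    have cu: "continuous_on ?I u"
      unfolding continuous_on_eq_continuous_within using u(3) has_vector_derivative_continuous by blast
    have cx: "continuous_on ?I (\<lambda>t. cinv c (u t))"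
      by (rule continuous_on_compose2[OF continuous_cinv[OF c(1)] cu]) (use u(2) in blast)
    have "solution_on A D f ?I (\<lambda>t. cinv c (u t))"
      unfolding solution_on_def
    proof (intro ballI conjI)
      fix t assume t: "t \<in> ?I"
      show "cinv c (u t) \<in> D" using uO[OF t] by auto
      show "has_velocity A ?I (\<lambda>t. cinv c (u t)) t (f t (cinv c (u t)))"
      proof (rule has_velocityI[OF c(1)])
        show "f t (cinv c (u t)) \<in> tangent_space A (cinv c (u t))"
          using f(1) uO[OF t] t t0 by (auto simp: vector_field_on_def)
        show "((\<lambda>s. cmap c (cinv c (u s))) has_vector_derivative f t (cinv c (u t)) c) (at t within ?I)"
          by (rule has_vector_derivative_transform[OF t uO(2) u(3)[OF t]])
      qed (use uO[OF t] t cx in \<open>auto simp: continuous_on_eq_continuous_within\<close>)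
    qed
    moreover have "cinv c (u t0) = q" using u(1) q cinv_cmap[OF c(1)] by (simp add: N_def)
    ultimately show "\<exists>x. x t0 = q \<and> solution_on A D f ?I x"
      by (intro exI[of _ "\<lambda>t. cinv c (u t)"] conjI)
  qed
qed

lemma solution_exists_uniform:
  assumes D: "open D"
    and f: "vector_field_on A D f" "continuous_in_time A D f" "locally_lipschitz_in_state A D f"
    and K: "compact K" "K \<subseteq> D"
  obtains d where "0 < d" "\<And>t0 q. t0 \<in> {0..T} \<Longrightarrow> q \<in> K \<Longrightarrow>
    \<exists>x. x t0 = q \<and> solution_on A D f {t0..t0+d} x"
proof -
  have "\<exists>d N. 0 < d \<and> open N \<and> snd z \<in> N \<and> (\<forall>t0 q. 0 \<le> t0 \<longrightarrow> t0 \<in> ball (fst z) d \<longrightarrow> q \<in> N \<longrightarrow>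
    (\<exists>x. x t0 = q \<and> solution_on A D f {t0..t0+d} x))" if z: "z \<in> {0..T} \<times> K" for z
  proof -
    have "snd z \<in> D" "0 \<le> fst z" using z K by auto
    from solution_exists_local[OF D f this] show ?thesis by metis
  qed
  then obtain d N where dN: "\<And>z. z \<in> {0..T} \<times> K \<Longrightarrow> 0 < d z \<and> open (N z) \<and> snd z \<in> N z \<and>
    (\<forall>t0 q. 0 \<le> t0 \<longrightarrow> t0 \<in> ball (fst z) (d z) \<longrightarrow> q \<in> N z \<longrightarrow> (\<exists>x. x t0 = q \<and> solution_on A D f {t0..t0 + d z} x))"
    by metis
  have "compact ({0..T} \<times> K)" using K by (intro compact_Times) auto
  then obtain C where C: "C \<subseteq> {0..T} \<times> K" "finite C" "{0..T} \<times> K \<subseteq> (\<Union>z\<in>C. ball (fst z) (d z) \<times> N z)"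
  proof (rule compactE_image[where f = "\<lambda>z. ball (fst z) (d z) \<times> N z" and C = "{0..T} \<times> K"])
    show "open (ball (fst z) (d z) \<times> N z)" if "z \<in> {0..T} \<times> K" for z
      using dN[OF that] by (intro open_Times) auto
    show "{0..T} \<times> K \<subseteq> (\<Union>c\<in>{0..T} \<times> K. ball (fst c) (d c) \<times> N c)"
    proof
      fix z assume z: "z \<in> {0..T} \<times> K"
      then have "z \<in> ball (fst z) (d z) \<times> N z" using dN[OF z] by (auto simp: mem_Times_iff)
      then show "z \<in> (\<Union>c\<in>{0..T} \<times> K. ball (fst c) (d c) \<times> N c)" using z by blast
    qed
  qed auto
  \<comment> \<open>The entry 1 keeps the set nonempty when the finite subcover is empty.\<close>
  define e where "e = Min (insert 1 (d ` C))"
  have e: "0 < e" "\<And>z. z \<in> C \<Longrightarrow> e \<le> d z"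
    using C dN by (auto simp: e_def)
  show ?thesis
  proof (rule that[OF e(1)])
    fix t0 q assume "t0 \<in> {0..T}" "q \<in> K"
    then obtain z where z: "z \<in> C" "t0 \<in> ball (fst z) (d z)" "q \<in> N z" using C(3) by blast
    with dN[of z] C(1) \<open>t0 \<in> {0..T}\<close> obtain x where "x t0 = q" "solution_on A D f {t0..t0 + d z} x" by fastforce
    then show "\<exists>x. x t0 = q \<and> solution_on A D f {t0..t0+e} x"
      using e(2)[OF z(1)] by (auto intro!: exI[of _ x] solution_on_subset[of D f "{t0..t0 + d z}"])
  qed
qed

text \<open>Each step prolongs the solution by the same length, because \<open>trap\<close> returns
  its end point to the compact set \<open>K\<close>. The condition \<open>trap\<close> speaks of
  solutions on compact intervals, so that existence on the half-line is not presupposed.\<close>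

lemma solution_global:
  assumes D: "open D"
    and f: "vector_field_on A D f" "continuous_in_time A D f" "locally_lipschitz_in_state A D f"
    and K: "compact K" "K \<subseteq> D" and t0: "0 \<le> t0"
    and trap: "\<And>T y. t0 \<le> T \<Longrightarrow> solution_on A D f {t0..T} y \<Longrightarrow> y t0 = x0 \<Longrightarrow> y T \<in> K"
    and x0: "x0 \<in> K"
  obtains x where "solution_on A D f {t0..} x" "x t0 = x0"
    "\<And>T y. t0 < T \<Longrightarrow> solution_on A D f {t0..<T} y \<Longrightarrow> y t0 = x0 \<Longrightarrow> (\<forall>t\<in>{t0..<T}. y t = x t)"
proof -
  have ex: "\<exists>y. solution_on A D f {t0..T} y \<and> y t0 = x0" if T: "t0 \<le> T" for T
  proof -
    obtain d where d: "0 < d" "\<And>s q. s \<in> {0..T} \<Longrightarrow> q \<in> K \<Longrightarrow> \<exists>x. x s = q \<and> solution_on A D f {s..s+d} x"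
      using solution_exists_uniform[OF D f K] by metis
    \<comment> \<open>The cut at \<open>T\<close> keeps the restart times in \<open>{0..T}\<close>,
      where the length \<open>d\<close> is valid.\<close>
    have step: "\<exists>y. solution_on A D f {t0..min T (t0 + real (Suc n) * d)} y \<and> y t0 = x0" for n
    proof (induction n)
      case 0
      obtain y where "y t0 = x0" "solution_on A D f {t0..t0+d} y" using d(2)[of t0 x0] t0 T x0 by auto
      then show ?case by (intro exI[of _ y]) (auto intro: solution_on_subset)
    next
      case (Suc n)
      define b where "b = min T (t0 + real (Suc n) * d)"
      have b: "t0 \<le> b" "b \<le> T" using T d by (auto simp: b_def)
      obtain y where y: "solution_on A D f {t0..b} y" "y t0 = x0" using Suc by (auto simp: b_def)
      have "y b \<in> K" by (rule trap[OF b(1) y])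
      then obtain z where z: "z b = y b" "solution_on A D f {b..b+d} z" using d(2)[of b "y b"] b t0 by auto
      have "solution_on A D f {t0..b+d} (\<lambda>t. if t \<le> b then y t else z t)"
        by (rule solution_join[OF y(1) z(2)]) (use z b d in auto)
      moreover have "min T (t0 + real (Suc (Suc n)) * d) \<le> b + d"
        using d(1) by (auto simp: b_def algebra_simps)
      ultimately have "solution_on A D f {t0..min T (t0 + real (Suc (Suc n)) * d)} (\<lambda>t. if t \<le> b then y t else z t)"
        by (elim solution_on_subset) auto
      then show ?case
        using y(2) b by (intro exI[of _ "\<lambda>t. if t \<le> b then y t else z t"]) auto
    qed
    obtain n where "T - t0 < real n * d" using reals_Archimedean3[OF d(1)] by blast
    then have "T \<le> t0 + real (Suc n) * d" using d(1) by (auto simp: algebra_simps)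
    then show ?thesis using step[of n] by (simp add: min_absorb1)
  qed
  then obtain Y where Y: "\<And>T. t0 \<le> T \<Longrightarrow> solution_on A D f {t0..T} (Y T) \<and> Y T t0 = x0" by metis
  \<comment> \<open>Diagonal gluing: by uniqueness \<open>Y T t\<close> is the same for all
    \<open>T \<ge> t\<close>.\<close>
  define x where "x t = Y t t" for t
  have xY: "x t = Y T t" if "t0 \<le> t" "t \<le> T" for t T
    unfolding x_def
    by (rule solution_unique[OF D f(2,3), of t0 t]) (use Y[of t] Y[of T] that t0 in \<open>auto intro: solution_on_subset\<close>)
  have "solution_on A D f {t0..} x"
    unfolding solution_on_def
  proof (intro ballI conjI)
    fix t assume t: "t \<in> {t0..}"
    have S: "solution_on A D f {t0..t+1} x"
      by (rule solution_on_cong[of D f _ "Y (t+1)"]) (use t Y[of "t+1"] xY in auto)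
    then show "x t \<in> D" using t by (auto simp: solution_on_def)
    \<comment> \<open>One extra unit of time ensures that \<open>t\<close> is not the right end
      point, so the velocity is that along the half-line.\<close>
    have "at t within {t0..} = at t within {t0..t+1}"
      by (rule at_within_nhd[of t "{..<t+1}"]) auto
    then show "has_velocity A {t0..} x t (f t (x t))"
      using S t has_velocity_filter[of "{t0..t+1}" x t] by (auto simp: solution_on_def)
  qed
  moreover have "x t0 = x0" using Y[of t0] by (simp add: x_def)
  moreover have "\<forall>t\<in>{t0..<T}. y t = x t" if "t0 < T" "solution_on A D f {t0..<T} y" "y t0 = x0" for T y
  proof
    fix t assume t: "t \<in> {t0..<T}"
    show "y t = x t"
      unfolding x_def
      by (rule solution_unique[OF D f(2,3), of t0 t]) (use Y[of t] that t t0 in \<open>auto intro: solution_on_subset\<close>)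
  qed
  ultimately show ?thesis by (rule that)
qed

end

section \<open>Second derivatives, Lipschitz maps and bilinear forms\<close>

lemma smooth_on_derivative:
  assumes "smooth_on S h"
  shows "smooth_on S (\<lambda>x. frechet_derivative h (at x) v)"
proof -
  have "Ck_on (Suc k) S h" for k using assms by (simp add: smooth_on_def del: Ck_on.simps)
  then show ?thesis using assms by (auto simp: smooth_on_def)
qed

lemma smooth_on_continuous: "smooth_on S h \<Longrightarrow> continuous_on S h"
  unfolding smooth_on_def by (metis Ck_on.simps(1))

text \<open>The mean value theorem is applied in direction \<open>v\<close> and then in direction
  \<open>w\<close>. The second difference on the left is unchanged when \<open>v\<close> and
  \<open>w\<close> are exchanged, which is the source of the symmetry of mixed derivatives.\<close>

lemma second_difference:
  fixes f :: "'a::real_normed_vector \<Rightarrow> real"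
  assumes f: "\<And>y. y \<in> S \<Longrightarrow> (f has_derivative f' y) (at y)"
    and f'': "\<And>y. y \<in> S \<Longrightarrow> ((\<lambda>y. f' y v) has_derivative f'' y) (at y)"
    and r: "0 < r" and S: "\<And>a b. 0 \<le> a \<Longrightarrow> a \<le> r \<Longrightarrow> 0 \<le> b \<Longrightarrow> b \<le> r \<Longrightarrow> x + a *\<^sub>R v + b *\<^sub>R w \<in> S"
  obtains a b where "0 \<le> a" "a \<le> r" "0 \<le> b" "b \<le> r"
    "f (x + r *\<^sub>R v + r *\<^sub>R w) - f (x + r *\<^sub>R v) - f (x + r *\<^sub>R w) + f x = r * r * f'' (x + a *\<^sub>R v + b *\<^sub>R w) w"
proof -
  define p where "p a = f (x + a *\<^sub>R v + r *\<^sub>R w) - f (x + a *\<^sub>R v + 0 *\<^sub>R w)" for a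
  have comp: "((\<lambda>a. f (x + a *\<^sub>R v + b *\<^sub>R w)) has_derivative (\<lambda>h. f' (x + a *\<^sub>R v + b *\<^sub>R w) (h *\<^sub>R v))) (at a within {0..r})"
    if "a \<in> {0..r}" "b \<in> {0..r}" for a b
    using that S by (intro has_derivative_compose[OF _ f]) (auto intro!: derivative_eq_intros)
  have lin: "linear (f' y)" if "y \<in> S" for y using f[OF that] has_derivative_linear by blast
  have lin'': "linear (f'' y)" if "y \<in> S" for y using f''[OF that] has_derivative_linear by blast
  have "\<exists>a\<in>{0<..<r}. p r - p 0 = (\<lambda>h. h * (f' (x + a *\<^sub>R v + r *\<^sub>R w) v - f' (x + a *\<^sub>R v + 0 *\<^sub>R w) v)) (r - 0)"
  proof (rule mvt_simple[OF r])
    fix a assume a: "0 \<le> a" "a \<le> r"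
    have "(p has_derivative (\<lambda>h. f' (x + a *\<^sub>R v + r *\<^sub>R w) (h *\<^sub>R v) - f' (x + a *\<^sub>R v + 0 *\<^sub>R w) (h *\<^sub>R v))) (at a within {0..r})"
      unfolding p_def using a r by (intro has_derivative_diff comp) auto
    then show "(p has_derivative (\<lambda>h. h * (f' (x + a *\<^sub>R v + r *\<^sub>R w) v - f' (x + a *\<^sub>R v + 0 *\<^sub>R w) v))) (at a within {0..r})"
      using a r S[of a r] S[of a 0] lin by (simp add: linear_cmul right_diff_distrib)
  qed
  then obtain a where a: "0 < a" "a < r"
    "p r - p 0 = r * (f' (x + a *\<^sub>R v + r *\<^sub>R w) v - f' (x + a *\<^sub>R v + 0 *\<^sub>R w) v)" by auto
  have "\<exists>b\<in>{0<..<r}. f' (x + a *\<^sub>R v + r *\<^sub>R w) v - f' (x + a *\<^sub>R v + 0 *\<^sub>R w) v = (\<lambda>h. h * f'' (x + a *\<^sub>R v + b *\<^sub>R w) w) (r - 0)"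
  proof (rule mvt_simple[OF r])
    fix b assume b: "0 \<le> b" "b \<le> r"
    have "((\<lambda>b. f' (x + a *\<^sub>R v + b *\<^sub>R w) v) has_derivative (\<lambda>h. f'' (x + a *\<^sub>R v + b *\<^sub>R w) (h *\<^sub>R w))) (at b within {0..r})"
      using a b S by (intro has_derivative_compose[OF _ f'']) (auto intro!: derivative_eq_intros)
    then show "((\<lambda>b. f' (x + a *\<^sub>R v + b *\<^sub>R w) v) has_derivative (\<lambda>h. h * f'' (x + a *\<^sub>R v + b *\<^sub>R w) w)) (at b within {0..r})"
      using a b S[of a b] lin'' by (simp add: linear_cmul)
  qed
  then obtain b where b: "0 < b" "b < r"
    "f' (x + a *\<^sub>R v + r *\<^sub>R w) v - f' (x + a *\<^sub>R v + 0 *\<^sub>R w) v = r * f'' (x + a *\<^sub>R v + b *\<^sub>R w) w" by auto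
  show ?thesis
    by (rule that[of a b]) (use a b in \<open>auto simp: p_def\<close>)
qed

text \<open>At suitable points close to \<open>x\<close> both mixed derivatives equal the same
  second difference divided by \<open>r * r\<close>. With \<open>e\<close> half of the supposed gap
  at \<open>x\<close>, continuity gives a contradiction.\<close>

lemma second_derivative_symmetric_real:
  fixes f :: "'a::real_normed_vector \<Rightarrow> real"
  assumes S: "open S" and x: "x \<in> S"
    and f: "\<And>y. y \<in> S \<Longrightarrow> (f has_derivative f' y) (at y)"
    and fv: "\<And>y. y \<in> S \<Longrightarrow> ((\<lambda>y. f' y v) has_derivative fv y) (at y)"
    and fw: "\<And>y. y \<in> S \<Longrightarrow> ((\<lambda>y. f' y w) has_derivative fw y) (at y)"
    and cont: "continuous_on S (\<lambda>y. fv y w)" "continuous_on S (\<lambda>y. fw y v)"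
  shows "fv x w = fw x v"
proof (rule ccontr)
  assume ne: "fv x w \<noteq> fw x v"
  define e where "e = \<bar>fv x w - fw x v\<bar> / 2"
  have e: "0 < e" using ne by (auto simp: e_def)
  have "\<forall>\<^sub>F y in at x. \<bar>fv y w - fv x w\<bar> < e" "\<forall>\<^sub>F y in at x. \<bar>fw y v - fw x v\<bar> < e" "\<forall>\<^sub>F y in at x. y \<in> S"
    using cont S x e by (auto simp: continuous_on_eq_continuous_at continuous_at dist_real_def[symmetric]
      intro: tendstoD eventually_at_in_open')
  then have "\<forall>\<^sub>F y in at x. \<bar>fv y w - fv x w\<bar> < e \<and> \<bar>fw y v - fw x v\<bar> < e \<and> y \<in> S"
    by eventually_elim auto
  then obtain d where d: "d > 0" "\<And>y. y \<noteq> x \<Longrightarrow> dist y x < d \<Longrightarrow> \<bar>fv y w - fv x w\<bar> < e \<and> \<bar>fw y v - fw x v\<bar> < e \<and> y \<in> S"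
    by (auto simp: eventually_at)
  have near: "\<bar>fv y w - fv x w\<bar> < e" "\<bar>fw y v - fw x v\<bar> < e" "y \<in> S" if "dist y x < d" for y
    using d(2)[of y] that x e by (cases "y = x"; auto)+
  \<comment> \<open>With \<open>r = d / (2 * c)\<close> the parallelogram spanned by
    \<open>r v\<close> and \<open>r w\<close> stays within \<open>d\<close> of \<open>x\<close>; the
    added 1 covers \<open>v = w = 0\<close>.\<close>
  define c where "c = norm v + norm w + 1"
  have c: "c > 0" unfolding c_def by (smt (verit) norm_ge_zero)
  define r where "r = d / (2 * c)"
  have r: "0 < r" "r * (norm v + norm w) < d"
  proof -
    show "0 < r" using d c by (simp add: r_def)
    have "r * (norm v + norm w) \<le> r * c" using \<open>0 < r\<close> by (intro mult_left_mono) (auto simp: c_def)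
    also have "\<dots> = d / 2" using c by (simp add: r_def)
    finally show "r * (norm v + norm w) < d" using d by simp
  qed
  have box: "dist (x + a *\<^sub>R v + b *\<^sub>R w) x < d" if "0 \<le> a" "a \<le> r" "0 \<le> b" "b \<le> r" for a b
  proof -
    have "dist (x + a *\<^sub>R v + b *\<^sub>R w) x \<le> a * norm v + b * norm w"
      using norm_triangle_ineq[of "a *\<^sub>R v" "b *\<^sub>R w"] that by (simp add: dist_norm add.assoc)
    also have "\<dots> \<le> r * norm v + r * norm w" using that by (intro add_mono mult_right_mono) auto
    finally show ?thesis using r by (simp add: distrib_left)
  qed
  obtain a b where ab: "0 \<le> a" "a \<le> r" "0 \<le> b" "b \<le> r"
    "f (x + r *\<^sub>R v + r *\<^sub>R w) - f (x + r *\<^sub>R v) - f (x + r *\<^sub>R w) + f x = r * r * fv (x + a *\<^sub>R v + b *\<^sub>R w) w"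
    by (rule second_difference[OF f fv r(1), where x = x and w = w]) (use near(3) box in auto)
  have box': "dist (x + a *\<^sub>R w + b *\<^sub>R v) x < d" if "0 \<le> a" "a \<le> r" "0 \<le> b" "b \<le> r" for a b
    using box[of b a] that by (simp add: ac_simps)
  obtain a' b' where ab': "0 \<le> a'" "a' \<le> r" "0 \<le> b'" "b' \<le> r"
    "f (x + r *\<^sub>R w + r *\<^sub>R v) - f (x + r *\<^sub>R w) - f (x + r *\<^sub>R v) + f x = r * r * fw (x + a' *\<^sub>R w + b' *\<^sub>R v) v"
    by (rule second_difference[OF f fw r(1), where x = x and w = v]) (use near(3) box' in auto)
  have "f (x + r *\<^sub>R w + r *\<^sub>R v) = f (x + r *\<^sub>R v + r *\<^sub>R w)" by (simp add: ac_simps)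
  then have "r * r * fv (x + a *\<^sub>R v + b *\<^sub>R w) w = r * r * fw (x + a' *\<^sub>R w + b' *\<^sub>R v) v"
    using ab(5) ab'(5) by linarith
  then have "fv (x + a *\<^sub>R v + b *\<^sub>R w) w = fw (x + a' *\<^sub>R w + b' *\<^sub>R v) v" using r by simp
  moreover have "\<bar>fv (x + a *\<^sub>R v + b *\<^sub>R w) w - fv x w\<bar> < e" by (rule near(1)[OF box[OF ab(1-4)]])
  moreover have "\<bar>fw (x + a' *\<^sub>R w + b' *\<^sub>R v) v - fw x v\<bar> < e" by (rule near(2)[OF box'[OF ab'(1-4)]])
  ultimately show False unfolding e_def by (simp add: abs_if field_simps split: if_splits)
qed

text \<open>Taken componentwise, because the mean value theorem with equality is a statement on real
  values.\<close>

lemma smooth_on_second_derivative_symmetric: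
  fixes h :: "'a::real_normed_vector \<Rightarrow> 'b::euclidean_space"
  assumes h: "smooth_on S h" and x: "x \<in> S"
  shows "frechet_derivative (\<lambda>y. frechet_derivative h (at y) v) (at x) w
    = frechet_derivative (\<lambda>y. frechet_derivative h (at y) w) (at x) v"
proof (rule euclidean_eqI)
  fix b :: 'b assume "b \<in> Basis"
  let ?D = "\<lambda>h y. frechet_derivative h (at y)"
  show "?D (\<lambda>y. ?D h y v) x w \<bullet> b = ?D (\<lambda>y. ?D h y w) x v \<bullet> b"
  proof (rule second_derivative_symmetric_real[where f = "\<lambda>y. h y \<bullet> b" and f' = "\<lambda>y k. ?D h y k \<bullet> b"
        and fv = "\<lambda>y k. ?D (\<lambda>y. ?D h y v) y k \<bullet> b" and fw = "\<lambda>y k. ?D (\<lambda>y. ?D h y w) y k \<bullet> b" and S = S])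
    show "open S" using h by (simp add: smooth_on_def)
    show "((\<lambda>y. h y \<bullet> b) has_derivative (\<lambda>k. ?D h y k \<bullet> b)) (at y)" if "y \<in> S" for y
      by (rule has_derivative_inner_left[OF smooth_on_frechet[OF h that]])
    show "((\<lambda>y. ?D h y v \<bullet> b) has_derivative (\<lambda>k. ?D (\<lambda>y. ?D h y v) y k \<bullet> b)) (at y)" if "y \<in> S" for y v
      by (rule has_derivative_inner_left[OF smooth_on_frechet[OF smooth_on_derivative[OF h] that]])
    then show "((\<lambda>y. ?D h y w \<bullet> b) has_derivative (\<lambda>k. ?D (\<lambda>y. ?D h y w) y k \<bullet> b)) (at y)" if "y \<in> S" for y
      using that by blast
    show "continuous_on S (\<lambda>y. ?D (\<lambda>y. ?D h y v) y w \<bullet> b)" "continuous_on S (\<lambda>y. ?D (\<lambda>y. ?D h y w) y v \<bullet> b)"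
      by (intro continuous_intros smooth_on_continuous[OF smooth_on_derivative[OF smooth_on_derivative[OF h]]])+
  qed (rule x)
qed

section \<open>Calculus of locally Lipschitz maps\<close>

text \<open>A property stable under algebraic operations and under solving linear systems. It
  suffices for the uniqueness of geodesics and avoids differentiating the Christoffel symbols, which
  are given by a definite description.\<close>

definition lip_at :: "('a::metric_space \<Rightarrow> 'b::metric_space) \<Rightarrow> 'a \<Rightarrow> bool" where
  "lip_at f z \<longleftrightarrow> (\<exists>r>0. \<exists>L. L-lipschitz_on (cball z r) f)"

lemma lip_at_const: "lip_at (\<lambda>x. c) z"
  unfolding lip_at_def by (intro exI[of _ 1] conjI exI[of _ 0] lipschitz_on_constant) auto

lemma lip_at_bounded_linear: "bounded_linear f \<Longrightarrow> lip_at f z"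
  unfolding lip_at_def by (metis bounded_linear.lipschitz_boundE zero_less_one)

lemma lip_at_add:
  fixes f g :: "'a::metric_space \<Rightarrow> 'b::real_normed_vector"
  assumes "lip_at f z" "lip_at g z"
  shows "lip_at (\<lambda>x. f x + g x) z"
proof -
  obtain r L s M where "r > 0" "s > 0" "L-lipschitz_on (cball z r) f" "M-lipschitz_on (cball z s) g"
    using assms by (auto simp: lip_at_def)
  then have "(L + M)-lipschitz_on (cball z (min r s)) (\<lambda>x. f x + g x)"
    by (intro lipschitz_on_add) (auto intro: lipschitz_on_subset)
  then show ?thesis using \<open>r > 0\<close> \<open>s > 0\<close> unfolding lip_at_def by (metis min_less_iff_conj)
qed

lemma lip_at_mult:
  fixes f g :: "'a::metric_space \<Rightarrow> real"
  assumes "lip_at f z" "lip_at g z"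
  shows "lip_at (\<lambda>x. f x * g x) z"
proof -
  obtain r L s M where rs: "r > 0" "s > 0" and f: "L-lipschitz_on (cball z r) f" and g: "M-lipschitz_on (cball z s) g"
    using assms by (auto simp: lip_at_def)
  define k where "k = min r s"
  have k: "k > 0" "k \<le> r" "k \<le> s" using rs by (auto simp: k_def)
  have LM: "0 \<le> L" "0 \<le> M" using f g by (auto simp: lipschitz_on_def)
  define a where "a = \<bar>f z\<bar> + L * k"
  define b where "b = \<bar>g z\<bar> + M * k"
  have fz: "\<bar>f x\<bar> \<le> a" "\<bar>g x\<bar> \<le> b" if "x \<in> cball z k" for x
  proof -
    have "\<bar>f x - f z\<bar> \<le> L * dist x z" "\<bar>g x - g z\<bar> \<le> M * dist x z"
      using lipschitz_onD[OF f, of x z] lipschitz_onD[OF g, of x z] that k by (auto simp: dist_real_def)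
    moreover have "L * dist x z \<le> L * k" "M * dist x z \<le> M * k"
      using that LM by (auto intro!: mult_left_mono simp: dist_commute)
    ultimately show "\<bar>f x\<bar> \<le> a" "\<bar>g x\<bar> \<le> b" unfolding a_def b_def by linarith+
  qed
  have "(a * M + b * L)-lipschitz_on (cball z k) (\<lambda>x. f x * g x)"
  proof (rule lipschitz_onI)
    fix x y assume xy: "x \<in> cball z k" "y \<in> cball z k"
    have "dist (f x * g x) (f y * g y) = \<bar>f x * (g x - g y) + g y * (f x - f y)\<bar>"
      by (simp add: dist_real_def algebra_simps)
    also have "\<dots> \<le> \<bar>f x\<bar> * \<bar>g x - g y\<bar> + \<bar>g y\<bar> * \<bar>f x - f y\<bar>"
      by (metis abs_mult abs_triangle_ineq)
    also have "\<dots> \<le> a * (M * dist x y) + b * (L * dist x y)"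
      using fz[OF xy(1)] fz[OF xy(2)] lipschitz_onD[OF f, of x y] lipschitz_onD[OF g, of x y] xy k
      by (intro add_mono mult_mono) (auto simp: dist_real_def)
    finally show "dist (f x * g x) (f y * g y) \<le> (a * M + b * L) * dist x y" by (simp add: algebra_simps)
  next
    show "0 \<le> a * M + b * L" using LM k by (auto simp: a_def b_def)
  qed
  then show ?thesis using k unfolding lip_at_def by blast
qed

lemma lip_at_sum:
  fixes f :: "'i \<Rightarrow> 'a::metric_space \<Rightarrow> 'b::real_normed_vector"
  shows "finite I \<Longrightarrow> (\<And>i. i \<in> I \<Longrightarrow> lip_at (f i) z) \<Longrightarrow> lip_at (\<lambda>x. \<Sum>i\<in>I. f i x) z"
  by (induction I rule: finite_induct) (auto intro: lip_at_add lip_at_const)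

lemma lip_at_fst: "lip_at f (fst z) \<Longrightarrow> lip_at (\<lambda>x. f (fst x)) z"
proof -
  assume "lip_at f (fst z)"
  then obtain r L where r: "r > 0" and f: "L-lipschitz_on (cball (fst z) r) f" by (auto simp: lip_at_def)
  have "L-lipschitz_on (cball z r) (\<lambda>x. f (fst x))"
  proof (rule lipschitz_onI)
    fix x y assume xy: "x \<in> cball z r" "y \<in> cball z r"
    have "dist (f (fst x)) (f (fst y)) \<le> L * dist (fst x) (fst y)"
      using xy dist_fst_le[of z x] dist_fst_le[of z y] by (intro lipschitz_onD[OF f]) auto
    also have "\<dots> \<le> L * dist x y"
      using f by (intro mult_left_mono dist_fst_le) (auto simp: lipschitz_on_def)
    finally show "dist (f (fst x)) (f (fst y)) \<le> L * dist x y" .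
  qed (use f in \<open>auto simp: lipschitz_on_def\<close>)
  then show ?thesis using r unfolding lip_at_def by blast
qed

lemma lip_at_common:
  fixes f :: "'i \<Rightarrow> 'a::metric_space \<Rightarrow> 'b::metric_space"
  assumes "finite I" "\<And>i. i \<in> I \<Longrightarrow> lip_at (f i) z"
  shows "\<exists>r L. 0 < r \<and> 0 \<le> L \<and> (\<forall>i\<in>I. L-lipschitz_on (cball z r) (f i))"
  using assms
proof (induction I rule: finite_induct)
    case empty
    show ?case by (intro exI[of _ 1]) auto
  next
    case (insert i I)
    then obtain r L where 1: "0 < r" "0 \<le> L" "\<forall>i\<in>I. L-lipschitz_on (cball z r) (f i)" by auto
    obtain s M where 2: "0 < s" "M-lipschitz_on (cball z s) (f i)" using insert.prems[of i] by (auto simp: lip_at_def)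
    have "\<forall>j\<in>insert i I. (max L M)-lipschitz_on (cball z (min r s)) (f j)"
      using 1 2 by (auto intro: lipschitz_on_mono[of M "cball z s"] lipschitz_on_mono[of L "cball z r"])
    then show ?case using 1 2 by (intro exI[of _ "min r s"] exI[of _ "max L M"]) auto
qed

lemma lip_at_uminus:
  fixes f :: "'a::metric_space \<Rightarrow> 'b::real_normed_vector"
  shows "lip_at f z \<Longrightarrow> lip_at (\<lambda>x. - f x) z"
  unfolding lip_at_def by (auto intro: lipschitz_on_minus)

lemma lip_at_Pair:
  assumes "lip_at f z" "lip_at g z"
  shows "lip_at (\<lambda>x. (f x, g x)) z"
proof -
  obtain r L s M where rs: "r > 0" "s > 0" "L-lipschitz_on (cball z r) f" "M-lipschitz_on (cball z s) g"
    using assms by (auto simp: lip_at_def)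
  then have "(sqrt (L\<^sup>2 + M\<^sup>2))-lipschitz_on (cball z (min r s)) (\<lambda>x. (f x, g x))"
    by (intro lipschitz_on_Pair) (auto intro: lipschitz_on_subset)
  then show ?thesis using rs unfolding lip_at_def by (metis min_less_iff_conj)
qed

lemma local_lipschitz_lip_at:
  assumes "\<And>z. z \<in> S \<Longrightarrow> lip_at h z"
  shows "local_lipschitz T S (\<lambda>t. h)"
proof (rule local_lipschitzI)
  fix t z assume "z \<in> S"
  from assms[OF this] obtain r L where r: "0 < r" "L-lipschitz_on (cball z r) h" by (auto simp: lip_at_def)
  then have "L-lipschitz_on (cball z r \<inter> S) h" by (elim lipschitz_on_subset) auto
  then show "\<exists>u>0. \<exists>L. \<forall>t\<in>cball t u \<inter> T. L-lipschitz_on (cball z u \<inter> S) h" using r(1) by blast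
qed

section \<open>Bilinear forms given by their coefficients\<close>

text \<open>Only the values of \<open>a\<close> on pairs of basis vectors enter, so that
  differentiability or Lipschitz bounds known for each coefficient separately pass to the form with
  moving arguments \<open>v\<close> and \<open>w\<close>.\<close>

definition bform :: "('e::euclidean_space \<Rightarrow> 'e \<Rightarrow> real) \<Rightarrow> 'e \<Rightarrow> 'e \<Rightarrow> real" where
  "bform a v w = (\<Sum>i\<in>Basis. \<Sum>j\<in>Basis. (v \<bullet> i) * (w \<bullet> j) * a i j)"

lemma bform_add_left: "bform a (v + v') w = bform a v w + bform a v' w"
  by (simp add: bform_def inner_add_left algebra_simps sum.distrib)

lemma bform_add_right: "bform a v (w + w') = bform a v w + bform a v w'"
  by (simp add: bform_def inner_add_left algebra_simps sum.distrib)

lemma bform_scale_left: "bform a (r *\<^sub>R v) w = r * bform a v w"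
  by (simp add: bform_def algebra_simps sum_distrib_left)

lemma bform_scale_right: "bform a v (r *\<^sub>R w) = r * bform a v w"
  by (simp add: bform_def algebra_simps sum_distrib_left)

lemma bform_minus_left: "bform a (- v) w = - bform a v w"
  using bform_scale_left[of a "-1" v w] by simp

lemma bform_diff_left: "bform a (v - v') w = bform a v w - bform a v' w"
  using bform_add_left[of a v "- v'" w] by (simp add: bform_minus_left)

lemma bform_minus_right: "bform a v (- w) = - bform a v w"
  using bform_scale_right[of a v "-1" w] by simp

lemma bform_diff: "bform (\<lambda>i j. a i j - b i j) v w = bform a v w - bform b v w"
  by (simp add: bform_def algebra_simps sum_subtractf)

lemma bform_expand_right: "bform a v w = (\<Sum>j\<in>Basis. (w \<bullet> j) * bform a v j)"
proof -
  have "linear (bform a v)" by (rule linearI) (simp_all add: bform_add_right bform_scale_right)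
  then have "bform a v (\<Sum>j\<in>Basis. (w \<bullet> j) *\<^sub>R j) = (\<Sum>j\<in>Basis. (w \<bullet> j) * bform a v j)"
    by (simp add: linear_sum linear_cmul)
  then show ?thesis by (simp add: euclidean_representation)
qed

lemma bform_unique:
  fixes B :: "'e::euclidean_space \<Rightarrow> 'e \<Rightarrow> real"
  assumes "\<And>w. linear (\<lambda>v. B v w)" "\<And>v. linear (B v)"
  shows "B v w = bform B v w"
proof -
  have "B v w = B (\<Sum>i\<in>Basis. (v \<bullet> i) *\<^sub>R i) w" by (simp add: euclidean_representation)
  also have "\<dots> = (\<Sum>i\<in>Basis. (v \<bullet> i) * B i w)"
    by (simp add: linear_sum[OF assms(1)] linear_cmul[OF assms(1)])
  also have "\<dots> = (\<Sum>i\<in>Basis. (v \<bullet> i) * B i (\<Sum>j\<in>Basis. (w \<bullet> j) *\<^sub>R j))" by (simp add: euclidean_representation)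
  also have "\<dots> = bform B v w"
    by (simp add: linear_sum[OF assms(2)] linear_cmul[OF assms(2)] bform_def sum_distrib_left mult.assoc)
  finally show ?thesis .
qed

lemma bform_bound:
  fixes v w :: "'e::euclidean_space"
  assumes "\<And>i j. i \<in> Basis \<Longrightarrow> j \<in> Basis \<Longrightarrow> \<bar>a i j\<bar> \<le> B"
  shows "\<bar>bform a v w\<bar> \<le> real DIM('e) * (real DIM('e) * B) * norm v * norm w"
proof -
  have "\<bar>bform a v w\<bar> \<le> (\<Sum>i\<in>Basis. \<Sum>j\<in>Basis. \<bar>(v \<bullet> i) * (w \<bullet> j) * a i j\<bar>)"
    unfolding bform_def by (intro order_trans[OF sum_abs] sum_mono sum_abs)
  also have "\<dots> \<le> (\<Sum>i\<in>(Basis::'e set). \<Sum>j\<in>(Basis::'e set). norm v * norm w * B)"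
    using assms unfolding abs_mult by (intro sum_mono mult_mono) (auto simp: Basis_le_norm)
  finally show ?thesis by (simp add: algebra_simps)
qed

lemma has_derivative_bform:
  fixes a :: "'p::real_normed_vector \<Rightarrow> 'e::euclidean_space \<Rightarrow> 'e \<Rightarrow> real"
  assumes a: "\<And>i j. i \<in> Basis \<Longrightarrow> j \<in> Basis \<Longrightarrow> ((\<lambda>s. a s i j) has_derivative (\<lambda>h. a' h i j)) (at t within I)"
    and v: "(v has_derivative v') (at t within I)" and w: "(w has_derivative w') (at t within I)"
  shows "((\<lambda>s. bform (a s) (v s) (w s)) has_derivative
    (\<lambda>h. bform (a' h) (v t) (w t) + bform (a t) (v' h) (w t) + bform (a t) (v t) (w' h))) (at t within I)"
  unfolding bform_def
  by (rule has_derivative_eq_rhs, (rule derivative_eq_intros a v w refl | assumption)+)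
    (simp add: fun_eq_iff sum.distrib[symmetric] algebra_simps)

text \<open>The constant is the minimum over the unit sphere, which is compact; homogeneity of
  degree 2 extends the bound to all vectors.\<close>

lemma bform_coercive:
  fixes a :: "'e::euclidean_space \<Rightarrow> 'e \<Rightarrow> real"
  assumes pos: "\<And>v. v \<noteq> 0 \<Longrightarrow> 0 < bform a v v"
  obtains l where "0 < l" "\<And>v. l * (norm v)\<^sup>2 \<le> bform a v v"
proof -
  have ne: "sphere (0::'e) 1 \<noteq> {}" by simp
  have "continuous_on (sphere 0 1) (\<lambda>v. bform a v v)"
    unfolding bform_def by (intro continuous_intros)
  from continuous_attains_inf[OF compact_sphere ne this]
  obtain v0 :: 'e where v0: "norm v0 = 1" "\<And>v. norm v = 1 \<Longrightarrow> bform a v0 v0 \<le> bform a v v" by auto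
  show ?thesis
  proof (rule that[of "bform a v0 v0"])
    show "0 < bform a v0 v0" using v0(1) by (intro pos) auto
    show "bform a v0 v0 * (norm v)\<^sup>2 \<le> bform a v v" for v
    proof (cases "v = 0")
      case True
      then show ?thesis by (simp add: bform_def)
    next
      case False
      have "bform a v0 v0 \<le> bform a (v /\<^sub>R norm v) (v /\<^sub>R norm v)" using False by (intro v0) simp
      also have "\<dots> = bform a v v / (norm v)\<^sup>2"
        by (simp add: bform_scale_left bform_scale_right power2_eq_square divide_simps)
      finally show ?thesis using False by (simp add: divide_simps)
    qed
  qed
qed

text \<open>Coercivity at \<open>q\<close> persists nearby with half the constant, and testing the
  equation for \<open>Z p - Z p'\<close> against this very vector bounds it. This replaces an
  explicit inverse matrix.\<close>

lemma lip_at_linear_solution: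
  fixes a :: "'p::metric_space \<Rightarrow> 'e::euclidean_space \<Rightarrow> 'e \<Rightarrow> real" and \<kappa> :: "'p \<Rightarrow> 'e \<Rightarrow> real"
  assumes a: "\<And>i j. i \<in> Basis \<Longrightarrow> j \<in> Basis \<Longrightarrow> lip_at (\<lambda>p. a p i j) q"
    and \<kappa>: "\<And>j. j \<in> Basis \<Longrightarrow> lip_at (\<lambda>p. \<kappa> p j) q"
    and pos: "\<And>v. v \<noteq> 0 \<Longrightarrow> 0 < bform (a q) v v"
    and r0: "0 < r0" and sol: "\<And>p j. p \<in> cball q r0 \<Longrightarrow> j \<in> Basis \<Longrightarrow> bform (a p) (Z p) j = \<kappa> p j"
  shows "lip_at Z q"
proof -
  let ?n = "real DIM('e)"
  obtain l where l: "0 < l" "\<And>v. l * (norm v)\<^sup>2 \<le> bform (a q) v v" using bform_coercive[OF pos] by blast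
  obtain r1 L1 where 1: "0 < r1" "0 \<le> L1" "\<And>ij. ij \<in> Basis \<times> Basis \<Longrightarrow> L1-lipschitz_on (cball q r1) (\<lambda>p. a p (fst ij) (snd ij))"
  proof -
    have "\<exists>r L. 0 < r \<and> 0 \<le> L \<and> (\<forall>ij\<in>Basis \<times> Basis. L-lipschitz_on (cball q r) (\<lambda>p. a p (fst ij) (snd ij)))"
      using a by (intro lip_at_common) auto
    then show ?thesis using that by blast
  qed
  obtain r2 L2 where 2: "0 < r2" "0 \<le> L2" "\<And>j. j \<in> Basis \<Longrightarrow> L2-lipschitz_on (cball q r2) (\<lambda>p. \<kappa> p j)"
    using lip_at_common[of Basis "\<lambda>j p. \<kappa> p j" q] \<kappa> finite_Basis by blast
  define M where "M = ?n * (?n * L1)"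
  have M0: "0 \<le> M" using 1 by (simp add: M_def)
  \<comment> \<open>Within \<open>l / (2 * (M + 1))\<close> the form changes by at most half of its
    coercivity constant \<open>l\<close>.\<close>
  define s where "s = min (min r0 (min r1 r2)) (l / (2 * (M + 1)))"
  have s: "0 < s" "s \<le> r0" "s \<le> r1" "s \<le> r2" "s \<le> l / (2 * (M + 1))"
  proof -
    have "0 < l / (2 * (M + 1))" using l M0 by simp
    then show "0 < s" "s \<le> r0" "s \<le> r1" "s \<le> r2" "s \<le> l / (2 * (M + 1))" using r0 1 2
      unfolding s_def by (auto simp only: min_less_iff_conj min.coboundedI1 min.coboundedI2 min.cobounded1 min.cobounded2)
  qed
  have Ms: "M * s \<le> l / 2"
  proof -
    have "M * s \<le> M * (l / (2 * (M + 1)))" using s M0 by (intro mult_left_mono) auto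
    also have "\<dots> \<le> l / 2" using M0 l by (simp add: divide_simps)
    finally show ?thesis .
  qed
  have diff: "\<bar>bform (a p) v w - bform (a p') v w\<bar> \<le> M * dist p p' * norm v * norm w"
    if "p \<in> cball q s" "p' \<in> cball q s" for p p' v w
  proof -
    have "\<bar>bform (\<lambda>i j. a p i j - a p' i j) v w\<bar> \<le> ?n * (?n * (L1 * dist p p')) * norm v * norm w"
    proof (rule bform_bound)
      fix i j :: 'e assume "i \<in> Basis" "j \<in> Basis"
      then show "\<bar>a p i j - a p' i j\<bar> \<le> L1 * dist p p'"
        using lipschitz_onD[OF 1(3)[of "(i, j)"], of p p'] that s by (simp add: dist_real_def)
    qed
    then show ?thesis by (simp add: bform_diff M_def mult_ac)
  qed
  have coer: "l / 2 * (norm v)\<^sup>2 \<le> bform (a p) v v" if p: "p \<in> cball q s" for p v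
  proof -
    have "bform (a q) v v - bform (a p) v v \<le> M * dist q p * norm v * norm v"
      using diff[of q p v v] p s by auto
    also have "\<dots> \<le> M * s * norm v * norm v"
      using p M0 by (intro mult_right_mono mult_left_mono) auto
    also have "\<dots> \<le> l / 2 * (norm v)\<^sup>2"
      using mult_right_mono[OF Ms, of "(norm v)\<^sup>2"] by (simp add: power2_eq_square)
    finally show ?thesis using l(2)[of v] by (simp add: field_simps)
  qed
  have rhs: "bform (a p) (Z p) w = (\<Sum>j\<in>Basis. (w \<bullet> j) * \<kappa> p j)" if "p \<in> cball q s" for p w
    unfolding bform_expand_right[of "a p" "Z p" w] using that s by (intro sum.cong refl) (simp add: sol)
  have cs: "(\<Sum>j\<in>Basis. (w \<bullet> j) * h j) \<le> ?n * c * norm w" if h: "\<And>j. j \<in> Basis \<Longrightarrow> \<bar>h j\<bar> \<le> c" for w :: 'e and h c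
  proof -
    have "(\<Sum>j\<in>Basis. (w \<bullet> j) * h j) \<le> (\<Sum>j\<in>(Basis::'e set). norm w * c)"
    proof (rule sum_mono)
      fix j :: 'e assume j: "j \<in> Basis"
      have "(w \<bullet> j) * h j \<le> \<bar>w \<bullet> j\<bar> * \<bar>h j\<bar>" by (metis abs_ge_self abs_mult)
      also have "\<dots> \<le> norm w * c" using j h[OF j] by (intro mult_mono) (auto simp: Basis_le_norm)
      finally show "(w \<bullet> j) * h j \<le> norm w * c" .
    qed
    then show ?thesis by (simp add: mult_ac)
  qed
  define K where "K = (\<Sum>j\<in>Basis. \<bar>\<kappa> q j\<bar>) + L2 * s"
  have K: "\<bar>\<kappa> p j\<bar> \<le> K" if "p \<in> cball q s" "j \<in> Basis" for p j
  proof -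
    have "\<bar>\<kappa> p j - \<kappa> q j\<bar> \<le> L2 * dist p q"
      using lipschitz_onD[OF 2(3)[OF that(2)], of p q] that s by (simp add: dist_real_def)
    moreover have "L2 * dist p q \<le> L2 * s" using that 2 by (intro mult_left_mono) (auto simp: dist_commute)
    moreover have "\<bar>\<kappa> q j\<bar> \<le> (\<Sum>j\<in>Basis. \<bar>\<kappa> q j\<bar>)" using that by (intro member_le_sum) auto
    ultimately show ?thesis unfolding K_def by linarith
  qed
  have cancel: "norm v \<le> 2 * c / l" if "l / 2 * (norm v)\<^sup>2 \<le> c * norm v" "0 \<le> c" for v :: 'e and c
  proof (cases "v = 0")
    case False
    then have "l / 2 * norm v \<le> c"
      using that(1) by (metis mult.assoc mult_le_cancel_right_pos power2_eq_square zero_less_norm_iff)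
    then show ?thesis using l by (simp add: field_simps)
  qed (use that l in auto)
  have K0: "0 \<le> K" unfolding K_def using 2 s by (simp add: sum_nonneg)
  define C where "C = 2 * (?n * K) / l"
  have C: "norm (Z p) \<le> C" if p: "p \<in> cball q s" for p
    unfolding C_def
  proof (rule cancel)
    show "l / 2 * (norm (Z p))\<^sup>2 \<le> ?n * K * norm (Z p)"
      using order_trans[OF coer[OF p, of "Z p"]] cs[of "\<kappa> p" K "Z p"] K[OF p] by (simp add: rhs[OF p])
  qed (use K0 in simp)
  have C0: "0 \<le> C" using K0 l by (simp add: C_def)
  have "(2 * (?n * L2 + M * C) / l)-lipschitz_on (cball q s) Z"
  proof (rule lipschitz_onI)
    fix p p' assume p: "p \<in> cball q s" "p' \<in> cball q s"
    let ?d = "Z p - Z p'"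
    have "norm ?d \<le> 2 * ((?n * L2 + M * C) * dist p p') / l"
    proof (rule cancel)
      \<comment> \<open>Exchanging \<open>a p\<close> for \<open>a p'\<close> at the vector
        \<open>Z p'\<close> separates the variation of the right-hand side from that of the
        coefficients.\<close>
      have "bform (a p) ?d ?d = (bform (a p) (Z p) ?d - bform (a p') (Z p') ?d) + (bform (a p') (Z p') ?d - bform (a p) (Z p') ?d)"
        by (simp add: bform_diff_left)
      also have "bform (a p) (Z p) ?d - bform (a p') (Z p') ?d = (\<Sum>j\<in>Basis. (?d \<bullet> j) * (\<kappa> p j - \<kappa> p' j))"
        by (simp add: rhs[OF p(1)] rhs[OF p(2)] sum_subtractf[symmetric] right_diff_distrib)
      also have "\<dots> \<le> ?n * (L2 * dist p p') * norm ?d"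
        using lipschitz_onD[OF 2(3), of _ p p'] p s by (intro cs) (simp add: dist_real_def)
      also have "bform (a p') (Z p') ?d - bform (a p) (Z p') ?d \<le> M * dist p p' * norm (Z p') * norm ?d"
        using diff[OF p, of "Z p'" ?d] by linarith
      also have "\<dots> \<le> M * dist p p' * C * norm ?d"
        using C[OF p(2)] M0 by (intro mult_right_mono mult_left_mono) auto
      finally have "bform (a p) ?d ?d \<le> (?n * L2 + M * C) * dist p p' * norm ?d" by (simp add: algebra_simps)
      then show "l / 2 * (norm ?d)\<^sup>2 \<le> (?n * L2 + M * C) * dist p p' * norm ?d"
        using coer[OF p(1), of ?d] by linarith
    qed (use 2 M0 C0 in simp)
    then show "dist (Z p) (Z p') \<le> 2 * (?n * L2 + M * C) / l * dist p p'"
      unfolding dist_norm[of "Z p"] by (simp add: algebra_simps)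
  qed (use 2 M0 C0 l in simp)
  then show ?thesis using s(1) unfolding lip_at_def by blast
qed

text \<open>Smoothness as defined gives continuity of each directional derivative; the finitely many
  along the basis bound the operator norm on a compact ball.\<close>

lemma smooth_on_lip_at:
  fixes h :: "'a::euclidean_space \<Rightarrow> 'b::real_normed_vector"
  assumes h: "smooth_on S h" and z: "z \<in> S"
  shows "lip_at h z"
proof -
  have "open S" using h by (simp add: smooth_on_def)
  then obtain r where r: "0 < r" "cball z r \<subseteq> S" using z open_contains_cball by blast
  let ?D = "\<lambda>x. frechet_derivative h (at x)"
  have "continuous_on (cball z r) (\<lambda>x. \<Sum>i\<in>Basis. norm (?D x i))"
    by (intro continuous_intros continuous_on_subset[OF smooth_on_continuous[OF smooth_on_derivative[OF h]] r(2)])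
  then have "bounded ((\<lambda>x. \<Sum>i\<in>Basis. norm (?D x i)) ` cball z r)"
    by (intro compact_imp_bounded compact_continuous_image) auto
  then obtain B where B: "\<And>x. x \<in> cball z r \<Longrightarrow> (\<Sum>i\<in>Basis. norm (?D x i)) \<le> B"
    unfolding bounded_iff by (metis abs_le_D1 imageI real_norm_def)
  have lin: "linear (?D x)" if "x \<in> cball z r" for x
    using smooth_on_frechet[OF h] r that has_derivative_linear by blast
  have on: "onorm (?D x) \<le> B" if x: "x \<in> cball z r" for x
  proof (rule onorm_le)
    fix v
    have "?D x v = (\<Sum>i\<in>Basis. (v \<bullet> i) *\<^sub>R ?D x i)"
      using arg_cong[OF euclidean_representation[of v], of "?D x"]
      by (simp add: linear_sum[OF lin[OF x]] linear_cmul[OF lin[OF x]])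
    then have "norm (?D x v) \<le> (\<Sum>i\<in>Basis. norm ((v \<bullet> i) *\<^sub>R ?D x i))"
      using norm_sum[of "\<lambda>i. (v \<bullet> i) *\<^sub>R ?D x i" Basis] by simp
    also have "\<dots> \<le> (\<Sum>i\<in>Basis. norm (?D x i) * norm v)"
      by (intro sum_mono) (auto simp: mult.commute[of _ "norm v"] Basis_le_norm intro!: mult_right_mono)
    also have "\<dots> \<le> B * norm v" using B[OF x] by (simp add: sum_distrib_right[symmetric] mult_right_mono)
    finally show "norm (?D x v) \<le> B * norm v" .
  qed
  have "B-lipschitz_on (cball z r) h"
  proof (rule lipschitz_onI)
    fix x y assume "x \<in> cball z r" "y \<in> cball z r"
    then show "dist (h x) (h y) \<le> B * dist x y"
      using differentiable_bound[of "cball z r" h ?D B y x] smooth_on_frechet[OF h] r on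
      by (simp add: dist_norm norm_minus_commute has_derivative_at_withinI subset_iff)
  next
    have "0 \<le> (\<Sum>i\<in>Basis. norm (?D z i))" by (simp add: sum_nonneg)
    also have "\<dots> \<le> B" using r by (intro B) auto
    finally show "0 \<le> B" .
  qed
  then show ?thesis using r unfolding lip_at_def by blast
qed

section \<open>Geodesics\<close>

locale riemannian = manifold A
  for A :: "('m::{t2_space,second_countable_topology}, 'e::euclidean_space) chart set" +
  fixes g :: "('m, 'e) metric"
  assumes metric: "riemannian_metric A g"
begin

section \<open>Tangent spaces and the metric in charts\<close>

text \<open>The cocycle rule, by which \<open>coord_vec\<close> satisfies the compatibility
  condition of tangent vectors.\<close>

lemma transition_compose:
  assumes "c \<in> A" "d \<in> A" "e \<in> A" and x: "x \<in> cdom c" "x \<in> cdom d" "x \<in> cdom e"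
  shows "frechet_derivative (cmap e \<circ> cinv c) (at (cmap c x)) v
    = frechet_derivative (cmap e \<circ> cinv d) (at (cmap d x)) (frechet_derivative (cmap d \<circ> cinv c) (at (cmap c x)) v)"
proof -
  let ?h = "cmap d \<circ> cinv c" and ?k = "cmap e \<circ> cinv d"
  have hx: "?h (cmap c x) = cmap d x" using assms by (simp add: cinv_cmap)
  have "((\<lambda>u. ?k (?h u)) has_derivative
      (\<lambda>v. frechet_derivative ?k (at (cmap d x)) (frechet_derivative ?h (at (cmap c x)) v))) (at (cmap c x))"
    by (rule has_derivative_compose[OF transition_has_derivative[OF assms(1,2) x(1,2)]])
      (simp only: hx transition_has_derivative[OF assms(2,3) x(2,3)])
  then have "((cmap e \<circ> cinv c) has_derivative
      (\<lambda>v. frechet_derivative ?k (at (cmap d x)) (frechet_derivative ?h (at (cmap c x)) v))) (at (cmap c x))"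
    by (rule has_derivative_transform_within_open[OF _ open_cmap_image[OF assms(1) open_cdom[OF assms(2)]]])
      (use assms in \<open>auto simp: cinv_cmap\<close>)
  from frechet_derivative_at[OF this] show ?thesis by metis
qed

lemma transition_self:
  assumes "c \<in> A" "x \<in> cdom c"
  shows "frechet_derivative (cmap c \<circ> cinv c) (at (cmap c x)) v = v"
proof -
  have "((cmap c \<circ> cinv c) has_derivative (\<lambda>v. v)) (at (cmap c x))"
    by (rule has_derivative_transform_within_open[OF has_derivative_ident open_cimage[OF assms(1)]])
      (use assms in \<open>auto simp: cinv_cmap\<close>)
  from frechet_derivative_at[OF this] show ?thesis by metis
qed

lemma coord_vec_self: "c \<in> A \<Longrightarrow> x \<in> cdom c \<Longrightarrow> coord_vec A c x v c = v"
  by (simp add: coord_vec_def transition_self)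

lemma coord_vec_tangent:
  assumes c: "c \<in> A" "x \<in> cdom c"
  shows "coord_vec A c x v \<in> tangent_space A x"
  unfolding tangent_space_def coord_vec_def mem_Collect_eq
proof (intro conjI ballI allI impI)
  fix a d assume ad: "a \<in> A" "d \<in> A" "x \<in> cdom a \<inter> cdom d"
  then have "x \<in> cdom a" "x \<in> cdom d" by auto
  then show "(if d \<in> A \<and> x \<in> cdom d then frechet_derivative (cmap d \<circ> cinv c) (at (cmap c x)) v else 0)
    = frechet_derivative (cmap d \<circ> cinv a) (at (cmap a x))
        (if a \<in> A \<and> x \<in> cdom a then frechet_derivative (cmap a \<circ> cinv c) (at (cmap c x)) v else 0)"
    using transition_compose[OF c(1) ad(1,2) c(2), of v] ad(1,2) by presburger
qed presburger

lemma tangent_coord: "X \<in> tangent_space A x \<Longrightarrow> c \<in> A \<Longrightarrow> x \<in> cdom c \<Longrightarrow> coord_vec A c x (X c) = X"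
proof (rule ext)
  fix d assume X: "X \<in> tangent_space A x" and c: "c \<in> A" "x \<in> cdom c"
  show "coord_vec A c x (X c) d = X d"
  proof (cases "d \<in> A \<and> x \<in> cdom d")
    case True
    then show ?thesis using tangent_transition[OF X c(1) _ c(2), of d] by (simp add: coord_vec_def)
  next
    case False
    moreover have "\<forall>c. c \<notin> A \<or> x \<notin> cdom c \<longrightarrow> X c = 0" using X unfolding tangent_space_def by blast
    ultimately have "X d = 0" by blast
    with False show ?thesis unfolding coord_vec_def by presburger
  qed
qed

lemma tangent_eqI:
  "X \<in> tangent_space A x \<Longrightarrow> Y \<in> tangent_space A x \<Longrightarrow> c \<in> A \<Longrightarrow> x \<in> cdom c \<Longrightarrow> X c = Y c \<Longrightarrow> X = Y"
  by (metis tangent_coord)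

lemma linear_transition:
  "c \<in> A \<Longrightarrow> d \<in> A \<Longrightarrow> x \<in> cdom c \<Longrightarrow> x \<in> cdom d \<Longrightarrow>
    linear (frechet_derivative (cmap d \<circ> cinv c) (at (cmap c x)))"
  using transition_has_derivative has_derivative_linear by blast

lemma coord_vec_comb:
  assumes "c \<in> A" "x \<in> cdom c"
  shows "coord_vec A c x (a *\<^sub>R v + b *\<^sub>R w) = (\<lambda>d. a *\<^sub>R coord_vec A c x v d + b *\<^sub>R coord_vec A c x w d)"
  using linear_transition[OF assms(1) _ assms(2)]
  by (auto simp: coord_vec_def fun_eq_iff linear_add linear_cmul)

lemma coord_vec_scale:
  assumes "c \<in> A" "x \<in> cdom c"
  shows "coord_vec A c x (a *\<^sub>R v) = (\<lambda>d. a *\<^sub>R coord_vec A c x v d)"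
  using coord_vec_comb[OF assms, of a v 0 v] by simp

lemma tangent_comb:
  assumes X: "X \<in> tangent_space A x" and Y: "Y \<in> tangent_space A x"
  shows "(\<lambda>c. a *\<^sub>R X c + b *\<^sub>R Y c) \<in> tangent_space A x"
proof -
  obtain c where c: "c \<in> A" "x \<in> cdom c" by (rule chart_at)
  have "(\<lambda>d. a *\<^sub>R X d + b *\<^sub>R Y d) = coord_vec A c x (a *\<^sub>R X c + b *\<^sub>R Y c)"
    using tangent_coord[OF X c] tangent_coord[OF Y c] by (simp add: coord_vec_comb[OF c])
  then show ?thesis using coord_vec_tangent[OF c] by simp
qed

lemma tangent_scale:
  "X \<in> tangent_space A x \<Longrightarrow> (\<lambda>c. a *\<^sub>R X c) \<in> tangent_space A x"
  using tangent_comb[of X x X a 0] by simp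

lemma g_props:
  assumes "X \<in> tangent_space A x" "Y \<in> tangent_space A x"
  shows g_sym: "g x X Y = g x Y X"
    and g_comb: "\<And>Z. Z \<in> tangent_space A x \<Longrightarrow> g x (\<lambda>c. a *\<^sub>R X c + b *\<^sub>R Y c) Z = a * g x X Z + b * g x Y Z"
    and g_pos: "X \<noteq> (\<lambda>c. 0) \<Longrightarrow> 0 < g x X X"
  using metric assms unfolding riemannian_metric_def by blast+

lemma g_comb_right:
  assumes "X \<in> tangent_space A x" "Y \<in> tangent_space A x" "Z \<in> tangent_space A x"
  shows "g x Z (\<lambda>c. a *\<^sub>R X c + b *\<^sub>R Y c) = a * g x Z X + b * g x Z Y"
  using g_comb[OF assms(1,2,3)] g_sym[OF assms(3) tangent_comb[OF assms(1,2)]] g_sym[OF assms(3,1)] g_sym[OF assms(3,2)]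
  by simp

text \<open>On the image of the chart this equals \<open>metric_in\<close>, while its bilinearity
  holds at every \<open>u\<close> by construction.\<close>

definition gm :: "('m, 'e) chart \<Rightarrow> 'e \<Rightarrow> 'e \<Rightarrow> 'e \<Rightarrow> real" where
  "gm c u = bform (metric_in A g c u)"

text \<open>In indices, \<open>h^k (d_k g_ij) v^i w^j\<close>: the metric is differentiated at
  \<open>u\<close> in direction \<open>h\<close>, with \<open>v\<close> and \<open>w\<close> held
  fixed.\<close>

definition dgm :: "('m, 'e) chart \<Rightarrow> 'e \<Rightarrow> 'e \<Rightarrow> 'e \<Rightarrow> 'e \<Rightarrow> real" where
  "dgm c u h = bform (\<lambda>i j. frechet_derivative (\<lambda>p. metric_in A g c p i j) (at u) h)"

lemma metric_in_gm:
  assumes c: "c \<in> A" and u: "u \<in> cmap c ` cdom c"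
  shows "metric_in A g c u v w = gm c u v w"
  unfolding gm_def
proof (rule bform_unique)
  have x: "cinv c u \<in> cdom c" by (rule cinv_in[OF c u])
  note T = coord_vec_tangent[OF c x]
  have l: "g (cinv c u) (coord_vec A c (cinv c u) (a *\<^sub>R v + b *\<^sub>R v')) (coord_vec A c (cinv c u) w)
      = a * g (cinv c u) (coord_vec A c (cinv c u) v) (coord_vec A c (cinv c u) w)
      + b * g (cinv c u) (coord_vec A c (cinv c u) v') (coord_vec A c (cinv c u) w)" for a v b v' w
    unfolding coord_vec_comb[OF c x] by (rule g_comb[OF T T T])
  have r: "g (cinv c u) (coord_vec A c (cinv c u) w) (coord_vec A c (cinv c u) (a *\<^sub>R v + b *\<^sub>R v'))
      = a * g (cinv c u) (coord_vec A c (cinv c u) w) (coord_vec A c (cinv c u) v)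
      + b * g (cinv c u) (coord_vec A c (cinv c u) w) (coord_vec A c (cinv c u) v')" for a v b v' w
    unfolding coord_vec_comb[OF c x] by (rule g_comb_right[OF T T T])
  show "linear (\<lambda>v. metric_in A g c u v w)" for w
  proof (rule linearI)
    show "metric_in A g c u (v + v') w = metric_in A g c u v w + metric_in A g c u v' w" for v v'
      using l[of 1 v 1 v' w] by (simp add: metric_in_def)
    show "metric_in A g c u (r *\<^sub>R v) w = r *\<^sub>R metric_in A g c u v w" for r v
      using l[of r v 0 v w] by (simp add: metric_in_def)
  qed
  show "linear (metric_in A g c u v)" for v
  proof (rule linearI)
    show "metric_in A g c u v (w + w') = metric_in A g c u v w + metric_in A g c u v w'" for w w'
      using r[of v 1 w 1 w'] by (simp add: metric_in_def)
    show "metric_in A g c u v (a *\<^sub>R w) = a *\<^sub>R metric_in A g c u v w" for a w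
      using r[of v a w 0 w] by (simp add: metric_in_def)
  qed
qed

lemma g_chart:
  assumes "X \<in> tangent_space A x" "Y \<in> tangent_space A x" and c: "c \<in> A" "x \<in> cdom c"
  shows "g x X Y = gm c (cmap c x) (X c) (Y c)"
proof -
  have "gm c (cmap c x) (X c) (Y c) = metric_in A g c (cmap c x) (X c) (Y c)"
    using c by (simp add: metric_in_gm)
  then show ?thesis
    using assms by (simp add: metric_in_def cinv_cmap tangent_coord)
qed

lemma gm_sym:
  assumes c: "c \<in> A" and u: "u \<in> cmap c ` cdom c"
  shows "gm c u v w = gm c u w v"
  using g_sym[OF coord_vec_tangent[OF c cinv_in[OF c u]] coord_vec_tangent[OF c cinv_in[OF c u]], of v w]
  by (simp add: metric_in_gm[OF assms, symmetric] metric_in_def)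

lemma gm_pos:
  assumes c: "c \<in> A" and u: "u \<in> cmap c ` cdom c" and v: "v \<noteq> 0"
  shows "0 < gm c u v v"
proof -
  note x = cinv_in[OF c u]
  have "coord_vec A c (cinv c u) v \<noteq> (\<lambda>c. 0)"
    using coord_vec_self[OF c x, of v] v by metis
  then show ?thesis
    using g_pos[OF coord_vec_tangent[OF c x] coord_vec_tangent[OF c x]]
    by (simp add: metric_in_gm[OF c u, symmetric] metric_in_def)
qed

lemma metric_in_smooth: "c \<in> A \<Longrightarrow> smooth_on (cmap c ` cdom c) (\<lambda>u. metric_in A g c u v w)"
  using metric unfolding riemannian_metric_def by blast

text \<open>The product rule with moving base point; conservation of speed, the energy variation and
  the Gauss lemma all rest on this formula.\<close>

lemma gm_curve_derivative:
  assumes c: "c \<in> A" and u: "u t \<in> cmap c ` cdom c"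
    and d: "(u has_derivative u') (at t within I)" "(v has_derivative v') (at t within I)" "(w has_derivative w') (at t within I)"
  shows "((\<lambda>s. gm c (u s) (v s) (w s)) has_derivative
    (\<lambda>h. dgm c (u t) (u' h) (v t) (w t) + gm c (u t) (v' h) (w t) + gm c (u t) (v t) (w' h))) (at t within I)"
  unfolding gm_def dgm_def
  by (rule has_derivative_bform[OF _ d(2,3)])
    (rule has_derivative_compose[OF d(1) smooth_on_frechet[OF metric_in_smooth[OF c] u]])

lemma frechet_metric_in:
  assumes c: "c \<in> A" and u: "u \<in> cmap c ` cdom c"
  shows "frechet_derivative (\<lambda>p. metric_in A g c p v w) (at u) h = dgm c u h v w"
proof -
  have "((\<lambda>p. gm c p v w) has_derivative (\<lambda>h. dgm c u h v w + gm c u 0 w + gm c u v 0)) (at u)"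
    by (rule gm_curve_derivative[OF c]) (auto intro: u)
  then have "((\<lambda>p. metric_in A g c p v w) has_derivative (\<lambda>h. dgm c u h v w + gm c u 0 w + gm c u v 0)) (at u)"
    by (rule has_derivative_transform_within_open[OF _ open_cimage[OF c] u]) (simp add: metric_in_gm[OF c])
  from frechet_derivative_at[OF this] have "frechet_derivative (\<lambda>p. metric_in A g c p v w) (at u) = (\<lambda>h. dgm c u h v w + gm c u 0 w + gm c u v 0)"
    by simp
  moreover have "gm c u 0 w = 0" "gm c u v 0 = 0" by (simp_all add: gm_def bform_def)
  ultimately show ?thesis by simp
qed

lemma dgm_linear:
  assumes c: "c \<in> A" and u: "u \<in> cmap c ` cdom c"
  shows "linear (\<lambda>h. dgm c u h v w)"
proof -
  have "(\<lambda>h. dgm c u h v w) = frechet_derivative (\<lambda>p. metric_in A g c p v w) (at u)"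
    using frechet_metric_in[OF assms] by auto
  then show ?thesis
    using has_derivative_linear[OF smooth_on_frechet[OF metric_in_smooth[OF c] u, of v w]] by simp
qed

lemma dgm_expand:
  assumes c: "c \<in> A" and u: "u \<in> cmap c ` cdom c"
  shows "dgm c u h v w = (\<Sum>k\<in>Basis. (h \<bullet> k) * dgm c u k v w)"
proof -
  have "dgm c u h v w = dgm c u (\<Sum>k\<in>Basis. (h \<bullet> k) *\<^sub>R k) v w" by (simp add: euclidean_representation)
  also have "\<dots> = (\<Sum>k\<in>Basis. (h \<bullet> k) * dgm c u k v w)"
    by (simp add: linear_sum[OF dgm_linear[OF assms]] linear_cmul[OF dgm_linear[OF assms]])
  finally show ?thesis .
qed

text \<open>The Koszul formula has exactly one solution: \<open>G\<close> represents the metric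
  through the Euclidean inner product, is injective by positive definiteness and hence surjective.
  This gives the definite description its meaning.\<close>

lemma christoffel:
  assumes c: "c \<in> A" and u: "u \<in> cmap c ` cdom c"
  shows "2 * gm c u (christoffel A g c u v w) y = dgm c u v w y + dgm c u w v y - dgm c u y v w"
proof -
  define k where "k y = dgm c u v w y + dgm c u w v y - dgm c u y v w" for y
  have dlin: "linear (\<lambda>h. dgm c u h v w)"
    by (rule dgm_linear[OF assms])
  have klin: "linear k"
    unfolding k_def by (rule linearI)
      (simp_all add: linear_add[OF dlin] linear_cmul[OF dlin] dgm_def[of c u v] dgm_def[of c u w] bform_add_right bform_scale_right algebra_simps)
  define G where "G z = (\<Sum>j\<in>Basis. gm c u z j *\<^sub>R j)" for z
  have G: "G z \<bullet> y = gm c u z y" for z y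
    unfolding G_def gm_def bform_expand_right[of _ z y] by (simp add: inner_sum_left inner_sum_right inner_commute[of _ y] mult.commute)
  have "linear G" unfolding G_def gm_def
    by (rule linearI) (simp_all add: bform_add_left bform_scale_left scaleR_add_left sum.distrib scaleR_sum_right)
  moreover have "inj G"
    using \<open>linear G\<close>
  proof (rule linear_injective_0[THEN iffD2, rule_format])
    fix z assume "G z = 0"
    then have "gm c u z z = 0" using G[of z z] by simp
    then show "z = 0" using gm_pos[OF assms, of z] by fastforce
  qed
  ultimately have "surj G" by (simp add: linear_injective_imp_surjective)
  then obtain z where z: "G z = (1/2) *\<^sub>R (\<Sum>j\<in>Basis. k j *\<^sub>R j)" by (metis surjD)
  have ky: "k y = (\<Sum>j\<in>Basis. (y \<bullet> j) * k j)" for y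
    using arg_cong[OF euclidean_representation[of y], of k] by (simp add: linear_sum[OF klin] linear_cmul[OF klin])
  then have zk: "2 * gm c u z y = k y" for y
  proof -
    have "2 * gm c u z y = 2 * (G z \<bullet> y)" by (simp only: G)
    also have "\<dots> = (\<Sum>j\<in>Basis. k j * (j \<bullet> y))" by (simp add: z inner_sum_left)
    also have "\<dots> = (\<Sum>j\<in>Basis. (y \<bullet> j) * k j)" by (intro sum.cong refl) (simp add: inner_commute)
    finally show ?thesis using ky[of y] by simp
  qed
  have chr: "christoffel A g c u v w = (THE z. \<forall>y. 2 * gm c u z y = k y)"
    unfolding christoffel_def k_def frechet_metric_in[OF assms] metric_in_gm[OF assms] ..
  have "christoffel A g c u v w = z"
    unfolding chr
  proof (rule the_equality)
    fix z' assume z': "\<forall>y. 2 * gm c u z' y = k y"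
    then have "G z' = G z" unfolding G_def using zk by (metis mult_cancel_left zero_neq_numeral)
    then show "z' = z" using \<open>inj G\<close> by (simp add: injD)
  qed (use zk in auto)
  then show ?thesis using zk by (simp add: k_def)
qed

text \<open>For equal arguments the Koszul formula is a linear system with the metric coefficients
  as matrix and a right-hand side quadratic in the velocity; all entries are locally
  Lipschitz.\<close>

lemma christoffel_lip_at:
  assumes c: "c \<in> A" and u: "fst q \<in> cmap c ` cdom c"
  shows "lip_at (\<lambda>p. christoffel A g c (fst p) (snd p) (snd p)) q"
proof -
  let ?U = "cmap c ` cdom c"
  let ?b = "\<lambda>u k i j. frechet_derivative (\<lambda>p. metric_in A g c p i j) (at u) k"
  obtain r where r: "0 < r" "cball (fst q) r \<subseteq> ?U"
    using open_cimage[OF c] u open_contains_cball by blast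
  have near: "fst p \<in> ?U" if "p \<in> cball q r" for p
    using that r dist_fst_le[of q p] by auto
  have lb: "lip_at (\<lambda>p. ?b (fst p) k i j) q" for k i j
    by (rule lip_at_fst[OF smooth_on_lip_at[OF smooth_on_derivative[OF metric_in_smooth[OF c]] u]])
  have ls: "lip_at (\<lambda>p. snd p \<bullet> i) q" for i :: 'e
    by (rule lip_at_bounded_linear) (intro bounded_linear_inner_left_comp bounded_linear_snd)
  note lc = lip_at_const[where z = q]
  \<comment> \<open>With \<open>v = w = snd p\<close> the first two Koszul terms coincide; after
    division by 2 the right-hand side is \<open>\<kappa>1 - \<kappa>2 / 2\<close>.\<close>
  define \<kappa>1 where "\<kappa>1 p y = (\<Sum>k\<in>Basis. (snd p \<bullet> k) * (\<Sum>i\<in>Basis. \<Sum>j\<in>Basis. (snd p \<bullet> i) * (y \<bullet> j) * ?b (fst p) k i j))" for p y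
  define \<kappa>2 where "\<kappa>2 p y = (\<Sum>i\<in>Basis. \<Sum>j\<in>Basis. (snd p \<bullet> i) * (snd p \<bullet> j) * ?b (fst p) y i j)" for p y
  show ?thesis
  proof (rule lip_at_linear_solution[where a = "\<lambda>p. metric_in A g c (fst p)" and \<kappa> = "\<lambda>p y. \<kappa>1 p y + (- 1/2) * \<kappa>2 p y", OF _ _ _ r(1)])
    show "lip_at (\<lambda>p. metric_in A g c (fst p) i j) q" for i j
      by (rule lip_at_fst[OF smooth_on_lip_at[OF metric_in_smooth[OF c] u]])
    show "lip_at (\<lambda>p. \<kappa>1 p j + (- 1/2) * \<kappa>2 p j) q" for j
      unfolding \<kappa>1_def \<kappa>2_def by (intro lip_at_add lip_at_mult lip_at_sum lc ls lb finite_Basis)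
    show "0 < bform (metric_in A g c (fst q)) v v" if "v \<noteq> 0" for v
      using gm_pos[OF c u that] by (simp add: gm_def)
    fix p :: "'e \<times> 'e" and y :: 'e assume p: "p \<in> cball q r"
    have 1: "dgm c (fst p) (snd p) (snd p) y = \<kappa>1 p y"
      unfolding \<kappa>1_def by (subst dgm_expand[OF c near[OF p]]) (simp add: dgm_def bform_def)
    have 2: "dgm c (fst p) y (snd p) (snd p) = \<kappa>2 p y"
      unfolding \<kappa>2_def by (simp add: dgm_def bform_def)
    show "bform (metric_in A g c (fst p)) (christoffel A g c (fst p) (snd p) (snd p)) y = \<kappa>1 p y + (- 1/2) * \<kappa>2 p y"
      using christoffel[OF c near[OF p], of "snd p" "snd p" y] by (simp add: 1 2 gm_def)
  qed
qed

section \<open>Geodesics as solutions of a first-order system\<close>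

text \<open>The conditions of \<open>geodesic\<close> with the velocity family named, so that
  position and velocity can be treated as a pair.\<close>

definition geodesic_vel :: "(real \<Rightarrow> 'm) \<Rightarrow> (real \<Rightarrow> ('m, 'e) tvec) \<Rightarrow> bool" where
  "geodesic_vel \<gamma> \<gamma>' \<longleftrightarrow> (\<forall>t. has_velocity A UNIV \<gamma> t (\<gamma>' t))
    \<and> (\<forall>t. \<forall>c\<in>A. \<gamma> t \<in> cdom c \<longrightarrow> ((\<lambda>s. \<gamma>' s c) has_vector_derivative
         - christoffel A g c (cmap c (\<gamma> t)) (\<gamma>' t c) (\<gamma>' t c)) (at t))"

lemma has_velocity_unique:
  assumes "has_velocity A I \<gamma> t X" "has_velocity A I \<gamma> t Y" "at t within I \<noteq> bot"
  shows "X = Y"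
proof -
  obtain c where c: "c \<in> A" "\<gamma> t \<in> cdom c" by (rule chart_at)
  have "X c = Y c"
    using vector_derivative_unique_within[OF assms(3) has_velocity_chart[OF assms(1) c] has_velocity_chart[OF assms(2) c]] .
  then show ?thesis using assms c by (auto simp: has_velocity_def intro: tangent_eqI[of X "\<gamma> t" Y c])
qed

lemma geodesic_from_vel:
  assumes "geodesic_from A g x X \<gamma>"
  obtains \<gamma>' where "geodesic_vel \<gamma> \<gamma>'" "\<gamma> 0 = x" "\<gamma>' 0 = X"
proof -
  obtain \<gamma>' where 1: "geodesic_vel \<gamma> \<gamma>'"
    using assms by (auto simp: geodesic_from_def geodesic_def geodesic_vel_def)
  then have "\<gamma>' 0 = X"
    using assms has_velocity_unique[of UNIV \<gamma> 0 "\<gamma>' 0" X] by (auto simp: geodesic_from_def geodesic_vel_def)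
  then show ?thesis using that 1 assms by (auto simp: geodesic_from_def)
qed

lemma geodesic_vel_from: "geodesic_vel \<gamma> \<gamma>' \<Longrightarrow> \<gamma> 0 = x \<Longrightarrow> \<gamma>' 0 = X \<Longrightarrow> geodesic_from A g x X \<gamma>"
  unfolding geodesic_from_def geodesic_def geodesic_vel_def by auto

lemma geodesic_vel_continuous:
  assumes "geodesic_vel \<gamma> \<gamma>'"
  shows "isCont \<gamma> t" and "\<gamma>' t \<in> tangent_space A (\<gamma> t)"
  using assms by (auto simp: geodesic_vel_def has_velocity_def)

lemma geodesic_vel_chart:
  assumes "geodesic_vel \<gamma> \<gamma>'" "c \<in> A" "\<gamma> t \<in> cdom c"
  shows "((\<lambda>s. cmap c (\<gamma> s)) has_vector_derivative \<gamma>' t c) (at t)"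
    and "((\<lambda>s. \<gamma>' s c) has_vector_derivative - christoffel A g c (cmap c (\<gamma> t)) (\<gamma>' t c) (\<gamma>' t c)) (at t)"
  using assms unfolding geodesic_vel_def by (blast intro: has_velocity_chart)+

text \<open>Serves the rescaling of geodesics and, with \<open>a = - 1\<close> and
  \<open>b = 1\<close>, the reversal of curves.\<close>

lemma has_velocity_affine:
  assumes "has_velocity A UNIV \<gamma> (a * t + b) X"
  shows "has_velocity A UNIV (\<lambda>s. \<gamma> (a * s + b)) t (\<lambda>c. a *\<^sub>R X c)"
proof -
  have cont: "continuous (at t) (\<lambda>s. \<gamma> (a * s + b))"
    using assms by (intro continuous_at_compose[of t "\<lambda>s. a * s + b" \<gamma>, unfolded comp_def])
      (auto simp: has_velocity_def intro!: continuous_intros)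
  have "((cmap c \<circ> (\<lambda>s. \<gamma> (a * s + b))) has_vector_derivative a *\<^sub>R X c) (at t)"
    if "((cmap c \<circ> \<gamma>) has_vector_derivative X c) (at (a * t + b))" for c
  proof -
    have "((\<lambda>s. a * s + b) has_vector_derivative a) (at t)"
      by (auto intro!: derivative_eq_intros)
    from vector_diff_chain_at[OF this that] show ?thesis by (simp add: comp_def)
  qed
  then show ?thesis using assms cont by (auto simp: has_velocity_def tangent_scale)
qed

text \<open>The Christoffel term is quadratic in the velocity, so both sides of the geodesic
  equation acquire the factor \<open>a^2\<close>.\<close>

lemma geodesic_vel_scale:
  assumes \<gamma>: "geodesic_vel \<gamma> \<gamma>'"
  shows "geodesic_vel (\<lambda>s. \<gamma> (a * s)) (\<lambda>s c. a *\<^sub>R \<gamma>' (a * s) c)"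
  unfolding geodesic_vel_def
proof (intro conjI allI ballI impI)
  show "has_velocity A UNIV (\<lambda>s. \<gamma> (a * s)) t (\<lambda>c. a *\<^sub>R \<gamma>' (a * t) c)" for t
    using has_velocity_affine[of \<gamma> a t 0 "\<gamma>' (a * t)"] \<gamma> by (simp add: geodesic_vel_def)
  fix t c assume c: "c \<in> A" "\<gamma> (a * t) \<in> cdom c"
  let ?u = "cmap c (\<gamma> (a * t))" and ?w = "\<gamma>' (a * t) c"
  have "((\<lambda>s. \<gamma>' s c) has_vector_derivative - christoffel A g c ?u ?w ?w) (at (a * t))"
    using \<gamma> c by (auto simp: geodesic_vel_def)
  moreover have "((\<lambda>s. a * s) has_vector_derivative a) (at t)"
    by (auto intro!: derivative_eq_intros simp: has_vector_derivative_def)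
  ultimately have "((\<lambda>s. \<gamma>' (a * s) c) has_vector_derivative a *\<^sub>R - christoffel A g c ?u ?w ?w) (at t)"
    using vector_diff_chain_at[of "\<lambda>s. a * s" a t "\<lambda>s. \<gamma>' s c" "- christoffel A g c ?u ?w ?w"] by (simp add: comp_def)
  then have "((\<lambda>s. a *\<^sub>R \<gamma>' (a * s) c) has_vector_derivative a *\<^sub>R (a *\<^sub>R - christoffel A g c ?u ?w ?w)) (at t)"
    using bounded_linear.has_vector_derivative[OF bounded_linear_scaleR_right] by blast
  moreover have u: "?u \<in> cmap c ` cdom c" using c by auto
  \<comment> \<open>A definite description does not exhibit its homogeneity; it follows by comparing
    the Koszul formulas for all \<open>y\<close>, as the metric is nondegenerate.\<close>
  have "christoffel A g c ?u (a *\<^sub>R ?w) (a *\<^sub>R ?w) = a *\<^sub>R (a *\<^sub>R christoffel A g c ?u ?w ?w)"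
  proof -
    have "2 * gm c ?u (christoffel A g c ?u (a *\<^sub>R ?w) (a *\<^sub>R ?w)) y = 2 * gm c ?u (a *\<^sub>R (a *\<^sub>R christoffel A g c ?u ?w ?w)) y" for y
    proof -
      have l: "dgm c ?u (a *\<^sub>R v) w z = a * dgm c ?u v w z" for v w z
        by (simp add: dgm_expand[OF c(1) u, of "a *\<^sub>R v"] dgm_expand[OF c(1) u, of v] sum_distrib_left mult.assoc)
      have "2 * gm c ?u (a *\<^sub>R (a *\<^sub>R christoffel A g c ?u ?w ?w)) y = a * (a * (2 * gm c ?u (christoffel A g c ?u ?w ?w) y))"
        by (simp add: gm_def bform_scale_left)
      then show ?thesis
        unfolding christoffel[OF c(1) u] l by (simp add: dgm_def bform_scale_left bform_scale_right algebra_simps)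
    qed
    then have "gm c ?u (christoffel A g c ?u (a *\<^sub>R ?w) (a *\<^sub>R ?w) - a *\<^sub>R (a *\<^sub>R christoffel A g c ?u ?w ?w)) y = 0" for y
      by (simp add: gm_def bform_diff_left)
    then show ?thesis using gm_pos[OF c(1) u] by (metis eq_iff_diff_eq_0 less_irrefl)
  qed
  ultimately show "((\<lambda>s. a *\<^sub>R \<gamma>' (a * s) c) has_vector_derivative
      - christoffel A g c ?u (a *\<^sub>R ?w) (a *\<^sub>R ?w)) (at t)"
    by simp
qed

text \<open>The derivative of the squared speed is the derivative of the metric along the curve
  minus twice the product of the Christoffel term with the velocity. The Koszul formula with all
  arguments equal to the velocity says that the two cancel.\<close>

lemma geodesic_speed:
  assumes \<gamma>: "geodesic_vel \<gamma> \<gamma>'"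
  shows "g (\<gamma> t) (\<gamma>' t) (\<gamma>' t) = g (\<gamma> 0) (\<gamma>' 0) (\<gamma>' 0)"
proof -
  have "((\<lambda>s. g (\<gamma> s) (\<gamma>' s) (\<gamma>' s)) has_real_derivative 0) (at t)" for t
  proof -
    obtain c where c: "c \<in> A" "\<gamma> t \<in> cdom c" by (rule chart_at)
    let ?u = "\<lambda>s. cmap c (\<gamma> s)" and ?w = "\<lambda>s. \<gamma>' s c"
    let ?\<Gamma> = "christoffel A g c (?u t) (?w t) (?w t)"
    have u: "?u t \<in> cmap c ` cdom c" using c by auto
    have d: "(?u has_derivative (\<lambda>h. h *\<^sub>R ?w t)) (at t)" "(?w has_derivative (\<lambda>h. h *\<^sub>R - ?\<Gamma>)) (at t)"
      using geodesic_vel_chart[OF \<gamma> c] by (simp_all only: has_vector_derivative_def)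
    have l: "dgm c (?u t) (h *\<^sub>R v) w z = h * dgm c (?u t) v w z" for h v w z
      by (simp add: dgm_expand[OF c(1) u, of "h *\<^sub>R v"] dgm_expand[OF c(1) u, of v] sum_distrib_left mult.assoc)
    have "((\<lambda>s. gm c (?u s) (?w s) (?w s)) has_derivative (\<lambda>h. h * 0)) (at t)"
    proof (rule has_derivative_eq_rhs[OF gm_curve_derivative[OF c(1) u d(1) d(2) d(2)]], rule ext)
      fix h
      have "gm c (?u t) (?w t) ?\<Gamma> = gm c (?u t) ?\<Gamma> (?w t)" by (rule gm_sym[OF c(1) u])
      then show "dgm c (?u t) (h *\<^sub>R ?w t) (?w t) (?w t) + gm c (?u t) (h *\<^sub>R - ?\<Gamma>) (?w t) + gm c (?u t) (?w t) (h *\<^sub>R - ?\<Gamma>) = h * 0"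
        using christoffel[OF c(1) u, of "?w t" "?w t" "?w t"]
        by (simp add: l gm_def bform_minus_left bform_minus_right bform_scale_left bform_scale_right algebra_simps)
    qed
    moreover have "open (\<gamma> -` cdom c)"
      using geodesic_vel_continuous(1)[OF \<gamma>] open_cdom[OF c(1)]
      by (intro open_vimage) (auto simp: continuous_on_eq_continuous_at)
    ultimately have "((\<lambda>s. g (\<gamma> s) (\<gamma>' s) (\<gamma>' s)) has_derivative (\<lambda>h. h * 0)) (at t)"
      by (rule has_derivative_transform_within_open)
        (use c geodesic_vel_continuous(2)[OF \<gamma>] in \<open>auto simp: g_chart\<close>)
    then show ?thesis
      by (rule has_derivative_imp_has_field_derivative) simp
  qed
  then show ?thesis using DERIV_isconst_all[of "\<lambda>s. g (\<gamma> s) (\<gamma>' s) (\<gamma>' s)" t 0] by blast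
qed

text \<open>Agreement is continued past the first time at which position or velocity differ: in a
  chart the pair solves an autonomous first-order system with locally Lipschitz right-hand side.
  Forward time suffices, since \<open>rexp\<close> evaluates geodesics at time 1.\<close>

lemma geodesic_unique:
  assumes \<gamma>: "geodesic_vel \<gamma> \<gamma>'" and \<eta>: "geodesic_vel \<eta> \<eta>'"
    and init: "\<gamma> 0 = \<eta> 0" "\<gamma>' 0 = \<eta>' 0" and t: "0 \<le> t"
  shows "\<gamma> t = \<eta> t"
proof (rule ccontr)
  assume "\<gamma> t \<noteq> \<eta> t"
  define N where "N = {s. 0 \<le> s \<and> \<not> (\<gamma> s = \<eta> s \<and> \<gamma>' s = \<eta>' s)}"
  define s where "s = Inf N"
  have N: "t \<in> N" "bdd_below N" using t \<open>\<gamma> t \<noteq> \<eta> t\<close> by (auto simp: N_def intro: bdd_belowI[of _ 0])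
  have s: "0 \<le> s" unfolding s_def by (rule cInf_greatest) (use N in \<open>auto simp: N_def\<close>)
  have below: "\<gamma> r = \<eta> r \<and> \<gamma>' r = \<eta>' r" if "0 \<le> r" "r < s" for r
    using cInf_lower[OF _ N(2), of r] that by (fastforce simp: N_def s_def)
  note cont = geodesic_vel_continuous(1)[OF \<gamma>] geodesic_vel_continuous(1)[OF \<eta>]
  have ev: "\<forall>\<^sub>F r in at_left s. \<gamma> r = \<eta> r \<and> \<gamma>' r = \<eta>' r" if "s \<noteq> 0"
  proof -
    have "\<forall>\<^sub>F r in at_left s. r \<in> {0<..<s}" using that s by (intro eventually_at_left_real) auto
    then show ?thesis by eventually_elim (use below in \<open>simp add: less_imp_le\<close>)
  qed
  have eq: "\<gamma> s = \<eta> s"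
  proof (cases "s = 0")
    case False
    have "(\<gamma> \<longlongrightarrow> \<gamma> s) (at_left s)" "(\<eta> \<longlongrightarrow> \<eta> s) (at_left s)"
      using cont[of s] unfolding continuous_at by (blast intro: tendsto_within_subset[OF _ subset_UNIV])+
    moreover have "\<forall>\<^sub>F r in at_left s. \<gamma> r = \<eta> r" using ev[OF False] by eventually_elim auto
    ultimately show ?thesis using tendsto_cong[of \<gamma> \<eta>] tendsto_unique[OF trivial_limit_at_left_real] by blast
  qed (simp add: init)
  obtain c where c: "c \<in> A" "\<gamma> s \<in> cdom c" by (rule chart_at)
  have c': "\<eta> s \<in> cdom c" using c eq by simp
  have eqc: "\<gamma>' s c = \<eta>' s c"
  proof (cases "s = 0")
    case False
    have "((\<lambda>r. \<gamma>' r c) \<longlongrightarrow> \<gamma>' s c) (at_left s)" "((\<lambda>r. \<eta>' r c) \<longlongrightarrow> \<eta>' s c) (at_left s)"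
      using has_vector_derivative_continuous[OF geodesic_vel_chart(2)[OF \<gamma> c]]
        has_vector_derivative_continuous[OF geodesic_vel_chart(2)[OF \<eta> c(1) c']]
      unfolding continuous_at by (blast intro: tendsto_within_subset[OF _ subset_UNIV])+
    moreover have "\<forall>\<^sub>F r in at_left s. \<gamma>' r c = \<eta>' r c" using ev[OF False] by eventually_elim auto
    ultimately show ?thesis
      using tendsto_cong[of "\<lambda>r. \<gamma>' r c" "\<lambda>r. \<eta>' r c"] tendsto_unique[OF trivial_limit_at_left_real] by blast
  qed (simp add: init)
  have "\<forall>\<^sub>F r in at s. \<gamma> r \<in> cdom c" "\<forall>\<^sub>F r in at s. \<eta> r \<in> cdom c"
    using cont[of s] c c' open_cdom[OF c(1)] by (simp_all add: continuous_at topological_tendstoD)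
  then have "\<forall>\<^sub>F r in nhds s. \<gamma> r \<in> cdom c \<and> \<eta> r \<in> cdom c"
    unfolding eventually_at_filter by eventually_elim (use c c' in blast)
  then obtain d where d: "d > 0" "\<And>r. dist r s < d \<Longrightarrow> \<gamma> r \<in> cdom c \<and> \<eta> r \<in> cdom c"
    by (auto simp: eventually_nhds_metric)
  let ?I = "{s..s + d / 2}" and ?U = "cmap c ` cdom c"
  let ?\<phi> = "\<lambda>p. (snd p, - christoffel A g c (fst p) (snd p) (snd p))"
  have dom: "\<gamma> r \<in> cdom c" "\<eta> r \<in> cdom c" if "r \<in> ?I" for r
    using d that by (auto simp: dist_real_def)
  have agree: "(cmap c (\<gamma> r), \<gamma>' r c) = (cmap c (\<eta> r), \<eta>' r c)" if r: "r \<in> ?I" for r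
  proof (rule ode_unique[of UNIV "?U \<times> UNIV" "\<lambda>t. ?\<phi>" s "s + d / 2"
        "\<lambda>r. (cmap c (\<gamma> r), \<gamma>' r c)" "\<lambda>r. (cmap c (\<eta> r), \<eta>' r c)"])
    show "local_lipschitz UNIV (?U \<times> UNIV) (\<lambda>t. ?\<phi>)"
    proof (rule local_lipschitz_lip_at)
      fix z :: "'e \<times> 'e" assume "z \<in> ?U \<times> UNIV"
      then have "fst z \<in> ?U" by auto
      then show "lip_at ?\<phi> z"
        using c(1) by (intro lip_at_Pair lip_at_bounded_linear bounded_linear_snd lip_at_uminus christoffel_lip_at)
    qed
    show "((\<lambda>r. (cmap c (\<gamma> r), \<gamma>' r c)) has_vector_derivative ?\<phi> (cmap c (\<gamma> r), \<gamma>' r c)) (at r within ?I)"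
      "((\<lambda>r. (cmap c (\<eta> r), \<eta>' r c)) has_vector_derivative ?\<phi> (cmap c (\<eta> r), \<eta>' r c)) (at r within ?I)"
      if "r \<in> ?I" for r
      using geodesic_vel_chart[OF \<gamma> c(1) dom(1)[OF that]] geodesic_vel_chart[OF \<eta> c(1) dom(2)[OF that]]
      by (simp_all add: has_vector_derivative_Pair has_vector_derivative_at_within)
  qed (use dom eq eqc r in auto)
  have "s + d / 2 \<le> s"
    unfolding s_def
  proof (rule cInf_greatest)
    fix r assume r: "r \<in> N"
    then have "s \<le> r" using cInf_lower[OF r N(2)] by (simp add: s_def)
    show "Inf N + d / 2 \<le> r"
    proof (rule ccontr)
      assume "\<not> Inf N + d / 2 \<le> r"
      then have rI: "r \<in> ?I" using \<open>s \<le> r\<close> by (simp add: s_def)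
      have "\<gamma> r = \<eta> r" using agree[OF rI] dom[OF rI] cinv_cmap[OF c(1)] by (metis Pair_inject)
      moreover have "\<gamma>' r = \<eta>' r"
        using agree[OF rI] dom[OF rI] calculation geodesic_vel_continuous(2)[OF \<gamma>, of r] geodesic_vel_continuous(2)[OF \<eta>, of r]
        by (intro tangent_eqI[of "\<gamma>' r" "\<gamma> r" _ c] c(1)) auto
      ultimately show False using r by (simp add: N_def)
    qed
  qed (use N in auto)
  with d show False by simp
qed

text \<open>Uniqueness of geodesics is what makes the definite description in \<^const>\<open>rexp\<close> meaningful.\<close>

lemma rexp_geodesic:
  assumes \<gamma>: "geodesic_vel \<gamma> \<gamma>'"
  shows "rexp A g (\<gamma> 0) (\<lambda>c. t *\<^sub>R \<gamma>' 0 c) = \<gamma> t"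
proof -
  have sc: "geodesic_vel (\<lambda>s. \<gamma> (t * s)) (\<lambda>s c. t *\<^sub>R \<gamma>' (t * s) c)" by (rule geodesic_vel_scale[OF \<gamma>])
  have "geodesic_from A g (\<gamma> 0) (\<lambda>c. t *\<^sub>R \<gamma>' 0 c) (\<lambda>s. \<gamma> (t * s))"
    by (rule geodesic_vel_from[OF sc]) auto
  moreover have "\<eta> 1 = \<gamma> t" if \<eta>: "geodesic_from A g (\<gamma> 0) (\<lambda>c. t *\<^sub>R \<gamma>' 0 c) \<eta>" for \<eta>
  proof -
    obtain \<eta>' where "geodesic_vel \<eta> \<eta>'" "\<eta> 0 = \<gamma> 0" "\<eta>' 0 = (\<lambda>c. t *\<^sub>R \<gamma>' 0 c)"
      by (rule geodesic_from_vel[OF \<eta>])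
    then show ?thesis using geodesic_unique[OF _ sc, of \<eta> \<eta>' 1] by simp
  qed
  ultimately show ?thesis
    unfolding rexp_def
  proof (intro the_equality)
    assume "geodesic_from A g (\<gamma> 0) (\<lambda>c. t *\<^sub>R \<gamma>' 0 c) (\<lambda>s. \<gamma> (t * s))"
    then show "\<exists>\<gamma>''. geodesic_from A g (\<gamma> 0) (\<lambda>c. t *\<^sub>R \<gamma>' 0 c) \<gamma>'' \<and> \<gamma> t = \<gamma>'' 1"
      by (intro exI[of _ "\<lambda>s. \<gamma> (t * s)"] conjI) simp_all
  qed blast
qed

end

section \<open>The Gauss lemma\<close>

lemma (in riemannian) g_zero_right: "X \<in> tangent_space A x \<Longrightarrow> g x X (\<lambda>c. 0) = 0"
  using g_comb_right[of X x X X 0 0] by simp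

section \<open>The exponential map in normal coordinates\<close>

locale exp_map = riemannian A g
  for A :: "('m::{t2_space,second_countable_topology}, 'e::euclidean_space) chart set"
    and g :: "('m, 'e) metric" +
  fixes xs :: 'm and c0 :: "('m, 'e) chart"
  assumes complete: "\<And>X. X \<in> tangent_space A xs \<Longrightarrow> \<exists>\<gamma>. geodesic_from A g xs X \<gamma>"
    and c0: "c0 \<in> A" "xs \<in> cdom c0"
begin

text \<open>The chart \<open>c0\<close> identifies the tangent space at \<open>xs\<close> with the
  model space; \<open>q\<close>, \<open>nrm\<close> and \<open>F\<close> are metric, norm and
  exponential map under this identification. \<open>D d\<close> and \<open>D2 d\<close> are
  derivatives of \<open>F\<close> read in a chart \<open>d\<close>, and \<open>dF\<close> is the
  same differential as a tangent vector.\<close>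

definition q :: "'e \<Rightarrow> 'e \<Rightarrow> real" where "q = gm c0 (cmap c0 xs)"
definition nrm :: "'e \<Rightarrow> real" where "nrm v = sqrt (q v v)"
definition F :: "'e \<Rightarrow> 'm" where "F v = rexp A g xs (coord_vec A c0 xs v)"
definition D :: "('m, 'e) chart \<Rightarrow> 'e \<Rightarrow> 'e \<Rightarrow> 'e" where
  "D d x = frechet_derivative (cmap d \<circ> F) (at x)"
definition D2 :: "('m, 'e) chart \<Rightarrow> 'e \<Rightarrow> 'e \<Rightarrow> 'e \<Rightarrow> 'e" where
  "D2 d x a = frechet_derivative (\<lambda>y. D d y a) (at x)"
definition dF :: "'e \<Rightarrow> 'e \<Rightarrow> ('m, 'e) tvec" where
  "dF x a = (\<lambda>d. if d \<in> A \<and> F x \<in> cdom d then D d x a else 0)"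

abbreviation V0 :: "'e \<Rightarrow> ('m, 'e) tvec" where "V0 v \<equiv> coord_vec A c0 xs v"

lemma q_g: "q v w = g xs (V0 v) (V0 w)"
  using g_chart[OF coord_vec_tangent[OF c0, of v] coord_vec_tangent[OF c0, of w] c0]
  by (simp add: q_def coord_vec_self[OF c0])

lemma nrm_tnorm: "tnorm g xs (V0 v) = nrm v"
  by (simp add: tnorm_def nrm_def q_g)

lemma q_bform: "q = bform (metric_in A g c0 (cmap c0 xs))"
  by (simp add: q_def gm_def)

lemma q_sym: "q v w = q w v"
  unfolding q_def using gm_sym[OF c0(1)] c0(2) by blast

lemma q_pos: "v \<noteq> 0 \<Longrightarrow> 0 < q v v"
  unfolding q_def using gm_pos[OF c0(1)] c0(2) by blast

lemma q_nonneg: "0 \<le> q v v"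
  using q_pos[of v] by (cases "v = 0") (auto simp: q_bform bform_def)

lemma nrm_0: "nrm 0 = 0" by (simp add: nrm_def q_bform bform_def)
lemma nrm_nonneg: "0 \<le> nrm v" by (simp add: nrm_def q_nonneg)
lemma nrm_sq: "nrm v * nrm v = q v v" by (simp add: nrm_def q_nonneg)
lemma nrm_pos: "v \<noteq> 0 \<Longrightarrow> 0 < nrm v" by (simp add: nrm_def q_pos)

lemma nrm_scale: "nrm (t *\<^sub>R v) = \<bar>t\<bar> * nrm v"
  by (simp add: nrm_def q_bform bform_scale_left bform_scale_right mult.assoc[symmetric] real_sqrt_mult)

lemma nrm_continuous: "continuous_on S nrm"
  unfolding nrm_def q_bform bform_def by (intro continuous_intros)

lemma ray_geodesic:
  obtains \<gamma> \<gamma>' where "geodesic_vel \<gamma> \<gamma>'" "\<gamma> 0 = xs" "\<gamma>' 0 = V0 v" "\<And>t. F (t *\<^sub>R v) = \<gamma> t"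
proof -
  obtain \<gamma>0 where "geodesic_from A g xs (V0 v) \<gamma>0" using complete[OF coord_vec_tangent[OF c0]] by blast
  then obtain \<gamma> \<gamma>' where \<gamma>: "geodesic_vel \<gamma> \<gamma>'" "\<gamma> 0 = xs" "\<gamma>' 0 = V0 v"
    by (metis geodesic_from_vel)
  have "F (t *\<^sub>R v) = \<gamma> t" for t
    using rexp_geodesic[OF \<gamma>(1), of t] by (simp add: F_def \<gamma> coord_vec_scale[OF c0])
  with \<gamma> show ?thesis by (rule that)
qed

lemma F_0: "F 0 = xs"
  using ray_geodesic[of 0] by (metis scaleR_zero_left)

end

text \<open>\<open>R\<close> is a radius at which the exponential map is a diffeomorphism, not the
  injectivity radius itself: the latter is a supremum, and working below it avoids the question
  whether it is attained.\<close>

locale exp_ball = exp_map A g xs c0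
  for A :: "('m::{t2_space,second_countable_topology}, 'e::euclidean_space) chart set"
    and g :: "('m, 'e) metric" and xs :: 'm and c0 :: "('m, 'e) chart" +
  fixes R :: ereal
  assumes R: "0 < R" and diffeo: "exp_diffeo A g xs R"
begin

definition N :: "'e set" where "N = {v. ereal (nrm v) < R}"
definition Fi :: "'m \<Rightarrow> 'e" where "Fi = inv_into N F"

lemma N_scale: "v \<in> N \<Longrightarrow> \<bar>t\<bar> \<le> 1 \<Longrightarrow> t *\<^sub>R v \<in> N"
proof -
  assume v: "v \<in> N" and t: "\<bar>t\<bar> \<le> 1"
  have "nrm (t *\<^sub>R v) \<le> 1 * nrm v" unfolding nrm_scale using t nrm_nonneg by (intro mult_right_mono) auto
  then have "ereal (nrm (t *\<^sub>R v)) \<le> ereal (nrm v)" by simp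
  then show ?thesis using v unfolding N_def mem_Collect_eq by (rule le_less_trans)
qed

lemma N_0: "0 \<in> N" using R by (simp add: N_def nrm_0 zero_ereal_def)

lemma diffeo_onto_F: "diffeo_onto A N (rball A g xs R) F"
proof -
  have "{v. ereal (tnorm g xs (V0 v)) < R} = N" by (simp add: N_def nrm_tnorm)
  moreover have "(\<lambda>v. rexp A g xs (V0 v)) = F" by (simp add: F_def fun_eq_iff)
  ultimately show ?thesis using diffeo c0 unfolding exp_diffeo_def by metis
qed

lemma open_N: "open N" and open_B: "open (rball A g xs R)" and bij_F: "bij_betw F N (rball A g xs R)"
  and F_continuous: "continuous_on N F"
  and F_smooth: "d \<in> A \<Longrightarrow> smooth_on (N \<inter> F -` cdom d) (cmap d \<circ> F)"
  and Fi_smooth: "d \<in> A \<Longrightarrow> smooth_on (cmap d ` (cdom d \<inter> rball A g xs R)) (Fi \<circ> cinv d)"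
  using diffeo_onto_F by (auto simp: diffeo_onto_def Fi_def)

lemma Fi_F: "v \<in> N \<Longrightarrow> Fi (F v) = v"
  using bij_F by (simp add: Fi_def bij_betw_def)

lemma F_Fi: "y \<in> rball A g xs R \<Longrightarrow> F (Fi y) = y" and Fi_N: "y \<in> rball A g xs R \<Longrightarrow> Fi y \<in> N"
  using bij_F by (auto simp: Fi_def bij_betw_def f_inv_into_f inv_into_into)

lemma F_B: "v \<in> N \<Longrightarrow> F v \<in> rball A g xs R"
  using bij_F by (auto simp: bij_betw_def)

lemma open_chart_N: "d \<in> A \<Longrightarrow> open (N \<inter> F -` cdom d)"
  using F_smooth by (simp add: smooth_on_def)

lemma F_derivative: "d \<in> A \<Longrightarrow> x \<in> N \<Longrightarrow> F x \<in> cdom d \<Longrightarrow> ((\<lambda>y. cmap d (F y)) has_derivative D d x) (at x)"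
  using smooth_on_frechet[OF F_smooth, of d x] by (simp add: D_def comp_def)

lemma D_derivative:
  assumes "d \<in> A" "x \<in> N" "F x \<in> cdom d"
  shows "((\<lambda>y. D d y a) has_derivative D2 d x a) (at x)"
  using smooth_on_frechet[OF smooth_on_derivative[OF F_smooth], of d x] assms by (simp add: D_def D2_def)

lemma D2_sym: "d \<in> A \<Longrightarrow> x \<in> N \<Longrightarrow> F x \<in> cdom d \<Longrightarrow> D2 d x a b = D2 d x b a"
  unfolding D2_def D_def by (rule smooth_on_second_derivative_symmetric[OF F_smooth]) auto

lemma D_linear: "d \<in> A \<Longrightarrow> x \<in> N \<Longrightarrow> F x \<in> cdom d \<Longrightarrow> linear (D d x)"
  using F_derivative has_derivative_linear by blast

lemma D2_linear: "d \<in> A \<Longrightarrow> x \<in> N \<Longrightarrow> F x \<in> cdom d \<Longrightarrow> linear (D2 d x a)"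
  using D_derivative has_derivative_linear by blast

lemma dF_chart: "d \<in> A \<Longrightarrow> F x \<in> cdom d \<Longrightarrow> dF x a d = D d x a"
  by (simp add: dF_def)

lemma dF_tangent:
  assumes x: "x \<in> N"
  shows "dF x a \<in> tangent_space A (F x)"
proof -
  obtain c where c: "c \<in> A" "F x \<in> cdom c" by (rule chart_at)
  have "dF x a = coord_vec A c (F x) (D c x a)"
  proof (rule ext)
    fix d
    show "dF x a d = coord_vec A c (F x) (D c x a) d"
    proof (cases "d \<in> A \<and> F x \<in> cdom d")
      case True
      then have d: "d \<in> A" "F x \<in> cdom d" by auto
      have "((\<lambda>y. (cmap d \<circ> cinv c) (cmap c (F y))) has_derivative
          (\<lambda>a. frechet_derivative (cmap d \<circ> cinv c) (at (cmap c (F x))) (D c x a))) (at x)"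
        by (rule has_derivative_compose[OF F_derivative[OF c(1) x c(2)] transition_has_derivative[OF c(1) d(1) c(2) d(2)]])
      then have "((\<lambda>y. cmap d (F y)) has_derivative
          (\<lambda>a. frechet_derivative (cmap d \<circ> cinv c) (at (cmap c (F x))) (D c x a))) (at x)"
        by (rule has_derivative_transform_within_open[OF _ open_chart_N[OF c(1)]])
          (use x c in \<open>auto simp: cinv_cmap\<close>)
      from has_derivative_unique[OF this F_derivative[OF d(1) x d(2)]]
      have "D d x a = frechet_derivative (cmap d \<circ> cinv c) (at (cmap c (F x))) (D c x a)" by metis
      with True show ?thesis unfolding dF_def coord_vec_def by presburger
    next
      case False
      then show ?thesis unfolding dF_def coord_vec_def by presburger
    qed
  qed
  then show ?thesis using coord_vec_tangent[OF c] by simp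
qed

lemma g_dF:
  assumes "d \<in> A" "x \<in> N" "F x \<in> cdom d"
  shows "g (F x) (dF x a) (dF x b) = gm d (cmap d (F x)) (D d x a) (D d x b)"
  using g_chart[OF dF_tangent[OF assms(2)] dF_tangent[OF assms(2)] assms(1,3), of a b] assms
  by (simp add: dF_chart)

text \<open>Expresses the velocity of the ray by the differential of \<open>F\<close>, which is
  possible where \<open>F\<close> is smooth, that is inside \<open>N\<close>.\<close>

lemma ray:
  obtains \<gamma> \<gamma>' where "geodesic_vel \<gamma> \<gamma>'" "\<gamma> 0 = xs" "\<gamma>' 0 = V0 v" "\<And>t. F (t *\<^sub>R v) = \<gamma> t"
    "\<And>t. t *\<^sub>R v \<in> N \<Longrightarrow> \<gamma>' t = dF (t *\<^sub>R v) v"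
proof -
  obtain \<gamma> \<gamma>' where \<gamma>: "geodesic_vel \<gamma> \<gamma>'" "\<gamma> 0 = xs" "\<gamma>' 0 = V0 v" and F: "\<And>t. F (t *\<^sub>R v) = \<gamma> t"
    by (rule ray_geodesic[of v]) blast
  have "\<gamma>' t = dF (t *\<^sub>R v) v" if t: "t *\<^sub>R v \<in> N" for t
  proof -
    obtain c where c: "c \<in> A" "\<gamma> t \<in> cdom c" by (rule chart_at)
    have "((\<lambda>s. cmap c (F (s *\<^sub>R v))) has_derivative (\<lambda>h. D c (t *\<^sub>R v) (h *\<^sub>R v))) (at t)"
      using c t by (intro has_derivative_compose[OF _ F_derivative]) (auto simp: F intro!: derivative_eq_intros)
    then have "((\<lambda>s. cmap c (\<gamma> s)) has_vector_derivative D c (t *\<^sub>R v) v) (at t)"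
      using D_linear[OF c(1) t] c(2) by (simp add: F has_vector_derivative_def linear_cmul)
    then have "\<gamma>' t c = D c (t *\<^sub>R v) v"
      using geodesic_vel_chart(1)[OF \<gamma>(1) c] vector_derivative_unique_at by blast
    then show ?thesis
      using geodesic_vel_continuous(2)[OF \<gamma>(1), of t] dF_tangent[OF t, of v] c
      by (intro tangent_eqI[of "\<gamma>' t" "\<gamma> t" _ c]) (auto simp: F dF_chart)
  qed
  with \<gamma> F show ?thesis by (rule that)
qed

lemma ray_speed:
  assumes "t *\<^sub>R v \<in> N"
  shows "g (F (t *\<^sub>R v)) (dF (t *\<^sub>R v) v) (dF (t *\<^sub>R v) v) = q v v"
  by (rule ray[of v]) (use geodesic_speed q_g assms in metis)

text \<open>The geodesic equation along the ray, read as a statement on the second derivative of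
  \<open>F\<close> taken twice in direction \<open>v\<close>.\<close>

lemma ray_acceleration:
  assumes d: "d \<in> A" and x: "t *\<^sub>R v \<in> N" "F (t *\<^sub>R v) \<in> cdom d"
  shows "D2 d (t *\<^sub>R v) v v = - christoffel A g d (cmap d (F (t *\<^sub>R v))) (D d (t *\<^sub>R v) v) (D d (t *\<^sub>R v) v)"
proof -
  obtain \<gamma> \<gamma>' where \<gamma>: "geodesic_vel \<gamma> \<gamma>'" "\<gamma> 0 = xs" "\<gamma>' 0 = V0 v" and F: "\<And>t. F (t *\<^sub>R v) = \<gamma> t"
    and v: "\<And>t. t *\<^sub>R v \<in> N \<Longrightarrow> \<gamma>' t = dF (t *\<^sub>R v) v"
    by (rule ray[of v]) blast
  have "\<gamma> t \<in> cdom d" using x by (simp add: F)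
  from geodesic_vel_chart(2)[OF \<gamma>(1) d this]
  have "((\<lambda>s. \<gamma>' s d) has_derivative (\<lambda>h. h *\<^sub>R - christoffel A g d (cmap d (F (t *\<^sub>R v))) (D d (t *\<^sub>R v) v) (D d (t *\<^sub>R v) v))) (at t)"
    using v[OF x(1)] d x by (simp add: has_vector_derivative_def F dF_chart)
  moreover have "open ((\<lambda>s. s *\<^sub>R v) -` (N \<inter> F -` cdom d))"
    by (intro open_vimage open_chart_N d continuous_intros)
  ultimately have "((\<lambda>s. D d (s *\<^sub>R v) v) has_derivative (\<lambda>h. h *\<^sub>R - christoffel A g d (cmap d (F (t *\<^sub>R v))) (D d (t *\<^sub>R v) v) (D d (t *\<^sub>R v) v))) (at t)"
    by (rule has_derivative_transform_within_open) (use x d v in \<open>auto simp: dF_chart\<close>)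
  moreover have "((\<lambda>s. D d (s *\<^sub>R v) v) has_derivative (\<lambda>h. D2 d (t *\<^sub>R v) v (h *\<^sub>R v))) (at t)"
    by (rule has_derivative_compose[where f = "\<lambda>s. s *\<^sub>R v" and g = "\<lambda>y. D d y v" and x = t and s = UNIV, OF _ D_derivative[OF d x, of v]]) (auto intro!: derivative_eq_intros)
  ultimately have "(\<lambda>h. D2 d (t *\<^sub>R v) v (h *\<^sub>R v)) 1 = (\<lambda>h. h *\<^sub>R - christoffel A g d (cmap d (F (t *\<^sub>R v))) (D d (t *\<^sub>R v) v) (D d (t *\<^sub>R v) v)) 1"
    using has_derivative_unique by metis
  then show ?thesis by simp
qed

text \<open>Differentiating the constant energy of the ray with initial velocity \<open>w + s u\<close> in \<open>s\<close>.\<close>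

lemma energy_variation:
  assumes d: "d \<in> A" and x: "t *\<^sub>R w \<in> N" "F (t *\<^sub>R w) \<in> cdom d"
  shows "t * dgm d (cmap d (F (t *\<^sub>R w))) (D d (t *\<^sub>R w) u) (D d (t *\<^sub>R w) w) (D d (t *\<^sub>R w) w)
    + 2 * gm d (cmap d (F (t *\<^sub>R w))) (D d (t *\<^sub>R w) w) (t *\<^sub>R D2 d (t *\<^sub>R w) w u + D d (t *\<^sub>R w) u) = 2 * q w u"
proof -
  define x where "x = t *\<^sub>R w"
  define y where "y s = x + s *\<^sub>R (t *\<^sub>R u)" for s
  have y: "y s = t *\<^sub>R (w + s *\<^sub>R u)" for s by (simp add: y_def x_def algebra_simps)
  have y0: "y 0 = x" by (simp add: y_def)
  have xN: "x \<in> N" "F x \<in> cdom d" using x by (simp_all add: x_def)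
  have U: "cmap d (F x) \<in> cmap d ` cdom d" using xN by auto
  have O: "open (y -` (N \<inter> F -` cdom d))"
    unfolding y_def by (intro open_vimage open_chart_N d continuous_intros)
  have dy: "(y has_derivative (\<lambda>h. h *\<^sub>R (t *\<^sub>R u))) (at 0)"
    unfolding y_def by (auto intro!: derivative_eq_intros)
  have lD: "linear (D d x)" and lD2: "linear (D2 d x a)" for a
    using D_linear[OF d xN] D2_linear[OF d xN] by auto
  \<comment> \<open>\<open>?v s\<close> is the velocity at time \<open>t\<close> of the geodesic
    with initial velocity \<open>w + s u\<close>, expanded by linearity so that it can be
    differentiated termwise.\<close>
  let ?c = "\<lambda>s. cmap d (F (y s))" and ?v = "\<lambda>s. D d (y s) w + s *\<^sub>R D d (y s) u"
  have dc: "(?c has_derivative (\<lambda>h. D d x (h *\<^sub>R (t *\<^sub>R u)))) (at 0)"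
    by (rule has_derivative_compose[OF dy]) (simp add: y0 F_derivative d xN)
  have dD: "((\<lambda>s. D d (y s) a) has_derivative (\<lambda>h. D2 d x a (h *\<^sub>R (t *\<^sub>R u)))) (at 0)" for a
    by (rule has_derivative_compose[OF dy]) (simp add: y0 D_derivative d xN)
  have dv: "(?v has_derivative (\<lambda>h. h *\<^sub>R (t *\<^sub>R D2 d x w u + D d x u))) (at 0)"
    by (rule has_derivative_eq_rhs, (rule derivative_intros dD)+)
      (simp add: fun_eq_iff y0 linear_cmul[OF lD2] algebra_simps)
  have "((\<lambda>s. gm d (?c s) (?v s) (?v s)) has_derivative (\<lambda>h. h * (t * dgm d (cmap d (F x)) (D d x u) (D d x w) (D d x w)
      + 2 * gm d (cmap d (F x)) (D d x w) (t *\<^sub>R D2 d x w u + D d x u)))) (at 0)"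
  proof (rule has_derivative_eq_rhs[OF gm_curve_derivative[OF d _ dc dv dv]], goal_cases)
    case 2
    show ?case
    proof
      fix h
      have "gm d (cmap d (F x)) (h *\<^sub>R (t *\<^sub>R D2 d x w u + D d x u)) (D d x w)
        = h * gm d (cmap d (F x)) (D d x w) (t *\<^sub>R D2 d x w u + D d x u)"
        using gm_sym[OF d U] by (simp add: gm_def bform_scale_left)
      moreover have "gm d (cmap d (F x)) (D d x w) (h *\<^sub>R (t *\<^sub>R D2 d x w u + D d x u))
        = h * gm d (cmap d (F x)) (D d x w) (t *\<^sub>R D2 d x w u + D d x u)"
        by (simp add: gm_def bform_scale_right)
      moreover have "dgm d (cmap d (F x)) (D d x (h *\<^sub>R (t *\<^sub>R u))) v v' = h * (t * dgm d (cmap d (F x)) (D d x u) v v')" for v v'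
        using linear_cmul[OF dgm_linear[OF d U]] by (simp add: linear_cmul[OF lD])
      ultimately show "dgm d (?c 0) (D d x (h *\<^sub>R t *\<^sub>R u)) (?v 0) (?v 0) +
         gm d (?c 0) (h *\<^sub>R (t *\<^sub>R D2 d x w u + D d x u)) (?v 0) + gm d (?c 0) (?v 0) (h *\<^sub>R (t *\<^sub>R D2 d x w u + D d x u)) =
         h * (t * dgm d (cmap d (F x)) (D d x u) (D d x w) (D d x w) + 2 * gm d (cmap d (F x)) (D d x w) (t *\<^sub>R D2 d x w u + D d x u))"
        by (simp add: y0 algebra_simps)
    qed
  qed (use U y0 in simp)
  then have 1: "((\<lambda>s. q (w + s *\<^sub>R u) (w + s *\<^sub>R u)) has_derivative (\<lambda>h. h * (t * dgm d (cmap d (F x)) (D d x u) (D d x w) (D d x w)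
      + 2 * gm d (cmap d (F x)) (D d x w) (t *\<^sub>R D2 d x w u + D d x u)))) (at 0)"
  proof (rule has_derivative_transform_within_open[OF _ O])
    fix s assume "s \<in> y -` (N \<inter> F -` cdom d)"
    then have s: "y s \<in> N" "F (y s) \<in> cdom d" by auto
    have "?v s = D d (y s) (w + s *\<^sub>R u)"
      using D_linear[OF d s] by (simp add: linear_add linear_cmul)
    then show "gm d (?c s) (?v s) (?v s) = q (w + s *\<^sub>R u) (w + s *\<^sub>R u)"
      using g_dF[OF d s, of "w + s *\<^sub>R u" "w + s *\<^sub>R u"] ray_speed[of t "w + s *\<^sub>R u"] s by (simp add: y)
  qed (use y0 xN in auto)
  have dw: "((\<lambda>s. w + s *\<^sub>R u) has_derivative (\<lambda>h. h *\<^sub>R u)) (at 0)"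
    by (auto intro!: derivative_eq_intros)
  have 2: "((\<lambda>s. q (w + s *\<^sub>R u) (w + s *\<^sub>R u)) has_derivative (\<lambda>h. bform (\<lambda>i j. 0) (w + 0 *\<^sub>R u) (w + 0 *\<^sub>R u)
      + q (h *\<^sub>R u) (w + 0 *\<^sub>R u) + q (w + 0 *\<^sub>R u) (h *\<^sub>R u))) (at 0)"
    unfolding q_bform by (rule has_derivative_bform[OF _ dw dw]) auto
  \<comment> \<open>The energy has been differentiated in two ways: through the chart, and directly
    as a quadratic form with constant coefficients. The two derivatives are compared at the
    increment 1.\<close>
  have "bform (\<lambda>i j. 0) (w + 0 *\<^sub>R u) (w + 0 *\<^sub>R u) + q (1 *\<^sub>R u) (w + 0 *\<^sub>R u) + q (w + 0 *\<^sub>R u) (1 *\<^sub>R u)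
    = 1 * (t * dgm d (cmap d (F x)) (D d x u) (D d x w) (D d x w)
      + 2 * gm d (cmap d (F x)) (D d x w) (t *\<^sub>R D2 d x w u + D d x u))"
    using fun_cong[OF has_derivative_unique[OF 2 1], of 1] .
  then show ?thesis using q_sym[of u w] by (simp add: x_def bform_def)
qed

text \<open>The function \<open>\<phi>\<close> below has the constant derivative \<open>q w u\<close>: the geodesic equation and the
  symmetry of second derivatives turn \<open>\<phi>'\<close> into half of the first variation of the energy.\<close>

lemma Gauss_lemma:
  assumes w: "w \<in> N"
  shows "g (F w) (dF w w) (dF w u) = q w u"
proof -
  \<comment> \<open>The last argument is the Jacobi field \<open>t dF u\<close> along the ray; it
    vanishes at \<open>t = 0\<close> and is \<open>dF w u\<close> at \<open>t = 1\<close>.\<close>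
  define \<phi> where "\<phi> t = g (F (t *\<^sub>R w)) (dF (t *\<^sub>R w) w) (dF (t *\<^sub>R w) (t *\<^sub>R u))" for t
  have deriv: "(\<phi> has_derivative (\<lambda>h. h * q w u)) (at t)" if t: "0 \<le> t" "t \<le> 1" for t
  proof -
    define x where "x = t *\<^sub>R w"
    have xN: "x \<in> N" using N_scale[OF w, of t] t by (simp add: x_def)
    obtain d where d: "d \<in> A" "F x \<in> cdom d" by (rule chart_at)
    have U: "cmap d (F x) \<in> cmap d ` cdom d" using d by auto
    have O: "open ((\<lambda>s. s *\<^sub>R w) -` (N \<inter> F -` cdom d))"
      by (intro open_vimage open_chart_N d continuous_intros)
    have dy: "((\<lambda>s. s *\<^sub>R w) has_derivative (\<lambda>h. h *\<^sub>R w)) (at t)"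
      by (auto intro!: derivative_eq_intros)
    have lD: "linear (D d x)" and lD2: "linear (D2 d x a)" for a
      using D_linear[OF d(1) xN d(2)] D2_linear[OF d(1) xN d(2)] by auto
    let ?c = "\<lambda>s. cmap d (F (s *\<^sub>R w))"
    have dc: "(?c has_derivative (\<lambda>h. D d x (h *\<^sub>R w))) (at t)"
      by (rule has_derivative_compose[OF dy]) (use F_derivative[OF d(1) xN d(2)] in \<open>simp add: x_def\<close>)
    have dD: "((\<lambda>s. D d (s *\<^sub>R w) a) has_derivative (\<lambda>h. D2 d x a (h *\<^sub>R w))) (at t)" for a
      by (rule has_derivative_compose[OF dy]) (use D_derivative[OF d(1) xN d(2)] in \<open>simp add: x_def\<close>)
    have dJ: "((\<lambda>s. s *\<^sub>R D d (s *\<^sub>R w) u) has_derivative (\<lambda>h. h *\<^sub>R (D d x u + t *\<^sub>R D2 d x u w))) (at t)"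
      by (rule has_derivative_eq_rhs, (rule derivative_intros dD)+)
        (simp add: fun_eq_iff x_def[symmetric] linear_cmul[OF lD2] algebra_simps)
    \<comment> \<open>The summands come from differentiating the metric, the radial velocity and the
      Jacobi field. By the Koszul formula the first two add up to half of the metric term in the
      energy variation.\<close>
    have main: "dgm d (cmap d (F x)) (D d x w) (D d x w) (t *\<^sub>R D d x u)
        + gm d (cmap d (F x)) (D2 d x w w) (t *\<^sub>R D d x u)
        + gm d (cmap d (F x)) (D d x w) (D d x u + t *\<^sub>R D2 d x u w) = q w u"
    proof -
      have h: "2 * gm d (cmap d (F x)) (D2 d x w w) (D d x u)
          = dgm d (cmap d (F x)) (D d x u) (D d x w) (D d x w) - 2 * dgm d (cmap d (F x)) (D d x w) (D d x w) (D d x u)"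
        using ray_acceleration[OF d(1), of t w] christoffel[OF d(1) U, of "D d x w" "D d x w" "D d x u"] xN d(2)
        by (simp add: x_def gm_def bform_minus_left)
      have "2 * (t * gm d (cmap d (F x)) (D2 d x w w) (D d x u))
          = t * dgm d (cmap d (F x)) (D d x u) (D d x w) (D d x w) - 2 * (t * dgm d (cmap d (F x)) (D d x w) (D d x w) (D d x u))"
        using arg_cong[OF h, of "\<lambda>z. t * z"] by (simp only: right_diff_distrib mult.left_commute)
      moreover have "t * dgm d (cmap d (F x)) (D d x u) (D d x w) (D d x w)
          + 2 * gm d (cmap d (F x)) (D d x w) (t *\<^sub>R D2 d x u w + D d x u) = 2 * q w u"
        using energy_variation[OF d(1), of t w u] xN d(2) D2_sym[OF d(1) xN d(2), of u w] by (simp add: x_def)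
      ultimately show ?thesis
        by (simp add: dgm_def gm_def bform_scale_right bform_add_right add.commute)
    qed
    have "((\<lambda>s. gm d (?c s) (D d (s *\<^sub>R w) w) (s *\<^sub>R D d (s *\<^sub>R w) u)) has_derivative (\<lambda>h. h * q w u)) (at t)"
    proof (rule has_derivative_eq_rhs[OF gm_curve_derivative[OF d(1) _ dc dD dJ]], goal_cases)
      case 2
      show ?case
      proof
        fix h
        have "dgm d (cmap d (F x)) (D d x (h *\<^sub>R w)) v v' = h * dgm d (cmap d (F x)) (D d x w) v v'" for v v'
          using linear_cmul[OF dgm_linear[OF d(1) U]] by (simp add: linear_cmul[OF lD])
        then show "dgm d (cmap d (F (t *\<^sub>R w))) (D d x (h *\<^sub>R w)) (D d (t *\<^sub>R w) w) (t *\<^sub>R D d (t *\<^sub>R w) u) +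
            gm d (cmap d (F (t *\<^sub>R w))) (D2 d x w (h *\<^sub>R w)) (t *\<^sub>R D d (t *\<^sub>R w) u) +
            gm d (cmap d (F (t *\<^sub>R w))) (D d (t *\<^sub>R w) w) (h *\<^sub>R (D d x u + t *\<^sub>R D2 d x u w)) = h * q w u"
          unfolding main[symmetric] x_def[symmetric]
          by (simp add: linear_cmul[OF lD2] gm_def bform_scale_left bform_scale_right distrib_left)
      qed
    qed (use U in \<open>simp add: x_def\<close>)
    then show ?thesis
    proof (rule has_derivative_transform_within_open[OF _ O])
      fix s assume "s \<in> (\<lambda>s. s *\<^sub>R w) -` (N \<inter> F -` cdom d)"
      then have s: "s *\<^sub>R w \<in> N" "F (s *\<^sub>R w) \<in> cdom d" by auto
      show "gm d (?c s) (D d (s *\<^sub>R w) w) (s *\<^sub>R D d (s *\<^sub>R w) u) = \<phi> s"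
        using g_dF[OF d(1) s] linear_cmul[OF D_linear[OF d(1) s], of s u] by (simp add: \<phi>_def)
    qed (use xN d in \<open>simp add: x_def\<close>)
  qed
  have "\<exists>t\<in>{0<..<1::real}. \<phi> 1 - \<phi> 0 = (1 - 0) * q w u"
    by (rule mvt_simple[where f' = "\<lambda>t h. h * q w u"]) (use deriv in \<open>auto intro: has_derivative_at_withinI\<close>)
  moreover have "\<phi> 0 = 0"
  proof -
    have "dF 0 0 = (\<lambda>c. 0)"
      using D_linear[of _ 0] N_0 by (auto simp: dF_def fun_eq_iff linear_0)
    then show ?thesis using g_zero_right[OF dF_tangent[OF N_0]] by (simp add: \<phi>_def)
  qed
  ultimately show ?thesis by (simp add: \<phi>_def)
qed

end

section \<open>Length of curves\<close>

text \<open>Induction on the number of points of \<open>S\<close> strictly between the end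
  points.\<close>

lemma integrable_on_pieces:
  fixes f :: "real \<Rightarrow> 'a::banach"
  assumes S: "finite S"
    and pieces: "\<And>a b. a \<in> S \<Longrightarrow> b \<in> S \<Longrightarrow> a < b \<Longrightarrow> S \<inter> {a<..<b} = {} \<Longrightarrow> f integrable_on {a..b}"
  shows "a \<in> S \<Longrightarrow> b \<in> S \<Longrightarrow> a \<le> b \<Longrightarrow> f integrable_on {a..b}"
proof (induction "card (S \<inter> {a<..<b})" arbitrary: a b rule: less_induct)
  case less
  show ?case
  proof (cases "S \<inter> {a<..<b} = {}")
    case True
    then show ?thesis using pieces[of a b] less.prems integrable_on_refl[of f b] by (cases "a = b") auto
  next
    case False
    then obtain m where m: "m \<in> S" "a < m" "m < b" by auto
    have "S \<inter> {a<..<m} \<subset> S \<inter> {a<..<b}" "S \<inter> {m<..<b} \<subset> S \<inter> {a<..<b}" using m by auto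
    then have "card (S \<inter> {a<..<m}) < card (S \<inter> {a<..<b})" "card (S \<inter> {m<..<b}) < card (S \<inter> {a<..<b})"
      using S by (auto intro!: psubset_card_mono)
    then have "f integrable_on {a..m}" "f integrable_on {m..b}"
      using less.hyps[of a m] less.hyps[of m b] less.prems m by auto
    then show ?thesis using m by (intro Henstock_Kurzweil_Integration.integrable_combine[of a m b]) auto
  qed
qed

lemma piecewise_C1E:
  assumes "piecewise_C1_curve A \<gamma>"
  obtains S where "finite S" "{0, 1} \<subseteq> S" "S \<subseteq> {0..1}"
    "\<And>a b. a \<in> S \<Longrightarrow> b \<in> S \<Longrightarrow> a < b \<Longrightarrow> S \<inter> {a<..<b} = {} \<Longrightarrow> C1_curve_on A {a..b} \<gamma>"
proof -
  from assms obtain S where S: "finite S" "{0, 1} \<subseteq> S" "S \<subseteq> {0..1}"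
    and C1: "\<forall>a\<in>S. \<forall>b\<in>S. a < b \<and> S \<inter> {a<..<b} = {} \<longrightarrow> C1_curve_on A {a..b} \<gamma>"
    unfolding piecewise_C1_curve_def by (elim conjE exE) (rule that)
  show ?thesis by (rule that[OF S]) (rule C1[rule_format], simp_all)
qed

context riemannian
begin

lemma g_nonneg: "X \<in> tangent_space A x \<Longrightarrow> 0 \<le> g x X X"
  using g_pos[of X x X] g_zero_right[of X x] by (cases "X = (\<lambda>c. 0)") auto

lemma Cauchy_Schwarz_g:
  assumes X: "X \<in> tangent_space A x" and Y: "Y \<in> tangent_space A x"
  shows "\<bar>g x X Y\<bar> \<le> tnorm g x X * tnorm g x Y"
proof -
  let ?a = "g x X X" and ?b = "g x X Y" and ?c = "g x Y Y"
  have "?b\<^sup>2 \<le> ?a * ?c"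
  proof (cases "?c = 0")
    case True
    then have "Y = (\<lambda>c. 0)" using g_pos[OF Y Y] by force
    then show ?thesis using g_zero_right[OF X] True by simp
  next
    case False
    then have c: "0 < ?c" using g_nonneg[OF Y] by simp
    \<comment> \<open>The component of \<open>X\<close> orthogonal to \<open>Y\<close>, multiplied
      by \<open>?c\<close> to avoid a division; its squared norm is
      \<open>?c * (?a * ?c - ?b^2)\<close>.\<close>
    define Z where "Z = (\<lambda>d. ?c *\<^sub>R X d + (- ?b) *\<^sub>R Y d)"
    have Z: "Z \<in> tangent_space A x" unfolding Z_def by (rule tangent_comb[OF X Y])
    have "0 \<le> g x Z Z" by (rule g_nonneg[OF Z])
    also have "g x Z Z = ?c * g x X Z + (- ?b) * g x Y Z"
      by (subst Z_def) (rule g_comb[OF X Y Z])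
    also have "g x X Z = ?c * ?a + (- ?b) * ?b" unfolding Z_def by (rule g_comb_right[OF X Y X])
    also have "g x Y Z = ?c * g x Y X + (- ?b) * ?c" unfolding Z_def by (rule g_comb_right[OF X Y Y])
    also have "g x Y X = ?b" by (rule g_sym[OF Y X])
    finally have "0 \<le> ?c * (?a * ?c - ?b\<^sup>2)" by (simp add: algebra_simps power2_eq_square)
    then show ?thesis using c by (simp add: zero_le_mult_iff)
  qed
  then have "\<bar>?b\<bar> \<le> sqrt (?a * ?c)" by (intro real_le_rsqrt) simp
  then show ?thesis by (simp add: tnorm_def real_sqrt_mult)
qed

text \<open>In a chart the speed is the square root of a polynomial in the velocity components and
  the metric coefficients along the curve. The times spent in the chart are relatively open in
  \<open>I\<close>, so continuity may be checked there.\<close>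

lemma C1_speed_continuous:
  assumes vel: "\<And>t. t \<in> I \<Longrightarrow> has_velocity A I \<gamma> t (\<gamma>' t)"
    and cont: "\<And>c. c \<in> A \<Longrightarrow> continuous_on {t \<in> I. \<gamma> t \<in> cdom c} (\<lambda>t. \<gamma>' t c)"
  shows "continuous_on I (\<lambda>t. tnorm g (\<gamma> t) (\<gamma>' t))"
  unfolding continuous_on_eq_continuous_within
proof
  fix t assume t: "t \<in> I"
  obtain c where c: "c \<in> A" "\<gamma> t \<in> cdom c" by (rule chart_at)
  let ?J = "{s \<in> I. \<gamma> s \<in> cdom c}"
  have cg: "continuous_on I \<gamma>"
    using vel by (auto simp: has_velocity_def continuous_on_eq_continuous_within)
  then obtain T where T: "open T" "T \<inter> I = \<gamma> -` cdom c \<inter> I"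
    using open_cdom[OF c(1)] unfolding continuous_on_open_invariant by metis
  have "continuous_on ?J (\<lambda>s. cmap c (\<gamma> s))"
    by (rule continuous_on_compose2[OF continuous_cmap[OF c(1)] continuous_on_subset[OF cg]]) auto
  then have "continuous_on ?J (\<lambda>s. metric_in A g c (cmap c (\<gamma> s)) i j)" for i j
    by (rule continuous_on_compose2[OF smooth_on_continuous[OF metric_in_smooth[OF c(1)]]]) auto
  then have "continuous_on ?J (\<lambda>s. sqrt (gm c (cmap c (\<gamma> s)) (\<gamma>' s c) (\<gamma>' s c)))"
    unfolding gm_def bform_def using cont[OF c(1)] by (intro continuous_intros)
  moreover have "sqrt (gm c (cmap c (\<gamma> s)) (\<gamma>' s c) (\<gamma>' s c)) = tnorm g (\<gamma> s) (\<gamma>' s)" if "s \<in> ?J" for s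
  proof -
    have "\<gamma>' s \<in> tangent_space A (\<gamma> s)" using vel[of s] that by (auto simp: has_velocity_def)
    then show ?thesis using that c by (simp add: tnorm_def g_chart)
  qed
  ultimately have "continuous_on ?J (\<lambda>t. tnorm g (\<gamma> t) (\<gamma>' t))"
    by (rule continuous_on_eq)
  then have "continuous (at t within ?J) (\<lambda>t. tnorm g (\<gamma> t) (\<gamma>' t))"
    using t c by (auto simp: continuous_on_eq_continuous_within)
  moreover have "at t within I = at t within ?J"
    by (rule at_within_nhd[of t T]) (use T t c in auto)
  ultimately show "continuous (at t within I) (\<lambda>t. tnorm g (\<gamma> t) (\<gamma>' t))" by simp
qed

text \<open>At the break points, and at 0 and 1, \<open>velocity\<close> may be an arbitrary choice.
  The integrand is therefore replaced by \<open>h\<close>, which is 0 there and nonnegative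
  everywhere; finitely many points leave the integral unchanged.\<close>

lemma piecewise_C1_speed:
  assumes \<gamma>: "piecewise_C1_curve A \<gamma>"
  obtains S h where "finite S" "\<And>t. 0 \<le> h t" "(h has_integral curve_length A g \<gamma>) {0..1}"
    "\<And>t. t \<in> {0<..<1} - S \<Longrightarrow> has_velocity A UNIV \<gamma> t (velocity A \<gamma> t)"
    "\<And>t. t \<in> {0<..<1} - S \<Longrightarrow> h t = tnorm g (\<gamma> t) (velocity A \<gamma> t)"
proof -
  obtain S where S: "finite S" "{0, 1} \<subseteq> S" "S \<subseteq> {0..1}"
    and C1: "\<And>a b. a \<in> S \<Longrightarrow> b \<in> S \<Longrightarrow> a < b \<Longrightarrow> S \<inter> {a<..<b} = {} \<Longrightarrow> C1_curve_on A {a..b} \<gamma>"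
  proof (rule piecewise_C1E[OF \<gamma>], goal_cases)
    case (1 S)
    show ?case by (rule 1(1)) (fact 1)+
  qed
  let ?f = "\<lambda>t. tnorm g (\<gamma> t) (velocity A \<gamma> t)"
  have velU: "has_velocity A UNIV \<gamma> t X \<Longrightarrow> has_velocity A UNIV \<gamma> t (velocity A \<gamma> t)" for t X
    using someI[of "has_velocity A UNIV \<gamma> t" X] by (simp add: velocity_def)
  have inner: "has_velocity A {a..b} \<gamma> t X \<Longrightarrow> a < t \<Longrightarrow> t < b \<Longrightarrow> has_velocity A UNIV \<gamma> t X" for a b t X
    using has_velocity_filter[of "{a..b}" \<gamma> t X UNIV] by (simp add: at_within_Icc_at)
  have vel: "has_velocity A UNIV \<gamma> t (velocity A \<gamma> t)" if t: "t \<in> {0<..<1} - S" for t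
  proof -
    \<comment> \<open>The partition points next to \<open>t\<close>: on the piece between them
      \<open>t\<close> is interior, so the velocity relative to the piece is two-sided.\<close>
    define a where "a = Max {s\<in>S. s < t}"
    define b where "b = Min {s\<in>S. t < s}"
    have fin: "finite {s\<in>S. s < t}" "finite {s\<in>S. t < s}" using S by auto
    have ne: "{s\<in>S. s < t} \<noteq> {}" "{s\<in>S. t < s} \<noteq> {}" using S t by auto
    have ab: "a \<in> S" "a < t" "b \<in> S" "t < b"
      using Max_in[OF fin(1) ne(1)] Min_in[OF fin(2) ne(2)] by (auto simp: a_def b_def)
    have "S \<inter> {a<..<b} = {}"
    proof (rule ccontr)
      assume "S \<inter> {a<..<b} \<noteq> {}"
      then obtain s where s: "s \<in> S" "a < s" "s < b" by auto
      then have "s \<noteq> t" using t by auto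
      then consider "s < t" | "t < s" by linarith
      then show False
        using Max_ge[OF fin(1), of s] Min_le[OF fin(2), of s] s by cases (auto simp: a_def b_def)
    qed
    then have "C1_curve_on A {a..b} \<gamma>" using C1 ab by auto
    then obtain X where "has_velocity A {a..b} \<gamma> t X" using ab by (fastforce simp: C1_curve_on_def)
    then show ?thesis using inner velU ab by blast
  qed
  have "?f integrable_on {0..1}"
  proof (rule integrable_on_pieces[OF S(1)])
    fix a b assume ab: "a \<in> S" "b \<in> S" "a < b" "S \<inter> {a<..<b} = {}"
    obtain \<gamma>' where \<gamma>': "\<And>t. t \<in> {a..b} \<Longrightarrow> has_velocity A {a..b} \<gamma> t (\<gamma>' t)"
      "\<And>c. c \<in> A \<Longrightarrow> continuous_on {t \<in> {a..b}. \<gamma> t \<in> cdom c} (\<lambda>t. \<gamma>' t c)"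
      using C1[OF ab] unfolding C1_curve_on_def by blast
    have "(\<lambda>t. tnorm g (\<gamma> t) (\<gamma>' t)) integrable_on {a..b}"
      by (rule integrable_continuous_real[OF C1_speed_continuous[OF \<gamma>']])
    then show "?f integrable_on {a..b}"
    proof (rule integrable_spike_finite[of "{a, b}", rotated 2])
      fix t assume "t \<in> {a..b} - {a, b}"
      then have "has_velocity A UNIV \<gamma> t (\<gamma>' t)" using inner[of a b t "\<gamma>' t"] \<gamma>'(1)[of t] by auto
      then have "velocity A \<gamma> t = \<gamma>' t" using velU has_velocity_unique[of UNIV \<gamma> t] by auto
      then show "?f t = tnorm g (\<gamma> t) (\<gamma>' t)" by simp
    qed simp
  qed (use S in auto)
  then have fi: "(?f has_integral curve_length A g \<gamma>) {0..1}"
    unfolding curve_length_def by (rule integrable_integral)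
  define h where "h t = (if t \<in> {0<..<1} - S then ?f t else 0)" for t
  show ?thesis
  proof (rule that[OF S(1) _ _ vel])
    show "0 \<le> h t" for t
      using vel[of t] g_nonneg[of "velocity A \<gamma> t" "\<gamma> t"] by (auto simp: h_def tnorm_def has_velocity_def)
    show "(h has_integral curve_length A g \<gamma>) {0..1}"
      by (rule has_integral_spike_finite[OF S(1) _ fi]) (use S(2) in \<open>auto simp: h_def\<close>)
    show "h t = ?f t" if "t \<in> {0<..<1} - S" for t using that by (auto simp: h_def)
  qed
qed

lemma curve_length_nonneg: "piecewise_C1_curve A \<gamma> \<Longrightarrow> 0 \<le> curve_length A g \<gamma>"
  by (erule piecewise_C1_speed) (metis has_integral_nonneg)

lemma piecewise_C1_reverse:
  assumes \<gamma>: "piecewise_C1_curve A \<gamma>"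
  shows "piecewise_C1_curve A (\<lambda>t. \<gamma> (1 - t))"
proof -
  obtain S where S: "finite S" "{0, 1} \<subseteq> S" "S \<subseteq> {0..1}"
    and C1: "\<And>a b. a \<in> S \<Longrightarrow> b \<in> S \<Longrightarrow> a < b \<Longrightarrow> S \<inter> {a<..<b} = {} \<Longrightarrow> C1_curve_on A {a..b} \<gamma>"
  proof (rule piecewise_C1E[OF \<gamma>], goal_cases)
    case (1 S)
    show ?case by (rule 1(1)) (fact 1)+
  qed
  let ?r = "\<lambda>t::real. 1 - t"
  have C1': "C1_curve_on A {a..b} (\<lambda>t. \<gamma> (1 - t))"
    if ab: "a \<in> ?r ` S" "b \<in> ?r ` S" "a < b" "?r ` S \<inter> {a<..<b} = {}" for a b
  proof -
    have "S \<inter> {1 - b<..<1 - a} = {}"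
    proof (rule ccontr)
      assume "S \<inter> {1 - b<..<1 - a} \<noteq> {}"
      then obtain s where "s \<in> S" "1 - b < s" "s < 1 - a" by auto
      then have "1 - s \<in> ?r ` S \<inter> {a<..<b}" by auto
      with ab(4) show False by auto
    qed
    then have "C1_curve_on A {1 - b..1 - a} \<gamma>" using ab by (intro C1) auto
    then obtain \<gamma>' where v: "\<And>t. t \<in> {1 - b..1 - a} \<Longrightarrow> has_velocity A {1 - b..1 - a} \<gamma> t (\<gamma>' t)"
      and c: "\<And>c. c \<in> A \<Longrightarrow> continuous_on {t \<in> {1 - b..1 - a}. \<gamma> t \<in> cdom c} (\<lambda>t. \<gamma>' t c)"
      unfolding C1_curve_on_def by blast
    have im: "?r ` {a..b} = {1 - b..1 - a}"
      by (auto simp: image_def intro!: bexI[of _ "1 - _"])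
    have V: "has_velocity A {a..b} (\<lambda>t. \<gamma> (1 - t)) t (\<lambda>c. (- 1) *\<^sub>R \<gamma>' (1 - t) c)" if t: "t \<in> {a..b}" for t
    proof -
      have v': "has_velocity A {1 - b..1 - a} \<gamma> (1 - t) (\<gamma>' (1 - t))" using v t by auto
      have "continuous (at t within {a..b}) (\<lambda>t. \<gamma> (1 - t))"
        using v' im by (intro continuous_within_compose2[of t "{a..b}" ?r \<gamma>] continuous_intros) (auto simp: has_velocity_def)
      moreover have "((cmap c \<circ> (\<lambda>t. \<gamma> (1 - t))) has_vector_derivative (- 1) *\<^sub>R \<gamma>' (1 - t) c) (at t within {a..b})"
        if "c \<in> A" "\<gamma> (1 - t) \<in> cdom c" for c
      proof -
        have "(?r has_vector_derivative (- 1)) (at t within {a..b})"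
          by (auto intro!: derivative_eq_intros simp: has_vector_derivative_def)
        moreover have "((\<lambda>s. cmap c (\<gamma> s)) has_derivative (\<lambda>h. h *\<^sub>R \<gamma>' (1 - t) c)) (at (1 - t) within ?r ` {a..b})"
          using has_velocity_chart[OF v' that] unfolding im has_vector_derivative_def .
        ultimately show ?thesis
          using vector_derivative_diff_chain_within[of ?r "- 1" t "{a..b}" "\<lambda>s. cmap c (\<gamma> s)" "\<lambda>h. h *\<^sub>R \<gamma>' (1 - t) c"] by (simp add: comp_def)
      qed
      moreover have "(\<lambda>c. (- 1) *\<^sub>R \<gamma>' (1 - t) c) \<in> tangent_space A (\<gamma> (1 - t))"
        using v' by (intro tangent_scale) (auto simp: has_velocity_def)
      ultimately show ?thesis unfolding has_velocity_def by blast
    qed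
    have C: "continuous_on {t \<in> {a..b}. \<gamma> (1 - t) \<in> cdom c} (\<lambda>t. (- 1) *\<^sub>R \<gamma>' (1 - t) c)" if "c \<in> A" for c
      by (intro continuous_intros continuous_on_compose2[OF c[OF that], of _ ?r]) auto
    show ?thesis
      unfolding C1_curve_on_def by (intro exI[of _ "\<lambda>t c. (- 1) *\<^sub>R \<gamma>' (1 - t) c"] conjI ballI V C)
  qed
  have "continuous_on {0..1} (\<lambda>t. \<gamma> (1 - t))"
    using \<gamma> unfolding piecewise_C1_curve_def
    by (intro continuous_on_compose2[of "{0..1}" \<gamma> _ ?r] continuous_intros) auto
  then show ?thesis
    unfolding piecewise_C1_curve_def using S C1' by (intro conjI exI[of _ "?r ` S"]) auto
qed

lemma curve_length_reverse:
  assumes \<gamma>: "piecewise_C1_curve A \<gamma>"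
  shows "curve_length A g (\<lambda>t. \<gamma> (1 - t)) = curve_length A g \<gamma>"
proof -
  obtain S h where S: "finite S" and h: "(h has_integral curve_length A g \<gamma>) {0..1}"
    and vel: "\<And>t. t \<in> {0<..<1} - S \<Longrightarrow> has_velocity A UNIV \<gamma> t (velocity A \<gamma> t)"
    and hv: "\<And>t. t \<in> {0<..<1} - S \<Longrightarrow> h t = tnorm g (\<gamma> t) (velocity A \<gamma> t)"
    by (rule piecewise_C1_speed[OF \<gamma>]) blast
  have "((\<lambda>t. h (1 - t)) has_integral curve_length A g \<gamma>) {0..1}"
    using has_integral_affinity[OF h[unfolded box_real(2)[symmetric]], of "-1" 1] by (simp add: image_affinity_cbox)
  then have "((\<lambda>t. tnorm g (\<gamma> (1 - t)) (velocity A (\<lambda>t. \<gamma> (1 - t)) t)) has_integral curve_length A g \<gamma>) {0..1}"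
  proof (rule has_integral_spike_finite[of "insert 0 (insert 1 ((\<lambda>t. 1 - t) ` S))", rotated 2])
    fix t :: real assume t: "t \<in> {0..1} - insert 0 (insert 1 ((\<lambda>t. 1 - t) ` S))"
    then have "1 - t \<notin> S" by (auto simp: image_iff)
    then have t': "1 - t \<in> {0<..<1} - S" using t by auto
    define X where "X = velocity A \<gamma> (1 - t)"
    have X: "has_velocity A UNIV \<gamma> (1 - t) X" unfolding X_def by (rule vel[OF t'])
    then have "has_velocity A UNIV (\<lambda>s. \<gamma> (1 - s)) t (\<lambda>c. (- 1) *\<^sub>R X c)"
      using has_velocity_affine[of \<gamma> "- 1" t 1 X] by simp
    then have "velocity A (\<lambda>t. \<gamma> (1 - t)) t = (\<lambda>c. (- 1) *\<^sub>R X c)"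
      unfolding velocity_def using has_velocity_unique[of UNIV "\<lambda>s. \<gamma> (1 - s)" t] by (intro some_equality) auto
    moreover have "tnorm g (\<gamma> (1 - t)) (\<lambda>c. (- 1) *\<^sub>R X c) = tnorm g (\<gamma> (1 - t)) X"
    proof -
      have XT: "X \<in> tangent_space A (\<gamma> (1 - t))" using X by (simp add: has_velocity_def)
      have "g (\<gamma> (1 - t)) (\<lambda>c. (- 1) *\<^sub>R X c) Z = - g (\<gamma> (1 - t)) X Z" if "Z \<in> tangent_space A (\<gamma> (1 - t))" for Z
        using g_comb[OF XT XT that, where a = "- 1" and b = 0] by simp
      moreover have "g (\<gamma> (1 - t)) X (\<lambda>c. (- 1) *\<^sub>R X c) = - g (\<gamma> (1 - t)) X X"
        using g_comb_right[OF XT XT XT, where a = "- 1" and b = 0] by simp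
      ultimately show ?thesis using tangent_scale[OF XT, of "- 1"] by (simp add: tnorm_def)
    qed
    ultimately show "tnorm g (\<gamma> (1 - t)) (velocity A (\<lambda>t. \<gamma> (1 - t)) t) = h (1 - t)"
      using hv[OF t'] by (simp add: X_def)
  qed (use S in auto)
  then show ?thesis unfolding curve_length_def by (simp add: integral_unique)
qed

text \<open>Reversing curves preserves their length. Symmetry is needed because balls measure the
  distance from \<open>xs\<close>, whereas the limits and the radial condition measure the distance
  to \<open>xs\<close>.\<close>

lemma rdist_commute: "rdist A g x y = rdist A g y x"
proof -
  have "{curve_length A g \<gamma> |\<gamma>. piecewise_C1_curve A \<gamma> \<and> \<gamma> 0 = x \<and> \<gamma> 1 = y}
      \<subseteq> {curve_length A g \<gamma> |\<gamma>. piecewise_C1_curve A \<gamma> \<and> \<gamma> 0 = y \<and> \<gamma> 1 = x}" for x y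
  proof clarify
    fix \<gamma> assume \<gamma>: "piecewise_C1_curve A \<gamma>"
    then show "\<exists>\<eta>. curve_length A g \<gamma> = curve_length A g \<eta> \<and> piecewise_C1_curve A \<eta> \<and> \<eta> 0 = \<gamma> 1 \<and> \<eta> 1 = \<gamma> 0"
      by (intro exI[of _ "\<lambda>t. \<gamma> (1 - t)"]) (simp add: curve_length_reverse piecewise_C1_reverse)
  qed
  then show ?thesis unfolding rdist_def by (metis (no_types, lifting) subset_antisym)
qed

lemma rdist_le:
  assumes "piecewise_C1_curve A \<gamma>" "\<gamma> 0 = x" "\<gamma> 1 = y"
  shows "rdist A g x y \<le> curve_length A g \<gamma>"
  unfolding rdist_def
  by (rule cInf_lower) (use assms curve_length_nonneg in \<open>auto intro!: bdd_belowI[of _ 0]\<close>)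

end

section \<open>Riemannian distance within the injectivity radius\<close>

lemma bform_zero: "bform (\<lambda>i j. 0) v w = 0"
  by (simp add: bform_def)

section \<open>Upper bound for the distance along radial geodesics\<close>

context exp_map
begin

lemma nrm_coercive:
  obtains l where "0 < l" "\<And>v. l * norm v \<le> nrm v"
proof -
  have "0 < bform (metric_in A g c0 (cmap c0 xs)) v v" if "v \<noteq> 0" for v
    using q_pos[OF that] by (simp add: q_bform)
  then obtain l where l: "0 < l" "\<And>v. l * (norm v)\<^sup>2 \<le> bform (metric_in A g c0 (cmap c0 xs)) v v"
    using bform_coercive by blast
  have "sqrt l * norm v \<le> nrm v" for v
  proof -
    have "sqrt l * norm v = sqrt (l * (norm v)\<^sup>2)" by (simp add: real_sqrt_mult)
    also have "\<dots> \<le> nrm v" unfolding nrm_def q_bform using l(2)[of v] by simp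
    finally show ?thesis .
  qed
  then show ?thesis using that[of "sqrt l"] l by simp
qed

lemma compact_nrm: "compact {v. nrm v \<le> r}"
proof -
  obtain l where l: "0 < l" "\<And>v. l * norm v \<le> nrm v" by (rule nrm_coercive) blast
  have "norm v \<le> r / l" if "nrm v \<le> r" for v
    using l(1) order_trans[OF l(2) that] by (simp add: field_simps)
  then have "bounded {v. nrm v \<le> r}" unfolding bounded_iff by blast
  moreover have "closed {v. nrm v \<le> r}" by (intro closed_Collect_le nrm_continuous continuous_on_const)
  ultimately show ?thesis by (simp add: compact_eq_bounded_closed)
qed

text \<open>The radial geodesic over unit time has constant speed \<open>nrm v\<close>. It bounds
  the distance from above and shows that the infimum defining it runs over a nonempty set.\<close>

lemma ray_curve:
  obtains \<gamma> where "piecewise_C1_curve A \<gamma>" "\<gamma> 0 = xs" "\<gamma> 1 = F v" "curve_length A g \<gamma> = nrm v"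
proof -
  obtain \<gamma> \<gamma>' where \<gamma>: "geodesic_vel \<gamma> \<gamma>'" "\<gamma> 0 = xs" "\<gamma>' 0 = V0 v" and F: "\<And>t. F (t *\<^sub>R v) = \<gamma> t"
    by (rule ray_geodesic[of v]) blast
  have vel: "has_velocity A UNIV \<gamma> t (\<gamma>' t)" for t using \<gamma>(1) by (simp add: geodesic_vel_def)
  have cont: "continuous_on {t \<in> {0..1}. \<gamma> t \<in> cdom c} (\<lambda>t. \<gamma>' t c)" if "c \<in> A" for c
    unfolding continuous_on_eq_continuous_within
  proof
    fix t assume "t \<in> {t \<in> {0..1}. \<gamma> t \<in> cdom c}"
    then have "isCont (\<lambda>t. \<gamma>' t c) t"
      using geodesic_vel_chart(2)[OF \<gamma>(1) that, of t] has_vector_derivative_continuous by blast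
    then show "continuous (at t within {t \<in> {0..1}. \<gamma> t \<in> cdom c}) (\<lambda>t. \<gamma>' t c)"
      by (rule continuous_at_imp_continuous_at_within)
  qed
  have "C1_curve_on A {0..1} \<gamma>"
    unfolding C1_curve_on_def
    by (intro exI[of _ \<gamma>'] conjI ballI cont has_velocity_subset[OF vel]) auto
  moreover have "continuous_on {0..1} \<gamma>"
    using geodesic_vel_continuous(1)[OF \<gamma>(1)] continuous_at_imp_continuous_on by blast
  ultimately have pc: "piecewise_C1_curve A \<gamma>"
    unfolding piecewise_C1_curve_def by (intro conjI exI[of _ "{0, 1}"]) auto
  have "velocity A \<gamma> t = \<gamma>' t" for t
    unfolding velocity_def using vel[of t] has_velocity_unique[of UNIV \<gamma> t] by (intro some_equality) auto
  then have "tnorm g (\<gamma> t) (velocity A \<gamma> t) = nrm v" for t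
    using geodesic_speed[OF \<gamma>(1), of t] \<gamma> by (simp add: tnorm_def nrm_def q_g)
  then have "curve_length A g \<gamma> = nrm v" by (simp add: curve_length_def)
  then show ?thesis using that[OF pc \<gamma>(2)] F[of 1] by simp
qed

lemma rdist_F_le: "rdist A g xs (F v) \<le> nrm v"
  by (rule ray_curve[of v]) (metis rdist_le)

end

section \<open>Distance and balls inside the exponential ball\<close>

context exp_ball
begin

abbreviation B :: "'m set" where "B \<equiv> rball A g xs R"

lemma Fi_chart_derivative:
  assumes "d \<in> A" "y \<in> cdom d" "y \<in> B"
  shows "((\<lambda>u. Fi (cinv d u)) has_derivative frechet_derivative (Fi \<circ> cinv d) (at (cmap d y))) (at (cmap d y))"
  using smooth_on_frechet[OF Fi_smooth[OF assms(1)], of "cmap d y"] assms by (simp add: comp_def)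

lemma Fi_continuous: "continuous_on B Fi"
  unfolding continuous_on_eq_continuous_within
proof
  fix y assume y: "y \<in> B"
  obtain d where d: "d \<in> A" "y \<in> cdom d" by (rule chart_at)
  let ?O = "cdom d \<inter> B"
  have "continuous_on ?O (\<lambda>z. (Fi \<circ> cinv d) (cmap d z))"
    by (rule continuous_on_compose2[OF smooth_on_continuous[OF Fi_smooth[OF d(1)]]
        continuous_on_subset[OF continuous_cmap[OF d(1)]]]) auto
  then have "continuous_on ?O Fi"
    by (rule continuous_on_eq) (auto simp: cinv_cmap[OF d(1)])
  then have "isCont Fi y"
    using open_B open_cdom[OF d(1)] d y by (simp add: continuous_on_eq_continuous_at open_Int)
  then show "continuous (at y within B) Fi" by (rule continuous_at_imp_continuous_at_within)
qed

text \<open>The curve is lifted to normal coordinates by \<open>Fi\<close>. Its velocity as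
  \<open>dF\<close> of the velocity of the lift is the form to which the Gauss lemma
  applies.\<close>

lemma curve_velocity:
  assumes vel: "has_velocity A UNIV \<gamma> t X" and t: "\<gamma> t \<in> B"
  obtains w' where "((\<lambda>s. Fi (\<gamma> s)) has_vector_derivative w') (at t)" "dF (Fi (\<gamma> t)) w' = X"
proof -
  obtain d where d: "d \<in> A" "\<gamma> t \<in> cdom d" by (rule chart_at)
  define w' where "w' = frechet_derivative (Fi \<circ> cinv d) (at (cmap d (\<gamma> t))) (X d)"
  have wN: "Fi (\<gamma> t) \<in> N" "F (Fi (\<gamma> t)) = \<gamma> t" using Fi_N[OF t] F_Fi[OF t] by auto
  have cX: "((\<lambda>s. cmap d (\<gamma> s)) has_vector_derivative X d) (at t)"
    by (rule has_velocity_chart[OF vel d])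
  have cont: "(\<gamma> \<longlongrightarrow> \<gamma> t) (at t)" using vel by (simp add: has_velocity_def continuous_at)
  have ev: "\<forall>\<^sub>F s in at t. \<gamma> s \<in> cdom d \<and> \<gamma> s \<in> B"
    using topological_tendstoD[OF cont open_cdom[OF d(1)] d(2)] topological_tendstoD[OF cont open_B t]
    by eventually_elim auto
  have "((\<lambda>s. Fi (cinv d (cmap d (\<gamma> s)))) has_derivative
      (\<lambda>h. frechet_derivative (Fi \<circ> cinv d) (at (cmap d (\<gamma> t))) (h *\<^sub>R X d))) (at t)"
    by (rule has_derivative_compose[OF cX[unfolded has_vector_derivative_def] Fi_chart_derivative[OF d t]])
  then have "((\<lambda>s. Fi (\<gamma> s)) has_derivative
      (\<lambda>h. frechet_derivative (Fi \<circ> cinv d) (at (cmap d (\<gamma> t))) (h *\<^sub>R X d))) (at t)"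
    by (rule has_derivative_transform_eventually)
      (use ev d in \<open>auto elim!: eventually_mono simp: cinv_cmap[OF d(1)]\<close>)
  moreover have "linear (frechet_derivative (Fi \<circ> cinv d) (at (cmap d (\<gamma> t))))"
    by (rule has_derivative_linear[OF Fi_chart_derivative[OF d t]])
  ultimately have 1: "((\<lambda>s. Fi (\<gamma> s)) has_vector_derivative w') (at t)"
    by (simp add: has_vector_derivative_def w'_def linear_cmul)
  have "((\<lambda>s. cmap d (F (Fi (\<gamma> s)))) has_derivative (\<lambda>h. D d (Fi (\<gamma> t)) (h *\<^sub>R w'))) (at t)"
    by (rule has_derivative_compose[OF 1[unfolded has_vector_derivative_def] F_derivative[OF d(1) wN(1)]])
      (use wN d in simp)
  then have "((\<lambda>s. cmap d (\<gamma> s)) has_derivative (\<lambda>h. D d (Fi (\<gamma> t)) (h *\<^sub>R w'))) (at t)"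
    by (rule has_derivative_transform_eventually) (use ev wN in \<open>auto elim!: eventually_mono simp: F_Fi\<close>)
  then have "((\<lambda>s. cmap d (\<gamma> s)) has_vector_derivative D d (Fi (\<gamma> t)) w') (at t)"
    using D_linear[OF d(1) wN(1)] wN d by (simp add: has_vector_derivative_def linear_cmul)
  then have "D d (Fi (\<gamma> t)) w' = X d" using cX vector_derivative_unique_at by blast
  then have "dF (Fi (\<gamma> t)) w' d = X d" using dF_chart[of d "Fi (\<gamma> t)" w'] d wN by simp
  moreover have "X \<in> tangent_space A (\<gamma> t)" using vel by (simp add: has_velocity_def)
  ultimately have "dF (Fi (\<gamma> t)) w' = X"
    using dF_tangent[OF wN(1), of w'] wN d by (intro tangent_eqI[of _ "\<gamma> t" _ d]) auto
  with 1 show ?thesis by (rule that)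
qed

text \<open>By the Gauss lemma \<open>dF w w\<close> has norm \<open>nrm w\<close> and its product
  with \<open>dF w u\<close> is \<open>q w u\<close>, so Cauchy-Schwarz applies: the radial part of
  a velocity is at most its length.\<close>

lemma radial_speed:
  assumes w: "w \<in> N"
  shows "\<bar>q w u\<bar> \<le> nrm w * tnorm g (F w) (dF w u)"
proof -
  have "tnorm g (F w) (dF w w) = nrm w" using Gauss_lemma[OF w, of w] by (simp add: tnorm_def nrm_def)
  then show ?thesis
    using Cauchy_Schwarz_g[OF dF_tangent[OF w, of w] dF_tangent[OF w, of u]] Gauss_lemma[OF w, of u] by simp
qed

text \<open>Up to the first exit from the ball of radius \<open>nrm v\<close>, the speed of the curve dominates the
  derivative of \<open>sqrt (e\<^sup>2 + \<bar>\<cdot>\<bar>\<^sup>2)\<close> of its normal coordinates, a smooth substitute for the norm.\<close>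

lemma curve_length_ge:
  assumes \<gamma>: "piecewise_C1_curve A \<gamma>" "\<gamma> 0 = xs" "\<gamma> 1 = F v" and v: "v \<in> N"
  shows "nrm v \<le> curve_length A g \<gamma>"
proof (cases "v = 0")
  case True
  then show ?thesis using curve_length_nonneg[OF \<gamma>(1)] by (simp add: nrm_0)
next
  case False
  define s where "s = nrm v"
  have s: "0 < s" "ereal s < R" using nrm_pos[OF False] v by (auto simp: s_def N_def)
  obtain S h where S: "finite S" and h: "\<And>t. 0 \<le> h t" "(h has_integral curve_length A g \<gamma>) {0..1}"
    and vel: "\<And>t. t \<in> {0<..<1} - S \<Longrightarrow> has_velocity A UNIV \<gamma> t (velocity A \<gamma> t)"
    and hv: "\<And>t. t \<in> {0<..<1} - S \<Longrightarrow> h t = tnorm g (\<gamma> t) (velocity A \<gamma> t)"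
    by (rule piecewise_C1_speed[OF \<gamma>(1)]) blast
  have cg: "continuous_on {0..1} \<gamma>" using \<gamma>(1) by (simp add: piecewise_C1_curve_def)
  define Ob where "Ob = {y \<in> B. nrm (Fi y) < s}"
  have Ob: "open Ob"
  proof -
    have "continuous_on B (\<lambda>y. nrm (Fi y))"
      by (rule continuous_on_compose2[OF nrm_continuous Fi_continuous]) auto
    from continuous_on_open_vimage[OF open_B, THEN iffD1, OF this, rule_format, OF open_lessThan[of s]]
    show ?thesis by (simp add: Ob_def Int_def vimage_def conj_commute)
  qed
  have sub: "{w. nrm w \<le> s} \<subseteq> N" using s by (auto simp: N_def intro: le_less_trans[of _ "ereal s"])
  \<comment> \<open>\<open>C\<close> is closed, being compact in a Hausdorff space. Hence the point
    where the curve first leaves \<open>Ob\<close> still lies in the exponential ball and has normal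
    coordinates.\<close>
  define C where "C = F ` {w. nrm w \<le> s}"
  have C: "closed C"
    unfolding C_def by (intro compact_imp_closed compact_continuous_image continuous_on_subset[OF F_continuous] compact_nrm sub)
  define M where "M = {t \<in> {0..1}. \<gamma> t \<notin> Ob}"
  define \<tau> where "\<tau> = Inf M"
  have "closed M"
  proof -
    have "M = {0..1} \<inter> \<gamma> -` (- Ob)" by (auto simp: M_def)
    then show ?thesis using continuous_closed_preimage[OF cg] Ob by auto
  qed
  have 1: "1 \<in> M" using \<gamma>(3) v by (auto simp: M_def Ob_def Fi_F s_def)
  have bdd: "bdd_below M" by (rule bdd_belowI[of _ 0]) (auto simp: M_def)
  have \<tau>M: "\<tau> \<in> M" unfolding \<tau>_def using closed_contains_Inf[OF _ bdd \<open>closed M\<close>] 1 by blast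
  have xsO: "xs \<in> Ob"
    using F_B[OF N_0] Fi_F[OF N_0] s by (simp add: Ob_def F_0 nrm_0)
  have \<tau>: "0 < \<tau>" "\<tau> \<le> 1"
    using \<tau>M xsO \<gamma>(2) by (auto simp: M_def order_le_less)
  have inO: "\<gamma> t \<in> Ob" if "0 \<le> t" "t < \<tau>" for t
    using cInf_lower[OF _ bdd, of t] that \<tau> by (force simp: M_def \<tau>_def)
  have "\<gamma> \<tau> \<in> C"
  proof (rule Lim_in_closed_set[OF C])
    show "(\<gamma> \<longlongrightarrow> \<gamma> \<tau>) (at \<tau> within {0..<\<tau>})"
      using cg \<tau> by (auto simp: continuous_on_def intro: tendsto_within_subset[of _ _ _ "{0..1}"])
    show "at \<tau> within {0..<\<tau>} \<noteq> bot" using \<tau> by (simp add: at_within_eq_bot_iff)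
    show "\<forall>\<^sub>F t in at \<tau> within {0..<\<tau>}. \<gamma> t \<in> C"
      unfolding eventually_at_filter
    proof (rule always_eventually, intro allI impI)
      fix t assume "t \<in> {0..<\<tau>}"
      then have "\<gamma> t \<in> Ob" using inO by auto
      then have "Fi (\<gamma> t) \<in> {w. nrm w \<le> s}" "F (Fi (\<gamma> t)) = \<gamma> t" by (auto simp: Ob_def F_Fi)
      then show "\<gamma> t \<in> C" unfolding C_def by (metis image_eqI)
    qed
  qed
  then obtain w\<tau> where w\<tau>: "\<gamma> \<tau> = F w\<tau>" "nrm w\<tau> \<le> s" by (auto simp: C_def)
  then have w\<tau>N: "w\<tau> \<in> N" using sub by auto
  have \<tau>B: "\<gamma> \<tau> \<in> B" using F_B[OF w\<tau>N] w\<tau> by simp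
  have end_s: "nrm (Fi (\<gamma> \<tau>)) = s"
    using \<tau>M \<tau>B w\<tau> Fi_F[OF w\<tau>N] by (auto simp: M_def Ob_def)
  have inB: "\<gamma> t \<in> B" if "t \<in> {0..\<tau>}" for t
    using inO[of t] \<tau>B that by (cases "t = \<tau>") (auto simp: Ob_def)
  have cw: "continuous_on {0..\<tau>} (\<lambda>t. Fi (\<gamma> t))"
    by (rule continuous_on_compose2[OF Fi_continuous continuous_on_subset[OF cg]]) (use inB \<tau> in auto)
  have bound: "sqrt (e\<^sup>2 + s\<^sup>2) - e \<le> curve_length A g \<gamma>" if e: "0 < e" for e
  proof -
    have halve: "(inverse a / 2) * (2 * b) = b / a" for a b :: real by (cases "a = 0") (auto simp: field_simps)
    define k where "k t = sqrt (e\<^sup>2 + q (Fi (\<gamma> t)) (Fi (\<gamma> t)))" for t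
    have pos: "0 < e\<^sup>2 + q w w" for w using e q_nonneg[of w] by (simp add: add_pos_nonneg)
    \<comment> \<open>At the exceptional times any number up to \<open>h t\<close> serves, so that
      the inequality holds everywhere although the derivative is known only off a finite
      set.\<close>
    have "\<exists>y. (t \<in> {0<..<\<tau>} - S \<longrightarrow> (k has_vector_derivative y) (at t)) \<and> y \<le> h t" for t
    proof (cases "t \<in> {0<..<\<tau>} - S")
      case True
      then have t: "t \<in> {0<..<1} - S" "\<gamma> t \<in> B" using \<tau> inB by auto
      define w where "w = Fi (\<gamma> t)"
      obtain w' where w': "((\<lambda>s. Fi (\<gamma> s)) has_vector_derivative w') (at t)" "dF w w' = velocity A \<gamma> t"
        using curve_velocity[OF vel[OF t(1)] t(2)] by (auto simp: w_def)
      have wN: "w \<in> N" "F w = \<gamma> t" using Fi_N[OF t(2)] F_Fi[OF t(2)] by (auto simp: w_def)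
      have "((\<lambda>s. q (Fi (\<gamma> s)) (Fi (\<gamma> s))) has_derivative
          (\<lambda>h. bform (\<lambda>i j. 0) w w + q (h *\<^sub>R w') w + q w (h *\<^sub>R w'))) (at t)"
        unfolding q_bform w_def using w'(1) by (intro has_derivative_bform) (auto simp: has_vector_derivative_def)
      then have dq: "((\<lambda>s. q (Fi (\<gamma> s)) (Fi (\<gamma> s))) has_real_derivative 2 * q w w') (at t)"
        by (rule has_derivative_imp_has_field_derivative)
          (use q_sym[of w' w] in \<open>simp add: q_bform bform_scale_left bform_scale_right bform_zero\<close>)
      have "((\<lambda>s. e\<^sup>2 + q (Fi (\<gamma> s)) (Fi (\<gamma> s))) has_real_derivative 2 * q w w') (at t)"
        using dq by (auto intro!: derivative_eq_intros)
      from DERIV_chain2[of sqrt "inverse (sqrt (e\<^sup>2 + q w w)) / 2" _ t, OF _ this] DERIV_real_sqrt[OF pos[of w]]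
      have "(k has_real_derivative (inverse (sqrt (e\<^sup>2 + q w w)) / 2) * (2 * q w w')) (at t)"
        unfolding w_def k_def[abs_def] by blast
      then have kd: "(k has_real_derivative q w w' / sqrt (e\<^sup>2 + q w w)) (at t)"
        by (rule DERIV_cong) (rule halve)
      have "q w w' \<le> nrm w * h t"
        using radial_speed[OF wN(1), of w'] w'(2) wN(2) hv[OF t(1)] by simp
      also have "\<dots> \<le> sqrt (e\<^sup>2 + q w w) * h t"
        unfolding nrm_def using h(1) by (intro mult_right_mono) auto
      finally have "q w w' / sqrt (e\<^sup>2 + q w w) \<le> h t"
        using pos[of w] by (simp add: divide_le_eq mult.commute)
      then show ?thesis using kd by (auto simp: has_real_derivative_iff_has_vector_derivative)
    qed (use h(1) in blast)
    then obtain k' where k': "\<And>t. t \<in> {0<..<\<tau>} - S \<Longrightarrow> (k has_vector_derivative k' t) (at t)" "\<And>t. k' t \<le> h t"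
      by metis
    have "continuous_on {0..\<tau>} k"
      unfolding k_def q_bform bform_def by (intro continuous_intros cw)
    with k'(1) have int: "(k' has_integral (k \<tau> - k 0)) {0..\<tau>}"
      using \<tau> by (intro fundamental_theorem_of_calculus_interior_strong[OF S]) auto
    have "h integrable_on {0..1}" using h(2) by blast
    then have hi: "h integrable_on {0..\<tau>}" using \<tau> by (auto intro: integrable_subinterval_real)
    have "k \<tau> - k 0 = integral {0..\<tau>} k'" using int by (simp add: integral_unique)
    also have "\<dots> \<le> integral {0..\<tau>} h"
      using k'(2) int hi by (intro integral_le) auto
    also have "\<dots> \<le> integral {0..1} h"
      using h \<tau> hi by (intro integral_subset_le) auto
    also have "\<dots> = curve_length A g \<gamma>" using h(2) by (simp add: integral_unique)
    finally have "k \<tau> - k 0 \<le> curve_length A g \<gamma>" .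
    moreover have "k 0 = e"
    proof -
      have "Fi xs = 0" using Fi_F[OF N_0] F_0 by simp
      moreover have "q 0 0 = 0" using nrm_sq[of 0] nrm_0 by simp
      ultimately show ?thesis using e by (simp add: k_def \<gamma>(2))
    qed
    moreover have "k \<tau> = sqrt (e\<^sup>2 + s\<^sup>2)"
      by (simp add: k_def nrm_sq[symmetric] end_s power2_eq_square)
    ultimately show ?thesis by simp
  qed
  have "s \<le> curve_length A g \<gamma>"
  proof (rule field_le_epsilon)
    fix e :: real assume e: "0 < e"
    have "s \<le> sqrt (e\<^sup>2 + s\<^sup>2)" using s by (intro real_le_rsqrt) simp
    then show "s \<le> curve_length A g \<gamma> + e" using bound[OF e] by linarith
  qed
  then show ?thesis by (simp add: s_def)
qed

lemma rdist_F:
  assumes v: "v \<in> N"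
  shows "rdist A g xs (F v) = nrm v"
proof (rule antisym[OF rdist_F_le])
  have "\<exists>\<gamma>. piecewise_C1_curve A \<gamma> \<and> \<gamma> 0 = xs \<and> \<gamma> 1 = F v"
    by (rule ray_curve[of v]) blast
  then show "nrm v \<le> rdist A g xs (F v)"
    unfolding rdist_def using curve_length_ge[OF _ _ _ v] by (intro cInf_greatest) auto
qed

lemma rdist_Fi: "y \<in> B \<Longrightarrow> rdist A g xs y = nrm (Fi y)"
  using rdist_F[OF Fi_N] F_Fi by metis

lemma rdist_continuous: "continuous_on B (rdist A g xs)"
proof -
  have "continuous_on B (\<lambda>y. nrm (Fi y))"
    by (rule continuous_on_compose2[OF nrm_continuous Fi_continuous]) auto
  then show ?thesis by (rule continuous_on_eq) (simp add: rdist_Fi)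
qed

lemma compact_cball: "ereal r < R \<Longrightarrow> compact {y. rdist A g xs y \<le> r}"
proof -
  assume r: "ereal r < R"
  have sub: "{w. nrm w \<le> r} \<subseteq> N" using r by (auto simp: N_def intro: le_less_trans[of _ "ereal r"])
  have "{y. rdist A g xs y \<le> r} = F ` {w. nrm w \<le> r}"
  proof (intro subset_antisym subsetI)
    fix y assume y: "y \<in> {y. rdist A g xs y \<le> r}"
    then have "ereal (rdist A g xs y) < R" using r by (auto intro: le_less_trans[of _ "ereal r"])
    then have "y \<in> B" by (simp add: rball_def)
    then show "y \<in> F ` {w. nrm w \<le> r}"
      using y rdist_Fi[of y] F_Fi[of y] by (intro image_eqI[of _ _ "Fi y"]) auto
  next
    fix y assume "y \<in> F ` {w. nrm w \<le> r}"
    then show "y \<in> {y. rdist A g xs y \<le> r}" using sub rdist_F by auto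
  qed
  then show ?thesis
    using compact_continuous_image[OF continuous_on_subset[OF F_continuous sub] compact_nrm] by simp
qed

lemma rdist_nonneg: "y \<in> B \<Longrightarrow> 0 \<le> rdist A g xs y"
  by (simp add: rdist_Fi nrm_nonneg)

lemma rdist_eq_0:
  assumes y: "y \<in> B"
  shows "rdist A g xs y = 0 \<longleftrightarrow> y = xs"
proof -
  have "rdist A g xs y = 0 \<longleftrightarrow> Fi y = 0"
    using nrm_pos[of "Fi y"] nrm_0 by (cases "Fi y = 0") (auto simp: rdist_Fi[OF y])
  also have "\<dots> \<longleftrightarrow> y = xs" using F_Fi[OF y] Fi_F[OF N_0] F_0 by metis
  finally show ?thesis .
qed

text \<open>In normal coordinates the squared distance is the quadratic form \<open>q\<close>, hence
  differentiable also at \<open>xs\<close>, where the distance itself is not.\<close>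

lemma rdist_sq_differentiable:
  assumes "d \<in> A" "y \<in> cdom d" "y \<in> B"
  shows "((\<lambda>x. (rdist A g x xs)\<^sup>2) \<circ> cinv d) differentiable (at (cmap d y))"
proof -
  let ?F = "frechet_derivative (Fi \<circ> cinv d) (at (cmap d y))"
  have "((\<lambda>u. bform (metric_in A g c0 (cmap c0 xs)) (Fi (cinv d u)) (Fi (cinv d u))) has_derivative
    (\<lambda>h. bform (\<lambda>i j. 0) (Fi (cinv d (cmap d y))) (Fi (cinv d (cmap d y)))
      + bform (metric_in A g c0 (cmap c0 xs)) (?F h) (Fi (cinv d (cmap d y)))
      + bform (metric_in A g c0 (cmap c0 xs)) (Fi (cinv d (cmap d y))) (?F h))) (at (cmap d y))"
    by (rule has_derivative_bform[OF _ Fi_chart_derivative[OF assms] Fi_chart_derivative[OF assms]]) auto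
  then have "((\<lambda>x. (rdist A g x xs)\<^sup>2) \<circ> cinv d has_derivative
    (\<lambda>h. bform (\<lambda>i j. 0) (Fi (cinv d (cmap d y))) (Fi (cinv d (cmap d y)))
      + bform (metric_in A g c0 (cmap c0 xs)) (?F h) (Fi (cinv d (cmap d y)))
      + bform (metric_in A g c0 (cmap c0 xs)) (Fi (cinv d (cmap d y))) (?F h))) (at (cmap d y))"
  proof (rule has_derivative_transform_within_open[OF _ open_cmap_image[OF assms(1) open_B]])
    fix u assume "u \<in> cmap d ` (cdom d \<inter> B)"
    then have "cinv d u \<in> B" using cinv_cmap[OF assms(1)] by auto
    then show "bform (metric_in A g c0 (cmap c0 xs)) (Fi (cinv d u)) (Fi (cinv d u)) = ((\<lambda>x. (rdist A g x xs)\<^sup>2) \<circ> cinv d) u"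
      by (simp add: rdist_commute[of _ xs] rdist_Fi power2_eq_square nrm_sq q_bform)
  qed (use assms in auto)
  then show ?thesis by (auto simp: differentiable_def)
qed

text \<open>Links the topology of the manifold with the distance at \<open>xs\<close>: small
  \<open>nrm\<close> forces small normal coordinates by coercivity, and \<open>F\<close> is
  continuous at 0.\<close>

lemma rball_basis:
  assumes "open Ob" "xs \<in> Ob"
  obtains e where "0 < e" "rball A g xs (ereal e) \<subseteq> Ob"
proof -
  have "open (F -` Ob \<inter> N)" using continuous_on_open_vimage[OF open_N] F_continuous assms(1) by blast
  moreover have "0 \<in> F -` Ob \<inter> N" using N_0 assms(2) by (simp add: F_0)
  ultimately obtain d where d: "0 < d" "ball 0 d \<subseteq> F -` Ob \<inter> N" by (metis open_contains_ball)
  obtain l where l: "0 < l" "\<And>v. l * norm v \<le> nrm v" by (rule nrm_coercive) blast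
  obtain r where r: "0 < r" "ereal r < R" using ereal_dense2[OF R] by (auto simp: zero_ereal_def)
  define e where "e = min r (l * d)"
  have "rball A g xs (ereal e) \<subseteq> Ob"
  proof
    fix y assume "y \<in> rball A g xs (ereal e)"
    then have y: "rdist A g xs y < r" "rdist A g xs y < l * d" by (auto simp: rball_def e_def)
    then have "ereal (rdist A g xs y) < R" using r by (metis ereal_less_eq(3) le_less_trans less_imp_le)
    then have yB: "y \<in> B" by (simp add: rball_def)
    then have "l * norm (Fi y) < l * d" using y(2) l(2)[of "Fi y"] by (simp add: rdist_Fi)
    then have "Fi y \<in> ball 0 d" using l(1) by simp
    then show "y \<in> Ob" using d F_Fi[OF yB] by auto
  qed
  then show ?thesis using that[of e] r l d by (simp add: e_def)
qed

end

context exp_map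
begin

lemma exp_ballI: "0 < R \<Longrightarrow> exp_diffeo A g xs R \<Longrightarrow> exp_ball A g xs c0 R"
  by unfold_locales

text \<open>If the injectivity radius were a number \<open>i \<le> r\<close>, then by completeness a unit speed geodesic
  would reach a point at distance exactly \<open>i\<close>, which lies in the larger ball but not in the smaller.\<close>

lemma radius_below_injectivity:
  assumes sub: "rball A g xs (ereal r1) \<subseteq> rball A g xs (inj_radius A g xs)"
    and xs: "xs \<in> rball A g xs (inj_radius A g xs)" and r: "r < r1"
  obtains R where "0 < R" "ereal r < R" "exp_diffeo A g xs R"
proof (rule ccontr)
  assume no: "\<not> thesis"
  let ?I = "inj_radius A g xs"
  have below: "\<exists>R. 0 < R \<and> exp_diffeo A g xs R \<and> x < R" if "x < ?I" for x
    using that unfolding inj_radius_def less_Sup_iff by auto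
  have I_le: "?I \<le> ereal r" using no that below by (metis leI)
  have I_pos: "0 < ?I"
  proof -
    obtain R where "0 < R" "exp_diffeo A g xs R" using below[of "ereal (rdist A g xs xs)"] xs by (auto simp: rball_def)
    then have "R \<le> ?I" unfolding inj_radius_def by (intro Sup_upper) auto
    with \<open>0 < R\<close> show ?thesis by simp
  qed
  obtain i where i: "?I = ereal i" "0 < i" "i \<le> r"
    using I_le I_pos by (cases ?I) (auto simp: zero_ereal_def)
  \<comment> \<open>The model space has dimension at least 1, so that a direction of unit length
    exists.\<close>
  obtain b :: 'e where b: "b \<in> Basis" by (meson ex_in_conv nonempty_Basis)
  then have "b \<noteq> 0" by auto
  define v where "v = (1 / nrm b) *\<^sub>R b"
  have v: "nrm v = 1" using nrm_pos[OF \<open>b \<noteq> 0\<close>] by (simp add: v_def nrm_scale)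
  have tv: "nrm (t *\<^sub>R v) = t" if "0 \<le> t" for t using that v by (simp add: nrm_scale)
  have dist_tv: "rdist A g xs (F (t *\<^sub>R v)) = t" if t: "0 \<le> t" "t < i" for t
  proof -
    obtain R where R: "0 < R" "exp_diffeo A g xs R" "ereal t < R" using below[of "ereal t"] t i by auto
    interpret E: exp_ball A g xs c0 R by (rule exp_ballI) fact+
    show ?thesis using E.rdist_F[of "t *\<^sub>R v"] R(3) t by (simp add: E.N_def tv)
  qed
  let ?y = "F (i *\<^sub>R v)"
  have "rdist A g xs ?y \<le> i" using rdist_F_le[of "i *\<^sub>R v"] i by (simp add: tv)
  then have "?y \<in> rball A g xs (ereal r1)" using i r by (simp add: rball_def)
  \<comment> \<open>A distance below \<open>i\<close> places \<open>?y\<close> in an exponential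
    ball, on which the distance is continuous; this is what permits the passage to the limit along
    the geodesic.\<close>
  then have y: "ereal (rdist A g xs ?y) < ereal i" using sub i by (auto simp: rball_def)
  then obtain R where R: "0 < R" "exp_diffeo A g xs R" "ereal (rdist A g xs ?y) < R" using below i by metis
  interpret E: exp_ball A g xs c0 R by (rule exp_ballI) fact+
  have yB: "?y \<in> E.B" using R(3) by (simp add: rball_def)
  obtain \<gamma> \<gamma>' where \<gamma>: "geodesic_vel \<gamma> \<gamma>'" and F: "\<And>t. F (t *\<^sub>R v) = \<gamma> t"
    by (rule ray_geodesic[of v]) blast
  have "(\<gamma> \<longlongrightarrow> \<gamma> i) (at_left i)"
    using geodesic_vel_continuous(1)[OF \<gamma>, of i] unfolding continuous_at by (rule tendsto_within_subset) simp
  moreover have "isCont (rdist A g xs) (\<gamma> i)"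
    using E.rdist_continuous E.open_B yB F[of i] by (simp add: continuous_on_eq_continuous_at)
  ultimately have "((\<lambda>t. rdist A g xs (\<gamma> t)) \<longlongrightarrow> rdist A g xs (\<gamma> i)) (at_left i)"
    by (rule isCont_tendsto_compose[rotated])
  moreover have "\<forall>\<^sub>F t in at_left i. rdist A g xs (\<gamma> t) = t"
    using eventually_at_left_real[OF i(2)]
  proof eventually_elim
    case (elim t)
    then show ?case using dist_tv[of t] by (simp add: F)
  qed
  ultimately have "((\<lambda>t. t) \<longlongrightarrow> rdist A g xs (\<gamma> i)) (at_left i)"
    using tendsto_cong[of "\<lambda>t. rdist A g xs (\<gamma> t)" "\<lambda>t. t" "at_left i"] by blast
  moreover have "((\<lambda>t. t) \<longlongrightarrow> i) (at_left i)" by (rule tendsto_ident_at)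
  ultimately have "rdist A g xs (\<gamma> i) = i" using tendsto_unique[OF trivial_limit_at_left_real] by blast
  then show False using y F[of i] by simp
qed

end

section \<open>Lyapunov stability\<close>

locale lyapunov = exp_map A g xs c0
  for A :: "('m::{t2_space,second_countable_topology}, 'e::euclidean_space) chart set"
    and g :: "('m, 'e) metric" and xs :: 'm and c0 :: "('m, 'e) chart" +
  fixes Dom :: "'m set" and f :: "real \<Rightarrow> 'm \<Rightarrow> ('m, 'e) tvec" and V :: "real \<Rightarrow> 'm \<Rightarrow> real"
    and W1 W2 W3 :: "'m \<Rightarrow> real" and r0 :: ereal
  assumes domain: "open Dom" "xs \<in> Dom" "Dom \<subseteq> rball A g xs (inj_radius A g xs)"
    and field: "vector_field_on A Dom f" "continuous_in_time A Dom f" "locally_lipschitz_in_state A Dom f"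
    and r0: "r0 = (SUP r\<in>{r::real. 0 < r \<and> rball A g xs (ereal r) \<subseteq> Dom}. ereal r)"
    and V: "C1_time_state A Dom V"
    and W: "continuous_on Dom W1" "continuous_on Dom W2" "continuous_on Dom W3"
      "pos_def_on Dom xs W1" "pos_def_on Dom xs W2" "pos_def_on Dom xs W3"
    and V_bounds: "\<And>t x. t \<ge> 0 \<Longrightarrow> x \<in> Dom \<Longrightarrow> W1 x \<le> V t x \<and> V t x \<le> W2 x"
    and V_decrease: "\<And>t x. t \<ge> 0 \<Longrightarrow> x \<in> Dom \<Longrightarrow> time_deriv V t x + mdiff A (V t) x (f t x) \<le> - W3 x"
begin

abbreviation \<rho> :: "'m \<Rightarrow> real" where "\<rho> \<equiv> rdist A g xs"
abbreviation Ball0 :: "'m set" where "Ball0 \<equiv> rball A g xs r0"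
abbreviation Vdot :: "real \<Rightarrow> 'm \<Rightarrow> real" where "Vdot t x \<equiv> time_deriv V t x + mdiff A (V t) x (f t x)"

section \<open>Balls contained in the domain\<close>

text \<open>A ball of radius slightly above \<open>r\<close> still lies in \<open>Dom\<close>, hence
  in the ball of injectivity radius, and this yields an exponential ball of radius above
  \<open>r\<close>. Facts on balls are drawn from such exponential balls one radius at a time, so
  that nothing is asked at \<open>r0\<close> itself.\<close>

lemma radius:
  assumes "ereal r < r0"
  obtains r1 R where "r < r1" "rball A g xs (ereal r1) \<subseteq> Dom" "exp_ball A g xs c0 R" "ereal r < R"
proof -
  obtain r1 where r1: "r < r1" "rball A g xs (ereal r1) \<subseteq> Dom"
    using assms unfolding r0 less_SUP_iff by auto
  obtain R where "0 < R" "ereal r < R" "exp_diffeo A g xs R"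
    by (rule radius_below_injectivity[of r1 r]) (use r1 domain in auto)
  then show ?thesis using that[OF r1 exp_ballI] by blast
qed

lemma rball_basis_xs:
  assumes "open G" "xs \<in> G"
  obtains e where "0 < e" "rball A g xs (ereal e) \<subseteq> G"
proof -
  have "ereal (\<rho> xs) < inj_radius A g xs" using domain by (auto simp: rball_def)
  then obtain R where R: "0 < R" "exp_diffeo A g xs R" unfolding inj_radius_def less_Sup_iff by auto
  interpret E: exp_ball A g xs c0 R by (rule exp_ballI) fact+
  show ?thesis using E.rball_basis[OF assms] that by blast
qed

lemma r0_pos: "0 < r0"
proof -
  obtain e where "0 < e" "rball A g xs (ereal e) \<subseteq> Dom" using rball_basis_xs[OF domain(1,2)] .
  then have "ereal e \<le> r0" unfolding r0 by (intro SUP_upper) auto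
  then show ?thesis using \<open>0 < e\<close> by (metis ereal_less(2) less_le_trans)
qed

lemma rho_xs: "\<rho> xs = 0"
proof -
  obtain R where "exp_ball A g xs c0 R" using radius[of 0] r0_pos by (auto simp: zero_ereal_def)
  then interpret E: exp_ball A g xs c0 R .
  show ?thesis using E.rdist_F[OF E.N_0] by (simp add: F_0 nrm_0)
qed

lemma ball_sub: "Ball0 \<subseteq> Dom"
proof
  fix x assume "x \<in> Ball0"
  then have "ereal (\<rho> x) < r0" by (simp add: rball_def)
  then obtain r1 where "\<rho> x < r1" "rball A g xs (ereal r1) \<subseteq> Dom" by (rule radius) blast
  then show "x \<in> Dom" by (auto simp: rball_def)
qed

lemma cball_sub: "ereal r < r0 \<Longrightarrow> {x. \<rho> x \<le> r} \<subseteq> Ball0"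
  by (auto simp: rball_def intro: le_less_trans[of _ "ereal r"])

lemma cball_compact: "ereal r < r0 \<Longrightarrow> compact {x. \<rho> x \<le> r}"
  by (erule radius) (rule exp_ball.compact_cball)

text \<open>The distance is known to be continuous on an exponential ball, so openness is obtained
  relative to that open set.\<close>

lemma ball_open: "ereal r < r0 \<Longrightarrow> open {x. \<rho> x < r}"
proof (erule radius)
  fix R assume "exp_ball A g xs c0 R" and r: "ereal r < R"
  then interpret E: exp_ball A g xs c0 R by simp
  have "{x. \<rho> x < r} = \<rho> -` {..<r} \<inter> E.B"
    using r by (auto simp: rball_def intro: less_trans[of _ "ereal r"])
  moreover have "open (\<rho> -` {..<r} \<inter> E.B)"
    by (rule continuous_on_open_vimage[OF E.open_B, THEN iffD1, OF E.rdist_continuous, rule_format, OF open_lessThan])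
  ultimately show "open {x. \<rho> x < r}" by simp
qed

lemma rho_ball:
  assumes "ereal (\<rho> x) < r0"
  shows "0 \<le> \<rho> x" "\<rho> x = 0 \<longleftrightarrow> x = xs"
proof -
  obtain R where "exp_ball A g xs c0 R" and r: "ereal (\<rho> x) < R" using radius[OF assms] by blast
  then interpret E: exp_ball A g xs c0 R by simp
  have "x \<in> E.B" using r by (simp add: rball_def)
  then show "0 \<le> \<rho> x" "\<rho> x = 0 \<longleftrightarrow> x = xs" using E.rdist_nonneg E.rdist_eq_0 by auto
qed

lemma rho_continuous: "continuous_on (Ball0) \<rho>"
proof (rule continuous_at_imp_continuous_on, rule ballI)
  fix x assume "x \<in> Ball0"
  then have "ereal (\<rho> x) < r0" by (simp add: rball_def)
  then obtain R where "exp_ball A g xs c0 R" and r: "ereal (\<rho> x) < R" using radius by blast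
  then interpret E: exp_ball A g xs c0 R by simp
  have "x \<in> E.B" using r by (simp add: rball_def)
  then show "isCont \<rho> x" using E.rdist_continuous E.open_B by (simp add: continuous_on_eq_continuous_at)
qed

text \<open>The annulus is compact and misses \<open>xs\<close>, so a function that is positive off
  \<open>xs\<close> attains a positive minimum on it.\<close>

lemma annulus_lower_bound:
  fixes U :: "'m \<Rightarrow> real"
  assumes r: "ereal r < r0" and e: "0 < e"
    and U: "continuous_on (Ball0) U" "\<And>x. x \<in> Ball0 \<Longrightarrow> x \<noteq> xs \<Longrightarrow> 0 < U x"
  shows "\<exists>d>0. \<forall>x. e \<le> \<rho> x \<longrightarrow> \<rho> x \<le> r \<longrightarrow> d \<le> U x"
proof (cases "e \<le> r")
  case False
  then show ?thesis by (intro exI[of _ 1]) auto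
next
  case True
  then have "ereal e < r0" using r by (metis ereal_less_eq(3) le_less_trans)
  then have K: "compact ({x. \<rho> x \<le> r} - {x. \<rho> x < e})"
    by (intro compact_diff cball_compact r ball_open)
  show ?thesis
  proof (cases "{x. \<rho> x \<le> r} - {x. \<rho> x < e} = {}")
    case True
    then show ?thesis by (intro exI[of _ 1]) auto
  next
    case False
    have "continuous_on ({x. \<rho> x \<le> r} - {x. \<rho> x < e}) U"
      by (rule continuous_on_subset[OF U(1)]) (use cball_sub[OF r] in auto)
    from continuous_attains_inf[OF K False this]
    obtain z where z: "\<rho> z \<le> r" "e \<le> \<rho> z" "\<And>x. \<rho> x \<le> r \<Longrightarrow> e \<le> \<rho> x \<Longrightarrow> U z \<le> U x" by force
    have zr: "z \<in> Ball0" using z cball_sub[OF r] by auto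
    then have "z \<noteq> xs" using rho_ball(2)[of z] z e by (auto simp: rball_def)
    then show ?thesis using U(2)[OF zr] z by blast
  qed
qed

lemma cball_bounded:
  fixes U :: "'m \<Rightarrow> real"
  assumes r: "ereal r < r0" and U: "continuous_on (Ball0) U"
  shows "\<exists>b::real. \<forall>x. \<rho> x \<le> r \<longrightarrow> U x \<le> b"
proof -
  have "compact (U ` {x. \<rho> x \<le> r})"
    by (intro compact_continuous_image cball_compact r continuous_on_subset[OF U] cball_sub)
  then have "bdd_above (U ` {x. \<rho> x \<le> r})" by (simp add: bounded_imp_bdd_above compact_imp_bounded)
  then show ?thesis unfolding bdd_above_def by auto
qed

text \<open>The contrapositive of continuity at \<open>xs\<close>, with open sets exchanged for
  metric balls by \<open>rball_basis_xs\<close>.\<close>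

lemma small_near_xs:
  fixes U :: "'m \<Rightarrow> real"
  assumes e: "0 < e" and U: "continuous_on (Ball0) U" "U xs = 0"
  shows "\<exists>d>0. \<forall>x\<in>Ball0. e \<le> U x \<longrightarrow> d \<le> \<rho> x"
proof -
  obtain r where r: "0 < r" "ereal r < r0" using ereal_dense2[OF r0_pos] by (auto simp: zero_ereal_def)
  have xsr: "xs \<in> {x. \<rho> x < r}" using rho_xs r by simp
  have cU: "continuous_on {x. \<rho> x < r} U"
    by (rule continuous_on_subset[OF U(1)]) (use cball_sub[OF r(2)] in auto)
  have "open (U -` {..<e} \<inter> {x. \<rho> x < r})"
    by (rule continuous_on_open_vimage[OF ball_open[OF r(2)], THEN iffD1, OF cU, rule_format, OF open_lessThan])
  moreover have "xs \<in> U -` {..<e} \<inter> {x. \<rho> x < r}" using xsr U e by auto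
  ultimately obtain d where d: "0 < d" "rball A g xs (ereal d) \<subseteq> U -` {..<e} \<inter> {x. \<rho> x < r}"
    using rball_basis_xs by blast
  have "d \<le> \<rho> x" if "e \<le> U x" for x
  proof (rule ccontr)
    assume "\<not> d \<le> \<rho> x"
    then have "x \<in> rball A g xs (ereal d)" by (simp add: rball_def)
    then show False using d(2) that by auto
  qed
  then show ?thesis using d(1) by blast
qed

lemma W_ball:
  "continuous_on (Ball0) W1" "continuous_on (Ball0) W2" "continuous_on (Ball0) W3"
  "W1 xs = 0" "W2 xs = 0" "W3 xs = 0"
  "\<And>x. x \<in> Dom \<Longrightarrow> x \<noteq> xs \<Longrightarrow> 0 < W1 x" "\<And>x. x \<in> Dom \<Longrightarrow> x \<noteq> xs \<Longrightarrow> 0 < W2 x" "\<And>x. x \<in> Dom \<Longrightarrow> x \<noteq> xs \<Longrightarrow> 0 < W3 x"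
  "\<And>x. x \<in> Dom \<Longrightarrow> 0 \<le> W1 x" "\<And>x. x \<in> Dom \<Longrightarrow> 0 \<le> W2 x" "\<And>x. x \<in> Dom \<Longrightarrow> 0 \<le> W3 x"
proof -
  show "continuous_on (Ball0) W1" "continuous_on (Ball0) W2" "continuous_on (Ball0) W3"
    by (rule continuous_on_subset[OF _ ball_sub], rule W)+
  show "W1 xs = 0" "W2 xs = 0" "W3 xs = 0" using W by (auto simp: pos_def_on_def)
  show "0 < W1 x" "0 < W2 x" "0 < W3 x" if "x \<in> Dom" "x \<noteq> xs" for x
    using W that by (auto simp: pos_def_on_def)
  show "0 \<le> W1 x" "0 \<le> W2 x" "0 \<le> W3 x" if "x \<in> Dom" for x
    using W that by (cases "x = xs"; force simp: pos_def_on_def less_imp_le)+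
qed

lemma W1_le_W2: "x \<in> Dom \<Longrightarrow> W1 x \<le> W2 x"
  using V_bounds[of 0 x] by linarith

section \<open>Derivatives along solutions and confinement\<close>

lemma some_chart:
  "(SOME c. c \<in> A \<and> x \<in> cdom c) \<in> A" "x \<in> cdom (SOME c. c \<in> A \<and> x \<in> cdom c)"
proof -
  obtain c where "c \<in> A \<and> x \<in> cdom c" using chart_at[of x] by metis
  then have "(SOME c. c \<in> A \<and> x \<in> cdom c) \<in> A \<and> x \<in> cdom (SOME c. c \<in> A \<and> x \<in> cdom c)"
    by (rule someI)
  then show "(SOME c. c \<in> A \<and> x \<in> cdom c) \<in> A" "x \<in> cdom (SOME c. c \<in> A \<and> x \<in> cdom c)"
    by (rule conjunct1, rule conjunct2)
qed

lemma mdiff_along: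
  assumes vel: "has_velocity A J x t X" and t: "t \<in> J"
    and h: "\<And>c. c \<in> A \<Longrightarrow> x t \<in> cdom c \<Longrightarrow> (h \<circ> cinv c) differentiable (at (cmap c (x t)))"
  shows "((\<lambda>s. h (x s)) has_real_derivative mdiff A h (x t) X) (at t within J)"
proof -
  define c where "c = (SOME c. c \<in> A \<and> x t \<in> cdom c)"
  have c: "c \<in> A" "x t \<in> cdom c"
    unfolding c_def by (rule some_chart)+
  let ?D = "frechet_derivative (h \<circ> cinv c) (at (cmap c (x t)))"
  have dh: "((h \<circ> cinv c) has_derivative ?D) (at (cmap c (x t)))"
    using h[OF c] frechet_derivative_works by blast
  have ev: "\<forall>\<^sub>F s in at t within J. x s \<in> cdom c"
    using vel open_cdom[OF c(1)] c(2) by (auto simp: has_velocity_def continuous_within intro: topological_tendstoD)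
  have "((\<lambda>s. (h \<circ> cinv c) (cmap c (x s))) has_derivative (\<lambda>k. ?D (k *\<^sub>R X c))) (at t within J)"
    by (rule has_derivative_compose[OF has_velocity_chart[OF vel c, unfolded has_vector_derivative_def] dh])
  then have "((\<lambda>s. h (x s)) has_derivative (\<lambda>k. ?D (k *\<^sub>R X c))) (at t within J)"
    by (rule has_derivative_transform_eventually)
      (use ev c t in \<open>auto elim!: eventually_mono simp: cinv_cmap[OF c(1)]\<close>)
  then show ?thesis
    by (rule has_derivative_imp_has_field_derivative)
      (simp add: mdiff_def c_def[symmetric] linear_cmul[OF has_derivative_linear[OF dh]])
qed

text \<open>The derivative of \<open>V\<close> in time and state jointly is linear, so along the
  curve it splits into \<open>time_deriv\<close> and \<open>mdiff\<close>. Differentiability is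
  relative to \<open>{0..}\<close> in time, hence the condition on \<open>J\<close>.\<close>

lemma V_along:
  assumes x: "solution_on A Dom f J x" and t: "t \<in> J" and J: "J \<subseteq> {0..}"
  shows "((\<lambda>s. V s (x s)) has_real_derivative Vdot t (x t)) (at t within J)"
proof -
  define c where "c = (SOME c. c \<in> A \<and> x t \<in> cdom c)"
  have c: "c \<in> A" "x t \<in> cdom c"
    unfolding c_def by (rule some_chart)+
  have vel: "has_velocity A J x t (f t (x t))" and xD: "x t \<in> Dom" using x t by (auto simp: solution_on_def)
  define U where "U = cmap c ` (cdom c \<inter> Dom)"
  define u where "u = cmap c (x t)"
  define G where "G = (\<lambda>(s, v). V s (cinv c v))"
  have U: "open U" "u \<in> U" using open_cmap_image[OF c(1) domain(1)] c xD by (auto simp: U_def u_def)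
  have tpos: "0 \<le> t" using t J by auto
  obtain V' :: "real \<times> 'e \<Rightarrow> (real \<times> 'e) \<Rightarrow>\<^sub>L real"
    where V': "\<And>p. p \<in> {0..} \<times> U \<Longrightarrow> (G has_derivative blinfun_apply (V' p)) (at p within {0..} \<times> U)"
    using V c(1) unfolding C1_time_state_def Let_def U_def G_def by blast
  define L where "L = blinfun_apply (V' (t, u))"
  have dG: "(G has_derivative L) (at (t, u) within {0..} \<times> U)"
    unfolding L_def using V'[of "(t, u)"] U tpos by auto
  have L: "linear L" by (rule has_derivative_linear[OF dG])
  have Lsplit: "L (k, k *\<^sub>R v) = k * (L (1, 0) + L (0, v))" for k v
  proof -
    have "(k, k *\<^sub>R v) = k *\<^sub>R ((1, 0) + (0, v))" by simp
    then show ?thesis using linear_cmul[OF L] linear_add[OF L] by (metis real_scaleR_def)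
  qed
  have xu: "cinv c u = x t" by (simp add: u_def cinv_cmap c)
  have td: "time_deriv V t (x t) = L (1, 0)"
  proof -
    have "((\<lambda>s. G (s, u)) has_derivative (\<lambda>k. L (k, 0))) (at t within {0..})"
    proof (rule has_derivative_in_compose[where f = "\<lambda>s. (s, u)" and f' = "\<lambda>k. (k, 0)" and g = G and g' = L])
      show "((\<lambda>s. (s, u)) has_derivative (\<lambda>k. (k, 0))) (at t within {0..})"
        by (intro has_derivative_Pair has_derivative_ident has_derivative_const)
      show "(G has_derivative L) (at (t, u) within (\<lambda>s. (s, u)) ` {0..})"
        by (rule has_derivative_subset[OF dG]) (use U in auto)
    qed
    moreover have "(\<lambda>k. L (k, 0)) = (\<lambda>k. k *\<^sub>R L (1, 0))"
    proof
      fix k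
      have "L (k, 0) = L (k *\<^sub>R (1, 0))" by simp
      also have "\<dots> = k *\<^sub>R L (1, 0)" by (rule linear_cmul[OF L])
      finally show "L (k, 0) = k *\<^sub>R L (1, 0)" .
    qed
    ultimately have "((\<lambda>s. V s (x t)) has_vector_derivative L (1, 0)) (at t within {0..})"
      by (simp only: has_vector_derivative_def G_def split_conv xu)
    \<comment> \<open>A nontrivial filter makes the derivative named by \<open>time_deriv\<close>
      unique; at \<open>t = 0\<close> this rests on later times alone.\<close>
    moreover have "at t within {0..} \<noteq> bot"
    proof -
      have "at t within {t<..} \<noteq> bot" by (rule trivial_limit_at_right_real)
      moreover have "at t within {t<..} \<le> at t within {0..}" using tpos by (intro at_le) auto
      ultimately show ?thesis using bot.extremum_unique by metis
    qed
    ultimately show ?thesis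
      unfolding time_deriv_def using vector_derivative_within by blast
  qed
  have md: "mdiff A (V t) (x t) X = L (0, X c)" for X
  proof -
    have "((\<lambda>v. G (t, v)) has_derivative (\<lambda>k. L (0, k))) (at u within U)"
    proof (rule has_derivative_in_compose[where f = "\<lambda>v. (t, v)" and f' = "\<lambda>k. (0, k)" and g = G and g' = L])
      show "((\<lambda>v. (t, v)) has_derivative (\<lambda>k. (0, k))) (at u within U)"
        by (intro has_derivative_Pair has_derivative_ident has_derivative_const)
      show "(G has_derivative L) (at (t, u) within (\<lambda>v. (t, v)) ` U)"
        by (rule has_derivative_subset[OF dG]) (use tpos in auto)
    qed
    then have "((V t \<circ> cinv c) has_derivative (\<lambda>k. L (0, k))) (at u)"
      using at_within_open[OF U(2,1)] by (simp add: G_def comp_def)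
    from frechet_derivative_at[OF this] show ?thesis
      by (simp add: mdiff_def c_def[symmetric] u_def[symmetric] Let_def) metis
  qed
  \<comment> \<open>Restricting to the times spent in the chart leaves the filter at
    \<open>t\<close> unchanged and keeps the image where \<open>G\<close> is differentiable.\<close>
  let ?J = "{s \<in> J. x s \<in> cdom c}"
  have cx: "continuous_on J x" by (rule solution_on_continuous[OF x])
  then obtain T where T: "open T" "T \<inter> J = x -` cdom c \<inter> J"
    using open_cdom[OF c(1)] unfolding continuous_on_open_invariant by metis
  have atJ: "at t within J = at t within ?J"
    by (rule at_within_nhd[of t T]) (use T t c in auto)
  have dx: "((\<lambda>s. (s, cmap c (x s))) has_derivative (\<lambda>k. (k, k *\<^sub>R f t (x t) c))) (at t within ?J)"
    using has_velocity_chart[OF vel c] unfolding atJ has_vector_derivative_def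
    by (intro has_derivative_Pair has_derivative_ident)
  have "((\<lambda>s. G (s, cmap c (x s))) has_derivative (\<lambda>k. L (k, k *\<^sub>R f t (x t) c))) (at t within ?J)"
  proof (rule has_derivative_in_compose[OF dx, of G L])
    have "(\<lambda>s. (s, cmap c (x s))) ` ?J \<subseteq> {0..} \<times> U"
      using J x by (auto simp: U_def solution_on_def)
    then show "(G has_derivative L) (at (t, cmap c (x t)) within (\<lambda>s. (s, cmap c (x s))) ` ?J)"
      using dG unfolding u_def[symmetric] by (rule has_derivative_subset[rotated])
  qed
  then have "((\<lambda>s. V s (x s)) has_derivative (\<lambda>k. L (k, k *\<^sub>R f t (x t) c))) (at t within ?J)"
    by (rule has_derivative_transform[rotated 2]) (use t c in \<open>auto simp: G_def cinv_cmap[OF c(1)]\<close>)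
  then show ?thesis
    unfolding atJ by (rule has_derivative_imp_has_field_derivative) (simp add: Lsplit td md)
qed

lemma V_antimono:
  assumes x: "solution_on A Dom f {t0..T} x" and t0: "0 \<le> t0" and st: "t0 \<le> s" "s \<le> t" "t \<le> T"
  shows "V t (x t) \<le> V s (x s)"
proof -
  have "V t (x t) \<le> V s (x s) - 0 * (t - s)"
  proof (rule real_derivative_le_imp_bound[OF st(2)])
    fix r assume r: "s \<le> r" "r \<le> t"
    then have r': "r \<in> {t0..T}" "0 \<le> r" using st t0 by auto
    have xr: "x r \<in> Dom" using x r' by (auto simp: solution_on_def)
    show "((\<lambda>s. V s (x s)) has_real_derivative Vdot r (x r)) (at r within {s..t})"
      by (rule DERIV_subset[OF V_along[OF x r'(1)]]) (use st t0 in auto)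
    show "Vdot r (x r) \<le> - 0"
      using V_decrease[OF r'(2) xr] W_ball(12)[OF xr] by simp
  qed
  then show ?thesis by simp
qed

text \<open>The open ball and the complement of the closed ball are open and disjoint, and together
  they cover a connected trajectory that avoids the sphere. Open sets are used because
  \<open>\<rho>\<close> is known to be continuous only within balls.\<close>

lemma stays_in_ball:
  fixes t0 T :: real
  assumes x: "continuous_on {t0..T} x" and r: "ereal r < r0" and start: "\<rho> (x t0) < r"
    and no: "\<And>t. t \<in> {t0..T} \<Longrightarrow> \<rho> (x t) \<noteq> r" and t: "t \<in> {t0..T}"
  shows "\<rho> (x t) < r"
proof (rule ccontr)
  assume c: "\<not> \<rho> (x t) < r"
  let ?S = "x ` {t0..T}"
  have "connected ?S" by (rule connected_continuous_image[OF x connected_Icc])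
  moreover have "open {y. \<rho> y < r}" by (rule ball_open[OF r])
  moreover have "open (- {y. \<rho> y \<le> r})"
    by (rule open_Compl) (rule compact_imp_closed[OF cball_compact[OF r]])
  moreover have "{y. \<rho> y < r} \<inter> - {y. \<rho> y \<le> r} \<inter> ?S = {}" by auto
  moreover have "?S \<subseteq> {y. \<rho> y < r} \<union> - {y. \<rho> y \<le> r}" using no by force
  moreover have "{y. \<rho> y < r} \<inter> ?S \<noteq> {}" using start t by auto
  moreover have "- {y. \<rho> y \<le> r} \<inter> ?S \<noteq> {}" using c no[OF t] t by force
  ultimately show False unfolding connected_def by blast
qed

section \<open>The three stability assertions\<close>

text \<open>Splits the claim into confinement, which yields existence on the half-line, and an
  estimate for solutions already known to be global and confined. \<open>K\<close> may depend on the
  initial state, as no single compact set need serve a whole open ball.\<close>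

lemma KL_estimateI:
  assumes est: "\<And>x t0. 0 \<le> t0 \<Longrightarrow> solution_on A Dom f {t0..} x \<Longrightarrow> x t0 \<in> X0 \<Longrightarrow>
      (\<And>t. t0 \<le> t \<Longrightarrow> x t \<in> K (x t0)) \<Longrightarrow> (\<And>t. t0 \<le> t \<Longrightarrow> \<rho> (x t) \<le> \<beta> (\<rho> (x t0)) (t - t0))"
    and X0: "\<And>x0. x0 \<in> X0 \<Longrightarrow> ereal (\<rho> x0) < a"
    and K: "\<And>x0. x0 \<in> X0 \<Longrightarrow> compact (K x0) \<and> K x0 \<subseteq> Dom \<and> x0 \<in> K x0"
    and trap: "\<And>x t0 T. 0 \<le> t0 \<Longrightarrow> t0 \<le> T \<Longrightarrow> solution_on A Dom f {t0..T} x \<Longrightarrow> x t0 \<in> X0 \<Longrightarrow> x T \<in> K (x t0)"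
  shows "KL_estimate A g Dom f xs a \<beta> X0"
  unfolding KL_estimate_def
proof (intro allI impI ballI conjI)
  fix t0 x0 assume t0: "(0::real) \<le> t0" and x0: "x0 \<in> X0"
  show "ereal (\<rho> x0) < a" by (rule X0[OF x0])
  obtain x where x: "solution_on A Dom f {t0..} x" "x t0 = x0"
    and un: "\<And>T y. t0 < T \<Longrightarrow> solution_on A Dom f {t0..<T} y \<Longrightarrow> y t0 = x0 \<Longrightarrow> (\<forall>t\<in>{t0..<T}. y t = x t)"
  proof (rule solution_global[OF domain(1) field, of "K x0" t0 x0])
    show "y T \<in> K x0" if "t0 \<le> T" "solution_on A Dom f {t0..T} y" "y t0 = x0" for T y
      using trap[OF t0 that(1,2)] that(3) x0 by simp
  qed (use K[OF x0] t0 in auto)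
  have "\<rho> (x t) \<le> \<beta> (\<rho> (x t0)) (t - t0)" if "t0 \<le> t" for t
  proof (rule est[OF t0 x(1)])
    show "x s \<in> K (x t0)" if "t0 \<le> s" for s
      by (rule trap[OF t0 that solution_on_subset[OF x(1)]]) (use x x0 in auto)
  qed (use x x0 that in auto)
  then show "\<exists>x. solution_on A Dom f {t0..} x \<and> x t0 = x0
    \<and> (\<forall>T y. t0 < T \<and> solution_on A Dom f {t0..<T} y \<and> y t0 = x0 \<longrightarrow> (\<forall>t\<in>{t0..<T}. y t = x t))
    \<and> (\<forall>t\<ge>t0. \<rho> (x t) \<le> \<beta> (\<rho> (x t0)) (t - t0))"
    using x un by blast
qed

lemma V_solution:
  assumes x: "solution_on A Dom f {t0..} x" and t0: "0 \<le> t0" and t: "t0 \<le> t"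
  shows "W1 (x t) \<le> V t (x t)" "V t (x t) \<le> W2 (x t)"
    "((\<lambda>s. V s (x s)) has_real_derivative Vdot t (x t)) (at t within {t0..})"
    "Vdot t (x t) \<le> - W3 (x t)"
proof -
  have xt: "x t \<in> Dom" using x t by (auto simp: solution_on_def)
  show "W1 (x t) \<le> V t (x t)" "V t (x t) \<le> W2 (x t)" using V_bounds[OF _ xt, of t] t t0 by auto
  show "Vdot t (x t) \<le> - W3 (x t)" using V_decrease[OF _ xt, of t] t t0 by auto
  show "((\<lambda>s. V s (x s)) has_real_derivative Vdot t (x t)) (at t within {t0..})"
    by (rule V_along[OF x]) (use t t0 in auto)
qed

text \<open>Along a solution \<open>W1\<close> is at most the initial value of \<open>V\<close>,
  hence at most \<open>c\<close>, whereas on the sphere it exceeds \<open>c\<close>; so the sphere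
  is never reached.\<close>

lemma local_assertion:
  assumes r: "0 < r" "ereal r < r0" and c: "c < (INF x\<in>{x. rdist A g x xs = r}. W1 x)"
  shows "\<exists>a \<beta>. class_KL a \<beta> \<and> KL_estimate A g Dom f xs a \<beta> {x \<in> closure (rball A g xs (ereal r)). W2 x \<le> c}"
proof -
  let ?K = "{x. \<rho> x \<le> r}" and ?X0 = "{x \<in> closure (rball A g xs (ereal r)). W2 x \<le> c}"
  have KD: "?K \<subseteq> Dom" using cball_sub[OF r(2)] ball_sub by auto
  have cl: "closure (rball A g xs (ereal r)) \<subseteq> ?K"
    by (rule closure_minimal) (auto simp: rball_def compact_imp_closed[OF cball_compact[OF r(2)]])
  have sphere: "c < W1 x" if x: "\<rho> x = r" for x
  proof -
    have "bdd_below (W1 ` {x. rdist A g x xs = r})"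
      using KD W_ball(10) by (intro bdd_belowI[of _ 0]) (auto simp: rdist_commute[of _ xs])
    then have "(INF x\<in>{x. rdist A g x xs = r}. W1 x) \<le> W1 x"
      by (rule cINF_lower) (use x in \<open>simp add: rdist_commute[of _ xs]\<close>)
    with c show ?thesis by simp
  qed
  have ball: "x \<in> Ball0" if "x \<in> ?K" for x using cball_sub[OF r(2)] that by blast
  have xsK: "xs \<in> ?K" using rho_xs r by simp
  have "\<exists>\<beta>. class_KL \<infinity> \<beta> \<and> KL_bound \<infinity> \<beta> ?K \<rho> (\<lambda>_. 0) (\<lambda>_. 0) W1 W2 W3"
  \<comment> \<open>\<open>N\<close> and \<open>B\<close> are constant: on the compact ball
    \<open>W3\<close> is bounded below away from \<open>xs\<close>, so one decay rate serves all
    initial states.\<close>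
  proof (rule Lyapunov_class_KL[of \<infinity> ?K \<rho> W1 W2 W3 "\<lambda>_. 0" "\<lambda>_. 0"])
    show "?K \<noteq> {}" using xsK by blast
    show "0 \<le> \<rho> x" if "x \<in> ?K" for x using rho_ball(1)[of x] ball[OF that] by (simp add: rball_def)
    show "\<exists>d>0. \<forall>x\<in>?K. e \<le> \<rho> x \<longrightarrow> d \<le> W1 x" if "0 < e" for e
      using annulus_lower_bound[OF r(2) that W_ball(1)] W_ball(7) ball_sub by blast
    \<comment> \<open>Vacuous: no point of \<open>?K\<close> has distance \<open>r + 1\<close> or
      more.\<close>
    show "\<exists>b. \<forall>x\<in>?K. b \<le> \<rho> x \<longrightarrow> l \<le> W1 x" for l by (intro exI[of _ "r + 1"]) auto
    show "\<exists>d>0. \<forall>x\<in>?K. e \<le> W2 x \<longrightarrow> d \<le> \<rho> x" if "0 < e" for e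
      using small_near_xs[OF that W_ball(2,5)] ball by blast
    show "\<exists>d>0. \<forall>x\<in>?K. 0 \<le> n \<longrightarrow> e \<le> \<rho> x \<longrightarrow> d \<le> W3 x" if "0 < e" for e n :: real
      using annulus_lower_bound[OF r(2) that W_ball(3)] W_ball(9) ball_sub by blast
    show "\<exists>b. \<forall>x\<in>?K. \<rho> x \<le> q \<longrightarrow> 0 \<le> b \<and> W2 x \<le> b" if "ereal q < \<infinity>" for q
    proof -
      obtain b where "\<forall>x. \<rho> x \<le> r \<longrightarrow> W2 x \<le> b" using cball_bounded[OF r(2) W_ball(2)] by blast
      then show ?thesis by (intro exI[of _ "max 0 b"]) (auto simp: le_max_iff_disj)
    qed
  qed (use W_ball(10-12) KD in auto)
  then obtain \<beta> where \<beta>: "class_KL \<infinity> \<beta>" and est: "KL_bound \<infinity> \<beta> ?K \<rho> (\<lambda>_. 0) (\<lambda>_. 0) W1 W2 W3"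
    by blast
  have "KL_estimate A g Dom f xs \<infinity> \<beta> ?X0"
  proof (rule KL_estimateI[where K = "\<lambda>_. ?K"])
    fix x t0 t assume t0: "(0::real) \<le> t0" and x: "solution_on A Dom f {t0..} x"
      and K: "\<And>t. t0 \<le> t \<Longrightarrow> x t \<in> ?K" and t: "t0 \<le> t"
    show "\<rho> (x t) \<le> \<beta> (\<rho> (x t0)) (t - t0)"
      by (rule KL_boundD[OF est, where v = "\<lambda>s. V s (x s)" and w = "\<lambda>t. Vdot t (x t)"])
        (use V_solution[OF x t0] K t in auto)
  next
    fix x t0 T assume t: "(0::real) \<le> t0" "t0 \<le> T" and x: "solution_on A Dom f {t0..T} x" and x0: "x t0 \<in> ?X0"
    have x0D: "x t0 \<in> Dom" "\<rho> (x t0) \<le> r" "W2 (x t0) \<le> c" using x0 cl KD by auto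
    have no: "\<rho> (x s) \<noteq> r" if s: "s \<in> {t0..T}" for s
    proof
      assume "\<rho> (x s) = r"
      then have "c < W1 (x s)" by (rule sphere)
      also have "\<dots> \<le> V s (x s)" using V_bounds[of s "x s"] x s t by (auto simp: solution_on_def)
      also have "\<dots> \<le> V t0 (x t0)" by (rule V_antimono[OF x]) (use s t in auto)
      also have "\<dots> \<le> W2 (x t0)" using V_bounds[OF t(1) x0D(1)] by simp
      finally show False using x0D by simp
    qed
    have "\<rho> (x T) < r"
      by (rule stays_in_ball[OF solution_on_continuous[OF x] r(2) _ no]) (use no[of t0] x0D t in auto)
    then show "x T \<in> ?K" by simp
  qed (use cball_compact[OF r(2)] KD cl in auto)
  with \<beta> show ?thesis by blast
qed

lemma to_radius_limit:
  fixes U :: "'m \<Rightarrow> real"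
  assumes U: "filterlim U at_top (to_radius A g xs r0)"
  obtains r :: real where "0 < r" "ereal r < r0" "\<And>x. r \<le> \<rho> x \<Longrightarrow> ereal (\<rho> x) < r0 \<Longrightarrow> l \<le> U x"
proof -
  have "eventually (\<lambda>x. l \<le> U x) (to_radius A g xs r0)"
    using U by (simp add: filterlim_at_top)
  then obtain P where P: "eventually P (at_left r0)" "\<And>x. P (ereal (\<rho> x)) \<Longrightarrow> l \<le> U x"
    unfolding to_radius_def eventually_filtercomap by (auto simp: rdist_commute[of _ xs])
  obtain b where b: "b < r0" "\<And>y. b < y \<Longrightarrow> y < r0 \<Longrightarrow> P y"
    using P(1) eventually_at_left[OF r0_pos] by blast
  obtain r where r: "max b 0 < ereal r" "ereal r < r0"
    using ereal_dense2[of "max b 0" r0] b r0_pos by auto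
  show ?thesis
  proof (rule that)
    show "0 < r" using r by (simp add: zero_ereal_def)
    show "l \<le> U x" if x: "r \<le> \<rho> x" "ereal (\<rho> x) < r0" for x
    proof -
      have "b < ereal r" using r by simp
      also have "ereal r \<le> ereal (\<rho> x)" using x by simp
      finally show ?thesis using b(2) x(2) P(2) by blast
    qed
  qed (rule r(2))
qed

text \<open>\<open>N = U1\<close> and \<open>B = U2\<close> express that a trajectory stays in a
  sublevel set of \<open>U1\<close>. Since \<open>U1\<close> blows up at radius \<open>r0\<close>,
  such a set lies in a compact ball, where \<open>U3\<close> is bounded below away from
  \<open>xs\<close> even if it tends to 0 at radius \<open>r0\<close>.\<close>

lemma proper_Lyapunov_class_KL:
  fixes U1 U2 U3 :: "'m \<Rightarrow> real"
  assumes cont: "continuous_on (Ball0) U1" "continuous_on (Ball0) U2" "continuous_on (Ball0) U3"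
    and pos: "\<And>x. x \<in> Ball0 \<Longrightarrow> x \<noteq> xs \<Longrightarrow> 0 < U1 x" "\<And>x. x \<in> Ball0 \<Longrightarrow> x \<noteq> xs \<Longrightarrow> 0 < U3 x"
    and zero: "U1 xs = 0" "U2 xs = 0" "U3 xs = 0"
    and le: "\<And>x. x \<in> Ball0 \<Longrightarrow> U1 x \<le> U2 x"
    and lim: "filterlim U1 at_top (to_radius A g xs r0)"
  shows "\<exists>\<beta>. class_KL r0 \<beta> \<and> KL_bound r0 \<beta> Ball0 \<rho> U1 U2 U1 U2 U3"
proof (rule Lyapunov_class_KL[OF r0_pos, of "Ball0" \<rho> U1 U2 U3 U1 U2])
    have X: "x \<in> Ball0 \<longleftrightarrow> ereal (\<rho> x) < r0" for x by (simp add: rball_def)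
  have "xs \<in> Ball0" using rho_xs r0_pos by (simp add: X zero_ereal_def)
  then show "Ball0 \<noteq> {}" by blast
  show "0 \<le> \<rho> x" if "x \<in> Ball0" for x using rho_ball(1) that by (simp add: X)
  show U1: "0 \<le> U1 x" if "x \<in> Ball0" for x using pos(1)[OF that] zero by (cases "x = xs") auto
  show "0 \<le> U3 x" if "x \<in> Ball0" for x using pos(2)[OF that] zero by (cases "x = xs") auto
  show "0 \<le> U2 x" if "x \<in> Ball0" for x using U1[OF that] le[OF that] by simp
  show "\<exists>d>0. \<forall>x\<in>Ball0. e \<le> \<rho> x \<longrightarrow> d \<le> U1 x" if e: "0 < e" for e
  proof -
    obtain r where r: "ereal r < r0" "\<And>x. r \<le> \<rho> x \<Longrightarrow> ereal (\<rho> x) < r0 \<Longrightarrow> 1 \<le> U1 x"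
      using to_radius_limit[OF lim, of 1] by metis
    obtain d where d: "0 < d" "\<forall>x. e \<le> \<rho> x \<longrightarrow> \<rho> x \<le> r \<longrightarrow> d \<le> U1 x"
      using annulus_lower_bound[OF r(1) e cont(1) pos(1)] by auto
    have "min 1 d \<le> U1 x" if "x \<in> Ball0" "e \<le> \<rho> x" for x
      using d(2) r(2)[of x] that by (cases "\<rho> x \<le> r") (force simp: X min_le_iff_disj)+
    then show ?thesis using d(1) by (intro exI[of _ "min 1 d"]) auto
  qed
  show "\<exists>b. \<forall>x\<in>Ball0. b \<le> \<rho> x \<longrightarrow> l \<le> U1 x" for l
    using to_radius_limit[OF lim, of l] by (metis X)
  show "\<exists>d>0. \<forall>x\<in>Ball0. e \<le> U2 x \<longrightarrow> d \<le> \<rho> x" if "0 < e" for e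
    by (rule small_near_xs[OF that cont(2) zero(2)])
  show "\<exists>d>0. \<forall>x\<in>Ball0. U1 x \<le> n \<longrightarrow> e \<le> \<rho> x \<longrightarrow> d \<le> U3 x" if e: "0 < e" for n e
  proof -
    \<comment> \<open>From radius \<open>r\<close> on the value exceeds \<open>n\<close> by at least
      1, so the sublevel set lies within radius \<open>r\<close>.\<close>
    obtain r where r: "ereal r < r0" "\<And>x. r \<le> \<rho> x \<Longrightarrow> ereal (\<rho> x) < r0 \<Longrightarrow> n + 1 \<le> U1 x"
      using to_radius_limit[OF lim, of "n + 1"] by metis
    obtain d where d: "0 < d" "\<forall>x. e \<le> \<rho> x \<longrightarrow> \<rho> x \<le> r \<longrightarrow> d \<le> U3 x"
      using annulus_lower_bound[OF r(1) e cont(3) pos(2)] by auto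
    have "d \<le> U3 x" if "x \<in> Ball0" "U1 x \<le> n" "e \<le> \<rho> x" for x
      using d(2) r(2)[of x] that by (cases "\<rho> x \<le> r") (force simp: X)+
    then show ?thesis using d(1) by blast
  qed
  show "\<exists>b. \<forall>x\<in>Ball0. \<rho> x \<le> q \<longrightarrow> U2 x \<le> b \<and> U2 x \<le> b" if "ereal q < r0" for q
    using cball_bounded[OF that cont(2)] by blast
qed (use le in auto)

lemma antimono_of_derivative:
  fixes v w :: "real \<Rightarrow> real"
  assumes "\<And>t. t0 \<le> t \<Longrightarrow> (v has_real_derivative w t) (at t within {t0..})" "\<And>t. t0 \<le> t \<Longrightarrow> w t \<le> 0" "t0 \<le> t"
  shows "v t \<le> v t0"
proof -
  have "v t \<le> v t0 - 0 * (t - t0)"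
  proof (rule real_derivative_le_imp_bound[OF assms(3)])
    show "(v has_real_derivative w r) (at r within {t0..t})" if "t0 \<le> r" for r
      by (rule DERIV_subset[OF assms(1)[OF that]]) auto
  qed (use assms(2) in simp)
  then show ?thesis by simp
qed

text \<open>The growth of \<open>W1\<close> supplies, for each initial state, a sphere on which
  \<open>W1\<close> exceeds the value of \<open>W2\<close> at that state; this barrier takes the
  place of the level \<open>c\<close> in the local assertion.\<close>

lemma proper_assertion:
  assumes lim: "filterlim W1 at_top (to_radius A g xs r0)"
  shows "\<exists>\<beta>. class_KL r0 \<beta> \<and> KL_estimate A g Dom f xs r0 \<beta> (Ball0)"
proof -
    have "\<exists>\<beta>. class_KL r0 \<beta> \<and> KL_bound r0 \<beta> Ball0 \<rho> W1 W2 W1 W2 W3"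
    by (rule proper_Lyapunov_class_KL) (use W_ball ball_sub W1_le_W2 lim in auto)
  then obtain \<beta> where \<beta>: "class_KL r0 \<beta>" and est: "KL_bound r0 \<beta> Ball0 \<rho> W1 W2 W1 W2 W3"
    by blast
  have "\<exists>r. \<rho> x0 < r \<and> ereal r < r0 \<and> (\<forall>x. \<rho> x = r \<longrightarrow> W2 x0 < W1 x)" if x0: "x0 \<in> Ball0" for x0
  proof -
    obtain r1 where r1: "0 < r1" "ereal r1 < r0" "\<And>x. r1 \<le> \<rho> x \<Longrightarrow> ereal (\<rho> x) < r0 \<Longrightarrow> W2 x0 + 1 \<le> W1 x"
      using to_radius_limit[OF lim, of "W2 x0 + 1"] by metis
    \<comment> \<open>The sphere must lie beyond both the threshold \<open>r1\<close> and the
      initial point, and still inside radius \<open>r0\<close>.\<close>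
    have "ereal (max r1 (\<rho> x0)) < r0" using r1 x0 by (simp add: rball_def max_def)
    then obtain r where r: "ereal (max r1 (\<rho> x0)) < ereal r" "ereal r < r0" using ereal_dense2 by blast
    then have "W2 x0 < W1 x" if "\<rho> x = r" for x using r1(3)[of x] that by auto
    then show ?thesis using r by auto
  qed
  then obtain rad where rad: "\<And>x0. x0 \<in> Ball0 \<Longrightarrow> \<rho> x0 < rad x0 \<and> ereal (rad x0) < r0 \<and> (\<forall>x. \<rho> x = rad x0 \<longrightarrow> W2 x0 < W1 x)"
    by metis
  let ?K = "\<lambda>x0. {x. \<rho> x \<le> rad x0}"
  have "KL_estimate A g Dom f xs r0 \<beta> Ball0"
  proof (rule KL_estimateI[where K = ?K])
    fix x t0 t assume t0: "(0::real) \<le> t0" and x: "solution_on A Dom f {t0..} x" and x0: "x t0 \<in> Ball0"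
      and K: "\<And>t. t0 \<le> t \<Longrightarrow> x t \<in> ?K (x t0)" and t: "t0 \<le> t"
    have xX: "x t \<in> Ball0" if "t0 \<le> t" for t using K[OF that] cball_sub rad[OF x0] by blast
    have bound: "W1 (x t) \<le> W2 (x t0)" if t: "t0 \<le> t" for t
    proof -
      have "W1 (x t) \<le> V t (x t)" by (rule V_solution[OF x t0 t])
      also have "\<dots> \<le> V t0 (x t0)"
        by (rule V_antimono[OF solution_on_subset[OF x] t0]) (use t in auto)
      also have "\<dots> \<le> W2 (x t0)" by (rule V_solution[OF x t0 order_refl])
      finally show ?thesis .
    qed
    show "\<rho> (x t) \<le> \<beta> (\<rho> (x t0)) (t - t0)"
      by (rule KL_boundD[OF est, where v = "\<lambda>s. V s (x s)" and w = "\<lambda>t. Vdot t (x t)"])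
        (use V_solution[OF x t0] xX x0 bound t in \<open>auto simp: rball_def\<close>)
  next
    show "compact (?K x0) \<and> ?K x0 \<subseteq> Dom \<and> x0 \<in> ?K x0" if "x0 \<in> Ball0" for x0
      using cball_compact[of "rad x0"] cball_sub[of "rad x0"] ball_sub rad[OF that] by auto
  next
    fix x t0 T assume t: "(0::real) \<le> t0" "t0 \<le> T" and x: "solution_on A Dom f {t0..T} x" and x0: "x t0 \<in> Ball0"
    have no: "\<rho> (x s) \<noteq> rad (x t0)" if s: "s \<in> {t0..T}" for s
    proof
      assume "\<rho> (x s) = rad (x t0)"
      then have "W2 (x t0) < W1 (x s)" using rad[OF x0] by blast
      also have "\<dots> \<le> V s (x s)" using V_bounds[of s "x s"] x s t by (auto simp: solution_on_def)
      also have "\<dots> \<le> V t0 (x t0)" by (rule V_antimono[OF x]) (use s t in auto)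
      also have "\<dots> \<le> W2 (x t0)" using V_bounds[OF t(1), of "x t0"] x0 ball_sub by blast
      finally show False by simp
    qed
    have "\<rho> (x T) < rad (x t0)"
      by (rule stays_in_ball[OF solution_on_continuous[OF x] _ _ no]) (use rad[OF x0] t in auto)
    then show "x T \<in> ?K (x t0)" by simp
  qed (simp add: rball_def)
  with \<beta> show ?thesis by blast
qed

lemma rho_sq_along:
  assumes vel: "has_velocity A J x t X" and t: "t \<in> J" and x: "x t \<in> Ball0"
  shows "((\<lambda>s. (\<rho> (x s))\<^sup>2) has_real_derivative mdiff A (\<lambda>y. (rdist A g y xs)\<^sup>2) (x t) X) (at t within J)"
proof -
  obtain R where "exp_ball A g xs c0 R" and r: "ereal (\<rho> (x t)) < R"
    using radius[of "\<rho> (x t)"] x by (auto simp: rball_def)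
  then interpret E: exp_ball A g xs c0 R by simp
  have "((\<lambda>s. (rdist A g (x s) xs)\<^sup>2) has_real_derivative mdiff A (\<lambda>y. (rdist A g y xs)\<^sup>2) (x t) X) (at t within J)"
    by (rule mdiff_along[OF vel t E.rdist_sq_differentiable]) (use r in \<open>auto simp: rball_def\<close>)
  then show ?thesis by (simp add: rdist_commute[of _ xs])
qed

text \<open>The quotient of \<open>V\<close> by \<open>r0\<^sup>2 - \<rho>\<^sup>2\<close> is a Lyapunov function of the kind treated before: since
  \<open>\<rho>\<close> does not increase along trajectories, dividing only improves the decrease of \<open>V\<close>.\<close>

lemma radial_assertion:
  assumes fin: "r0 < \<infinity>"
    and lim: "filterlim (\<lambda>x. W1 x / ((real_of_ereal r0)\<^sup>2 - (rdist A g x xs)\<^sup>2)) at_top (to_radius A g xs r0)"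
    and radial: "\<And>t x. 0 \<le> t \<Longrightarrow> x \<in> Ball0 \<Longrightarrow> mdiff A (\<lambda>y. (rdist A g y xs)\<^sup>2) x (f t x) \<le> 0"
  shows "\<exists>\<beta>. class_KL r0 \<beta> \<and> KL_estimate A g Dom f xs r0 \<beta> (Ball0)"
proof -
    define R where "R = real_of_ereal r0"
  have R: "r0 = ereal R" "0 < R" using fin r0_pos by (cases r0; simp add: R_def zero_ereal_def)+
  have X: "x \<in> Ball0 \<longleftrightarrow> \<rho> x < R" for x by (simp add: rball_def R)
  have rho0: "0 \<le> \<rho> x" if "x \<in> Ball0" for x using rho_ball(1)[of x] that by (simp add: rball_def)
  define h where "h x = R\<^sup>2 - (\<rho> x)\<^sup>2" for x
  have h: "0 < h x" if "x \<in> Ball0" for x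
    using power_strict_mono[of "\<rho> x" R 2] rho0[OF that] that by (simp add: h_def X)
  have ch: "continuous_on Ball0 h" unfolding h_def by (intro continuous_intros rho_continuous)
  define U1 U2 U3 where "U1 x = W1 x / h x" and "U2 x = W2 x / h x" and "U3 x = W3 x / h x" for x
  have Uc: "continuous_on Ball0 U1" "continuous_on Ball0 U2" "continuous_on Ball0 U3"
    unfolding U1_def U2_def U3_def using h by (intro continuous_intros ch W_ball(1-3); force)+
  have lim': "filterlim U1 at_top (to_radius A g xs r0)"
    using lim by (simp add: U1_def[abs_def] h_def R_def rdist_commute[of _ xs])
  have "\<exists>\<beta>. class_KL r0 \<beta> \<and> KL_bound r0 \<beta> Ball0 \<rho> U1 U2 U1 U2 U3"
  proof (rule proper_Lyapunov_class_KL[OF Uc _ _ _ _ _ _ lim'])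
    show "0 < U1 x" "0 < U3 x" if "x \<in> Ball0" "x \<noteq> xs" for x
      using h[OF that(1)] W_ball(7,9)[of x] that ball_sub by (auto simp: U1_def U3_def)
    show "U1 x \<le> U2 x" if "x \<in> Ball0" for x
      unfolding U1_def U2_def using h[OF that] W1_le_W2[of x] that ball_sub by (intro divide_right_mono) auto
  qed (simp_all add: U1_def U2_def U3_def W_ball)
  then obtain \<beta> where \<beta>: "class_KL r0 \<beta>" and est: "KL_bound r0 \<beta> Ball0 \<rho> U1 U2 U1 U2 U3"
    by blast
  \<comment> \<open>The distance cannot increase, so any radius strictly between the initial
    distance and \<open>R\<close> gives a trapping ball; the midpoint is one.\<close>
  let ?K = "\<lambda>x0. {x. \<rho> x \<le> (\<rho> x0 + R) / 2}"
  have Kr: "ereal ((\<rho> x0 + R) / 2) < r0" "\<rho> x0 < (\<rho> x0 + R) / 2" if "x0 \<in> Ball0" for x0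
    using that unfolding X by (auto simp: R(1))
  have "KL_estimate A g Dom f xs r0 \<beta> Ball0"
  proof (rule KL_estimateI[where K = ?K])
    fix x t0 t assume t0: "(0::real) \<le> t0" and x: "solution_on A Dom f {t0..} x" and x0: "x t0 \<in> Ball0"
      and K: "\<And>t. t0 \<le> t \<Longrightarrow> x t \<in> ?K (x t0)" and t: "t0 \<le> t"
    have xX: "x t \<in> Ball0" if "t0 \<le> t" for t using K[OF that] cball_sub[OF Kr(1)[OF x0]] by blast
    define v where "v s = V s (x s) / h (x s)" for s
    define w where "w t = (Vdot t (x t) * h (x t)
        - V t (x t) * - mdiff A (\<lambda>y. (rdist A g y xs)\<^sup>2) (x t) (f t (x t))) / (h (x t) * h (x t))" for t
    have dv: "(v has_real_derivative w t) (at t within {t0..})" if t: "t0 \<le> t" for t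
    proof -
      have "has_velocity A {t0..} x t (f t (x t))" using x t by (auto simp: solution_on_def)
      from DERIV_diff[OF DERIV_const[of "R\<^sup>2"] rho_sq_along[OF this _ xX[OF t]]] t
      have "((\<lambda>s. h (x s)) has_real_derivative - mdiff A (\<lambda>y. (rdist A g y xs)\<^sup>2) (x t) (f t (x t))) (at t within {t0..})"
        by (simp add: h_def)
      from DERIV_divide[OF V_solution(3)[OF x t0 t] this] show ?thesis
        using h[OF xX[OF t]] by (simp add: v_def[abs_def] w_def)
    qed
    \<comment> \<open>In the quotient rule the term with the derivative of \<open>h\<close> is
      \<open>V\<close> times the derivative of the squared distance, nonpositive because
      \<open>V \<ge> 0\<close>. Division by \<open>h\<close> turns the remaining bound by
      \<open>W3\<close> into one by \<open>U3\<close>.\<close>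
    have w_le: "w t \<le> - U3 (x t)" if t: "t0 \<le> t" for t
    proof -
      have "0 \<le> V t (x t)" using V_solution(1)[OF x t0 t] W_ball(10)[of "x t"] xX[OF t] ball_sub by force
      then have "V t (x t) * mdiff A (\<lambda>y. (rdist A g y xs)\<^sup>2) (x t) (f t (x t)) \<le> 0"
        using radial[of t "x t"] xX[OF t] t t0 by (simp add: mult_nonneg_nonpos)
      moreover have "Vdot t (x t) * h (x t) \<le> - W3 (x t) * h (x t)"
        using V_solution(4)[OF x t0 t] h[OF xX[OF t]] by (intro mult_right_mono) auto
      ultimately have "w t \<le> (- W3 (x t) * h (x t)) / (h (x t) * h (x t))"
        unfolding w_def using h[OF xX[OF t]] by (intro divide_right_mono) auto
      also have "\<dots> = - U3 (x t)" using h[OF xX[OF t]] by (simp add: U3_def)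
      finally show ?thesis .
    qed
    have U3: "0 \<le> U3 (x t)" if "t0 \<le> t" for t
      using h[OF xX[OF that]] W_ball(12)[of "x t"] xX[OF that] ball_sub by (auto simp: U3_def)
    have vb: "U1 (x t) \<le> v t" "v t \<le> U2 (x t)" if "t0 \<le> t" for t
      unfolding U1_def U2_def v_def using h[OF xX[OF that]] V_solution(1,2)[OF x t0 that]
      by (auto intro!: divide_right_mono)
    have vm: "v t \<le> v t0" if "t0 \<le> t" for t
      by (rule antimono_of_derivative[OF dv _ that]) (use w_le U3 in force)+
    show "\<rho> (x t) \<le> \<beta> (\<rho> (x t0)) (t - t0)"
    proof (rule KL_boundD[OF est, where v = v and w = w])
      show "x t \<in> Ball0 \<and> U1 (x t) \<le> U2 (x t0) \<and> U1 (x t) \<le> v t \<and> v t \<le> U2 (x t)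
        \<and> (v has_real_derivative w t) (at t within {t0..}) \<and> w t \<le> - U3 (x t)" if "t0 \<le> t" for t
        using that xX vb vm dv w_le by (meson order_refl order_trans)
    qed (use x0 t in \<open>simp_all add: rball_def\<close>)
  next
    show "compact (?K x0) \<and> ?K x0 \<subseteq> Dom \<and> x0 \<in> ?K x0" if "x0 \<in> Ball0" for x0
      using cball_compact[OF Kr(1)[OF that]] cball_sub[OF Kr(1)[OF that]] ball_sub Kr(2)[OF that] by auto
  next
    fix x t0 T assume t: "(0::real) \<le> t0" "t0 \<le> T" and x: "solution_on A Dom f {t0..T} x" and x0: "x t0 \<in> Ball0"
    define r where "r = (\<rho> (x t0) + R) / 2"
    have r: "ereal r < r0" "\<rho> (x t0) < r" using Kr[OF x0] by (auto simp: r_def)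
    define M where "M = {s \<in> {t0..T}. \<rho> (x s) = r}"
    have cx: "continuous_on {t0..T} x" by (rule solution_on_continuous[OF x])
    \<comment> \<open>\<open>radial\<close> is available only inside the ball of radius
      \<open>r0\<close>. Up to the first hitting time of the sphere of radius \<open>r\<close> the
      solution remains inside, so the squared distance cannot have grown from its initial value to
      \<open>r^2\<close>.\<close>
    have no: "M = {}"
    proof (rule ccontr)
      assume ne: "M \<noteq> {}"
      have "M = {t0..T} \<inter> x -` ({y. \<rho> y \<le> r} - {y. \<rho> y < r})" by (auto simp: M_def)
      moreover have "closed ({y. \<rho> y \<le> r} - {y. \<rho> y < r})"
        by (intro closed_Diff compact_imp_closed cball_compact ball_open r)
      ultimately have "closed M" using continuous_closed_preimage[OF cx] by auto
      have bdd: "bdd_below M" by (rule bdd_belowI[of _ t0]) (auto simp: M_def)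
      define \<tau> where "\<tau> = Inf M"
      have \<tau>M: "\<tau> \<in> M" unfolding \<tau>_def by (rule closed_contains_Inf[OF ne bdd \<open>closed M\<close>])
      have before: "\<rho> (x s) < r" if "t0 \<le> s" "s < \<tau>" for s
      proof (rule stays_in_ball[of t0 s x])
        show "continuous_on {t0..s} x" by (rule continuous_on_subset[OF cx]) (use that \<tau>M in \<open>auto simp: M_def\<close>)
        show "\<rho> (x s') \<noteq> r" if "s' \<in> {t0..s}" for s'
          using cInf_lower[OF _ bdd, of s'] that \<open>s < \<tau>\<close> \<tau>M by (force simp: M_def \<tau>_def)
      qed (use r that in auto)
      have inX: "x s \<in> Ball0" if "t0 \<le> s" "s \<le> \<tau>" for s
        using before[of s] that \<tau>M cball_sub[OF r(1)] by (cases "s = \<tau>") (force simp: M_def)+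
      have "(\<rho> (x \<tau>))\<^sup>2 \<le> (\<rho> (x t0))\<^sup>2 - 0 * (\<tau> - t0)"
      proof (rule real_derivative_le_imp_bound)
        show "t0 \<le> \<tau>" using \<tau>M by (simp add: M_def)
        fix s assume s: "t0 \<le> s" "s \<le> \<tau>"
        then have s': "s \<in> {t0..T}" using \<tau>M by (auto simp: M_def)
        have "has_velocity A {t0..T} x s (f s (x s))" using x s' by (auto simp: solution_on_def)
        from rho_sq_along[OF this s' inX[OF s]]
        show "((\<lambda>s. (\<rho> (x s))\<^sup>2) has_real_derivative mdiff A (\<lambda>y. (rdist A g y xs)\<^sup>2) (x s) (f s (x s))) (at s within {t0..\<tau>})"
          by (rule DERIV_subset) (use \<tau>M in \<open>auto simp: M_def\<close>)
        show "mdiff A (\<lambda>y. (rdist A g y xs)\<^sup>2) (x s) (f s (x s)) \<le> - 0"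
          using radial[OF _ inX[OF s]] s t by simp
      qed
      then have "r\<^sup>2 \<le> (\<rho> (x t0))\<^sup>2" using \<tau>M by (simp add: M_def)
      moreover have "(\<rho> (x t0))\<^sup>2 < r\<^sup>2" using r rho0[OF x0] by (intro power_strict_mono) auto
      ultimately show False by simp
    qed
    have "\<rho> (x T) < r"
      by (rule stays_in_ball[OF cx r]) (use no t in \<open>auto simp: M_def\<close>)
    then show "x T \<in> ?K (x t0)" by (simp add: r_def)
  qed (simp add: rball_def)
  with \<beta> show ?thesis by blast
qed

end

theorem theorem2p1:
  fixes A :: "('m::{t2_space,second_countable_topology}, 'e::euclidean_space) chart set"
    and g :: "('m, 'e) metric"
    and xs :: 'm and D :: "'m set"
    and f :: "real \<Rightarrow> 'm \<Rightarrow> ('m, 'e) tvec"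
    and V :: "real \<Rightarrow> 'm \<Rightarrow> real"
    and W1 W2 W3 :: "'m \<Rightarrow> real"
    and r0 :: ereal
  assumes manifold: "complete_riemannian_manifold A g" "connected (UNIV :: 'm set)"
    and domain: "open D" "xs \<in> D" "D \<subseteq> rball A g xs (inj_radius A g xs)"
    and field: "vector_field_on A D f" "continuous_in_time A D f" "locally_lipschitz_in_state A D f"
    and equilibrium: "\<forall>t\<ge>0. f t xs = (\<lambda>c. 0)"
    and r0: "r0 = (SUP r\<in>{r::real. 0 < r \<and> rball A g xs (ereal r) \<subseteq> D}. ereal r)"
    and V: "C1_time_state A D V"
    and W: "continuous_on D W1" "continuous_on D W2" "continuous_on D W3"
           "pos_def_on D xs W1" "pos_def_on D xs W2" "pos_def_on D xs W3"
    and V_bounds: "\<forall>t\<ge>0. \<forall>x\<in>D. W1 x \<le> V t x \<and> V t x \<le> W2 x"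
    and V_decrease: "\<forall>t\<ge>0. \<forall>x\<in>D. time_deriv V t x + mdiff A (V t) x (f t x) \<le> - W3 x"
  shows
    "(\<forall>r::real. 0 < r \<and> ereal r < r0 \<longrightarrow>
        (\<forall>c. 0 < c \<and> c < (INF x\<in>{x. rdist A g x xs = r}. W1 x) \<longrightarrow>
           (\<exists>a \<beta>. class_KL a \<beta> \<and>
              KL_estimate A g D f xs a \<beta>
                {x \<in> closure (rball A g xs (ereal r)). W2 x \<le> c})))
     \<and> (filterlim W1 at_top (to_radius A g xs r0) \<longrightarrow>
          (\<exists>\<beta>. class_KL r0 \<beta> \<and> KL_estimate A g D f xs r0 \<beta> (rball A g xs r0)))
     \<and> (r0 < \<infinity>
        \<and> filterlim (\<lambda>x. W1 x / ((real_of_ereal r0)\<^sup>2 - (rdist A g x xs)\<^sup>2)) at_top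
            (to_radius A g xs r0)
        \<and> (\<forall>t\<ge>0. \<forall>x\<in>rball A g xs r0. mdiff A (\<lambda>y. (rdist A g y xs)\<^sup>2) x (f t x) \<le> 0) \<longrightarrow>
          (\<exists>\<beta>. class_KL r0 \<beta> \<and> KL_estimate A g D f xs r0 \<beta> (rball A g xs r0)))"
proof -
  have atlas: "smooth_atlas A" and metric: "riemannian_metric A g"
    and complete: "\<And>x X. X \<in> tangent_space A x \<Longrightarrow> \<exists>\<gamma>. geodesic_from A g x X \<gamma>"
    using manifold(1) by (auto simp: complete_riemannian_manifold_def)
  interpret riemannian A g by unfold_locales (rule atlas metric)+
  obtain c0 where c0: "c0 \<in> A" "xs \<in> cdom c0" by (rule chart_at)
  interpret lyapunov A g xs c0 D f V W1 W2 W3 r0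
    by unfold_locales (use complete c0 domain field r0 V W V_bounds V_decrease in auto)
  show ?thesis
    using local_assertion proper_assertion radial_assertion by blast
qed

end
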